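(* Let $\mu,\nu$ be compactly supported probability measures on $\mathbb{R}$ such that $\mu$ is non-degenerate. Then: (a) Let $z<z^*_{\mu\boxplus\nu}$ and assume that $h^>_{\mu,\nu}(z)$ is a solution of $F_{\mu,\nu}(h)=z$. Let $g=G_\nu(h^>_{\mu,\nu}(z))$. If $(0,g)\subset-D_\mu^+$, then $g$ is a local maximum or an inflection point of $E_{\mu,\nu,z}$. (b) Let $z<z^*_{\mu\boxplus\nu}$. For any $u\in[-\infty,0)$ and $v\in\big(g^*_{\mu\boxplus\nu},G_\nu(h^>_{\mu,\nu}(z))\big)$ such that $(u,v)\subset-D_\mu^+$, $$U_{\mu\boxplus\nu}(z)=\inf_{g\in\mathcal{E}_{\mu,\nu,z}\cap(u,v)}E_{\mu,\nu,z}(g).$$ (c) If $F_{\mu,\nu}$ is strictly concave and $\mathcal{E}_{\mu,\nu,z}\subset-D_\mu^+$, then the following holds for the given $\mu,\nu$: - if $z>z^*_{\mu\boxplus\nu}$, then $E_{\mu,\nu,z}$ has no critical points; - if $z=z^*_{\mu\boxplus\nu}$, then $E_{\mu,\nu,z}$ has a unique critical point at $g=g^*_{\mu\boxplus\nu}$, which is an inflection point; - if $z<z^*_{\mu\boxplus\nu}$, then $E_{\mu,\nu,z}$ has a unique local minimum at $g=G_{\mu\boxplus\nu}(z)$, and at most one additional critical point, which if present is a local maximum in $(G_{\mu\boxplus\nu}(z),\infty)$.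
   Context: For a compactly supported probability measure $\rho$ on $\mathbb{R}$: $\operatorname{supp}_-\rho$ and $\operatorname{supp}_+\rho$ are the infimum and supremum of its support; $\rho$ is non-degenerate if it is not a Dirac mass. $U_\rho(z)=\int\log|z-\lambda|\rho(d\lambda)$. $G_\rho(z)=\int\frac{\rho(d\lambda)}{\lambda-z}$ (note the sign). On the real line, $G_\rho$ is strictly increasing and positive on $(-\infty,\operatorname{supp}_-\rho)$, strictly increasing and negative on $(\operatorname{supp}_+\rho,\infty)$; set $G_\rho(\operatorname{supp}_-\rho)=\lim_{z\uparrow\operatorname{supp}_-\rho}G_\rho(z)\in(0,\infty]$ and $G_\rho(\operatorname{supp}_+\rho)=\lim_{z\downarrow\operatorname{supp}_+\rho}G_\rho(z)\in[-\infty,0)$. $G_\rho^{\langle-1\rangle}$ is the inverse of $G_\rho$ restricted to $\mathbb{R}\setminus[\operatorname{supp}_-\rho,\operatorname{supp}_+\rho]$. Let $\hat D_\rho=(-G_\rho(\operatorname{supp}_-\rho),-G_\rho(\operatorname{supp}_+\rho))$, and $\hat R_\rho(t)=G_\rho^{\langle-1\rangle}(-t)-t^{-1}$ for $t\in\hat D_\rho\setminus\{0\}$. The real $R$-transform $R_\rho:D_\rho\to\mathbb{R}$ is the unique real analytic extension of $\hat R_\rho$ to a maximal open interval $D_\rho\supset\hat D_\rho$ (so $0\in D_\rho$). The free additive convolution $\mu\boxplus\nu$ is the unique compactly supported probability measure with $D_\mu\cap D_\nu\subset D_{\mu\boxplus\nu}$ and $R_{\mu\boxplus\nu}=R_\mu+R_\nu$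 on $D_\mu\cap D_\nu$. $D_\mu^+=\{t\in D_\mu:R_\mu'(t)>0\}$. $z^*_{\mu\boxplus\nu}=\operatorname{supp}_-(\mu\boxplus\nu)$ and $g^*_{\mu\boxplus\nu}=G_{\mu\boxplus\nu}(z^*_{\mu\boxplus\nu})\in(0,\infty]$. Throughout, $z$ is real. $F_{\mu,\nu}(h)=R_\mu(-G_\nu(h))+h$ for $h\in\operatorname{dom}(F_{\mu,\nu})=\{h\in(-\infty,\operatorname{supp}_-\nu):G_\nu(h)\in-D_\mu\}$. $h^>_{\mu,\nu}(z)$ is the second solution of $F_{\mu,\nu}(h)=z$ from the left, if such a solution exists, and otherwise $h^>_{\mu,\nu}(z)=\sup\operatorname{dom}(F_{\mu,\nu})$. $\mathcal{E}_{\mu,\nu,z}=\{g\in-D_\mu: z-R_\mu(-g)<\operatorname{supp}_-\nu\}$, and for $g\in\mathcal{E}_{\mu,\nu,z}$ $$E_{\mu,\nu,z}(g)=\int_0^g sR_\mu'(-s)\,ds+\int\log(\lambda-z+R_\mu(-g))\,\nu(d\lambda).$$ An inflection point of $E_{\mu,\nu,z}$ here means a critical point that is not a local extremum.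
   Formalization: In (c), second bullet, the critical point at g* is claimed only if g* lies in the domain of E; otherwise E has no critical point. As written it fails for mu = nu = 0.9 delta_0 + 0.1 delta_1, where z* = 0, g* is infinite and E has no critical point. *)

theory Defs
  imports "HOL-Probability.Probability"
begin

section \<open>Compactly supported probability measures on the real line\<close>

definition supp :: "real measure \<Rightarrow> real set" where
  "supp \<rho> = {x. \<forall>U. open U \<and> x \<in> U \<longrightarrow> emeasure \<rho> U > 0}"

definition supp_lower :: "real measure \<Rightarrow> real" where
  "supp_lower \<rho> = Inf (supp \<rho>)"

definition supp_upper :: "real measure \<Rightarrow> real" where
  "supp_upper \<rho> = Sup (supp \<rho>)"

definition compactly_supported :: "real measure \<Rightarrow> bool" where
  "compactly_supported \<rho> \<longleftrightarrow> real_distribution \<rho> \<and> compact (supp \<rho>)"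

definition non_degenerate :: "real measure \<Rightarrow> bool" where
  "non_degenerate \<rho> \<longleftrightarrow> (\<forall>a. \<rho> \<noteq> return borel a)"

definition log_potential :: "real measure \<Rightarrow> real \<Rightarrow> real" where
  "log_potential \<rho> z = (\<integral>x. ln \<bar>z - x\<bar> \<partial>\<rho>)"


section \<open>The Stieltjes transform\<close>

text \<open>The sign convention makes it positive to the left of the support.\<close>

definition stieltjes :: "real measure \<Rightarrow> real \<Rightarrow> real" where
  "stieltjes \<rho> z = (\<integral>x. 1 / (x - z) \<partial>\<rho>)"

text \<open>The values at the two edges of the support, possibly infinite. They are separate
  constants because the edges coincide for a Dirac mass while the two limits do not.\<close>

definition stieltjes_lower_edge :: "real measure \<Rightarrow> ereal" where
  "stieltjes_lower_edge \<rho> = Lim (at_left (supp_lower \<rho>)) (\<lambda>z. ereal (stieltjes \<rho> z))"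

definition stieltjes_upper_edge :: "real measure \<Rightarrow> ereal" where
  "stieltjes_upper_edge \<rho> = Lim (at_right (supp_upper \<rho>)) (\<lambda>z. ereal (stieltjes \<rho> z))"

text \<open>The Stieltjes transform on the half-line up to and including the lower edge.\<close>

definition stieltjes_left :: "real measure \<Rightarrow> real \<Rightarrow> ereal" where
  "stieltjes_left \<rho> z =
     (if z = supp_lower \<rho> then stieltjes_lower_edge \<rho> else ereal (stieltjes \<rho> z))"

definition stieltjes_inv :: "real measure \<Rightarrow> real \<Rightarrow> real" where
  "stieltjes_inv \<rho> = the_inv_into (- {supp_lower \<rho>..supp_upper \<rho>}) (stieltjes \<rho>)"


section \<open>The real R-transform\<close>

definition real_analytic_on :: "(real \<Rightarrow> real) \<Rightarrow> real set \<Rightarrow> bool" where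
  "real_analytic_on f S \<longleftrightarrow>
     (\<forall>x\<in>S. \<exists>r>0. \<exists>a::nat \<Rightarrow> real. \<forall>y. \<bar>y - x\<bar> < r \<longrightarrow> (\<lambda>n. a n * (y - x) ^ n) sums f y)"

definition R_hat_domain :: "real measure \<Rightarrow> real set" where
  "R_hat_domain \<rho> =
     {t. - stieltjes_lower_edge \<rho> < ereal t \<and> ereal t < - stieltjes_upper_edge \<rho>}"

definition R_hat :: "real measure \<Rightarrow> real \<Rightarrow> real" where
  "R_hat \<rho> t = stieltjes_inv \<rho> (- t) - 1 / t"

definition R_extension :: "real measure \<Rightarrow> real set \<Rightarrow> (real \<Rightarrow> real) \<Rightarrow> bool" where
  "R_extension \<rho> I f \<longleftrightarrow>
     open I \<and> is_interval I \<and> R_hat_domain \<rho> \<subseteq> I \<and> real_analytic_on f I \<and>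
     (\<forall>t\<in>R_hat_domain \<rho> - {0}. f t = R_hat \<rho> t)"

text \<open>By the identity theorem any two extensions agree on the intersection of their intervals,
  so they glue together: the union below is the largest interval carrying an extension, and the
  extension chosen in \<open>R_transform\<close> is unique on it (its values elsewhere are irrelevant).\<close>

definition R_domain :: "real measure \<Rightarrow> real set" where
  "R_domain \<rho> = \<Union>{I. \<exists>f. R_extension \<rho> I f}"

definition R_transform :: "real measure \<Rightarrow> real \<Rightarrow> real" where
  "R_transform \<rho> = (SOME f. R_extension \<rho> (R_domain \<rho>) f)"

definition R_domain_plus :: "real measure \<Rightarrow> real set" where
  "R_domain_plus \<rho> = {t \<in> R_domain \<rho>. deriv (R_transform \<rho>) t > 0}"

text \<open>\<open>is_free_convolution \<mu> \<nu> \<rho>\<close> says that \<open>\<rho>\<close> is the free additive convolution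
  of \<open>\<mu>\<close> and \<open>\<nu>\<close>; it is stated as a relation, since the measure is specified by its
  characterizing property.\<close>

definition is_free_convolution :: "real measure \<Rightarrow> real measure \<Rightarrow> real measure \<Rightarrow> bool" where
  "is_free_convolution \<mu> \<nu> \<rho> \<longleftrightarrow>
     compactly_supported \<rho> \<and> R_domain \<mu> \<inter> R_domain \<nu> \<subseteq> R_domain \<rho> \<and>
     (\<forall>t\<in>R_domain \<mu> \<inter> R_domain \<nu>. R_transform \<rho> t = R_transform \<mu> t + R_transform \<nu> t)"


section \<open>The functions F and E\<close>

definition F_domain :: "real measure \<Rightarrow> real measure \<Rightarrow> real set" where
  "F_domain \<mu> \<nu> = {h. h < supp_lower \<nu> \<and> stieltjes \<nu> h \<in> uminus ` R_domain \<mu>}"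

definition F_fun :: "real measure \<Rightarrow> real measure \<Rightarrow> real \<Rightarrow> real" where
  "F_fun \<mu> \<nu> h = R_transform \<mu> (- stieltjes \<nu> h) + h"

text \<open>The second solution from the left is the one having exactly one solution to its left.\<close>

definition F_second_solution :: "real measure \<Rightarrow> real measure \<Rightarrow> real \<Rightarrow> real \<Rightarrow> bool" where
  "F_second_solution \<mu> \<nu> z h \<longleftrightarrow>
     h \<in> F_domain \<mu> \<nu> \<and> F_fun \<mu> \<nu> h = z \<and>
     card {h' \<in> F_domain \<mu> \<nu>. h' < h \<and> F_fun \<mu> \<nu> h' = z} = 1"

definition h_second :: "real measure \<Rightarrow> real measure \<Rightarrow> real \<Rightarrow> real" where
  "h_second \<mu> \<nu> z =
     (if \<exists>h. F_second_solution \<mu> \<nu> z h then THE h. F_second_solution \<mu> \<nu> z h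
      else Sup (F_domain \<mu> \<nu>))"

definition E_domain :: "real measure \<Rightarrow> real measure \<Rightarrow> real \<Rightarrow> real set" where
  "E_domain \<mu> \<nu> z =
     {g \<in> uminus ` R_domain \<mu>. z - R_transform \<mu> (- g) < supp_lower \<nu>}"

text \<open>The interval integral is oriented, as needed for negative \<open>g\<close>.\<close>

definition E_fun :: "real measure \<Rightarrow> real measure \<Rightarrow> real \<Rightarrow> real \<Rightarrow> real" where
  "E_fun \<mu> \<nu> z g =
     (LBINT s=ereal 0..ereal g. s * deriv (R_transform \<mu>) (- s)) +
     (\<integral>x. ln (x - z + R_transform \<mu> (- g)) \<partial>\<nu>)"


section \<open>Critical points and strict concavity\<close>

text \<open>Critical points and inflection points are only used for open sets \<open>S\<close>.\<close>

definition critical_point_on :: "real set \<Rightarrow> (real \<Rightarrow> real) \<Rightarrow> real \<Rightarrow> bool" where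
  "critical_point_on S f x \<longleftrightarrow> x \<in> S \<and> (f has_real_derivative 0) (at x)"

definition local_max_on :: "real set \<Rightarrow> (real \<Rightarrow> real) \<Rightarrow> real \<Rightarrow> bool" where
  "local_max_on S f x \<longleftrightarrow> x \<in> S \<and> (\<forall>\<^sub>F y in at x within S. f y \<le> f x)"

definition local_min_on :: "real set \<Rightarrow> (real \<Rightarrow> real) \<Rightarrow> real \<Rightarrow> bool" where
  "local_min_on S f x \<longleftrightarrow> x \<in> S \<and> (\<forall>\<^sub>F y in at x within S. f x \<le> f y)"

definition inflection_point_on :: "real set \<Rightarrow> (real \<Rightarrow> real) \<Rightarrow> real \<Rightarrow> bool" where
  "inflection_point_on S f x \<longleftrightarrow>
     critical_point_on S f x \<and> \<not> local_max_on S f x \<and> \<not> local_min_on S f x"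

definition strictly_concave_on :: "real set \<Rightarrow> (real \<Rightarrow> real) \<Rightarrow> bool" where
  "strictly_concave_on S f \<longleftrightarrow>
     convex S \<and>
     (\<forall>x\<in>S. \<forall>y\<in>S. \<forall>t. x \<noteq> y \<and> 0 < t \<and> t < 1 \<longrightarrow>
        (1 - t) * f x + t * f y < f ((1 - t) * x + t * y))"

end

theory Submission
  imports Defs "HOL-Complex_Analysis.Complex_Analysis"
begin

text \<open>
  Where the derivative of the R-transform is positive, the derivative of \<open>E\<close> at \<open>g = G\<^sub>\<nu>(h)\<close> has
  the sign of \<open>F(h) - z\<close>. In the coordinate \<open>g\<close>, \<open>F\<close> is \<open>R\<^sub>\<rho>(-g) - 1/g\<close>, which inverts \<open>G\<^sub>\<rho>\<close> and is
  therefore increasing up to the edge value \<open>G\<^sub>\<rho>(supp\<^sub>- \<rho>)\<close>. There \<open>F\<close> is stationary: otherwise \<open>G\<^sub>\<rho>\<close> would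
  continue analytically across the edge of the support, which positivity of its Taylor coefficients
  forbids. The value of \<open>E\<close> at \<open>G\<^sub>\<rho>(z)\<close> is \<open>U\<^sub>\<rho>(z)\<close> because both have derivative \<open>-G\<^sub>\<rho>(z)\<close> in \<open>z\<close>
  and agree asymptotically at minus infinity.

  That the edge value of \<open>\<rho>\<close> does not exceed those of \<open>\<mu>\<close> and \<open>\<nu>\<close> is proved without complex subordination.
  The functions \<open>\<omega>\<^sub>1 = G\<^sub>\<mu>\<^sup>-\<^sup>1 \<circ> G\<^sub>\<rho>\<close> and \<open>\<omega>\<^sub>2 = G\<^sub>\<nu>\<^sup>-\<^sup>1 \<circ> G\<^sub>\<rho>\<close> satisfy \<open>\<omega>\<^sub>1 + \<omega>\<^sub>2 + 1/G\<^sub>\<rho> = id\<close>. By Kaluza's lemma on reciprocals of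
  log-convex power series, this is a recursion which makes all their Taylor coefficients nonnegative.
\<close>

section \<open>Real analytic functions\<close>

text \<open>The hypothesis on \<rho> relates the three R-transforms on a common domain and says
  nothing about the edges of the supports. Below the edge value of a measure its R-transform at -g
  is K(g) + 1/g, with K the inverse of G, so \<open>F\<close> is recognised as the inverse of
  G_\<rho> only where this formula holds for all three measures. Hence the comparison of edge
  values: without it nothing would force -g into the domain of R_\<mu> for every g up to the edge
  value of \<rho>. Conversely, R_\<mu> may extend beyond these values, so \<open>F\<close> can
  continue past the edge value of \<rho>, where it no longer inverts G_\<rho>; there only its value
  and its zero slope at the edge, continuity, and the counting of solutions or concavity are
  available.

  The recursion for the subordination functions closes because 1/G_\<rho> equals both (1/G_\<mu>) o
  \<omega>1 and (1/G_\<nu>) o \<omega>2: it can be expanded in either unknown. Kaluza's lemma gives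
  the sign of the coefficients of 1/G_\<mu> and 1/G_\<nu>, and the variance of 1/(x - z) bounds the
  linear ones by -1.\<close>

abbreviation agrees_on_reals :: "(complex \<Rightarrow> complex) \<Rightarrow> (real \<Rightarrow> real) \<Rightarrow> real \<Rightarrow> bool" where
  "agrees_on_reals fc f x \<equiv> \<forall>\<^sub>F t in nhds x. fc (of_real t) = of_real (f t)"

text \<open>Stated through a local holomorphic extension, so that composition, inversion and
  uniqueness are inherited from complex analysis; \<open>real_analytic_on_iff\<close> returns to
  convergent real series.\<close>

definition real_analytic_at :: "(real \<Rightarrow> real) \<Rightarrow> real \<Rightarrow> bool" where
  "real_analytic_at f x \<longleftrightarrow>
     (\<exists>fc. fc analytic_on {complex_of_real x} \<and>
        (agrees_on_reals fc f x))"

lemma eventually_nhds_of_real: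
  assumes "eventually P (nhds (complex_of_real x))"
  shows "\<forall>\<^sub>F t in nhds x. P (complex_of_real t)"
proof -
  have "isCont complex_of_real x" by simp
  hence "filterlim complex_of_real (nhds (complex_of_real x)) (nhds x)"
    unfolding isCont_def tendsto_at_iff_tendsto_nhds by simp
  thus ?thesis using assms by (simp add: filterlim_iff)
qed

lemma eventually_nhds_imp_at: "eventually P (nhds x) \<Longrightarrow> eventually P (at x)"
  by (simp add: eventually_nhds_conv_at)

lemma isCont_filterlim_nhds: "isCont f x \<Longrightarrow> filterlim f (nhds (f x)) (nhds x)"
  unfolding isCont_def tendsto_at_iff_tendsto_nhds .

lemma real_analytic_at_cong:
  assumes "real_analytic_at f x" "\<forall>\<^sub>F t in nhds x. f t = g t"
  shows "real_analytic_at g x"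
proof -
  obtain fc where fc: "fc analytic_on {complex_of_real x}"
    "agrees_on_reals fc f x"
    using assms(1) unfolding real_analytic_at_def by blast
  have "agrees_on_reals fc g x"
    using fc(2) assms(2) by eventually_elim simp
  with fc(1) show ?thesis unfolding real_analytic_at_def by blast
qed

lemma real_analytic_at_const: "real_analytic_at (\<lambda>_. c) x"
  unfolding real_analytic_at_def by (rule exI[of _ "\<lambda>_. complex_of_real c"]) auto

lemma real_analytic_at_id: "real_analytic_at (\<lambda>t. t) x"
  unfolding real_analytic_at_def by (rule exI[of _ "\<lambda>z. z"]) auto

lemma
  assumes "real_analytic_at f x" "real_analytic_at g x"
  shows real_analytic_at_add: "real_analytic_at (\<lambda>t. f t + g t) x"
    and real_analytic_at_diff: "real_analytic_at (\<lambda>t. f t - g t) x"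
    and real_analytic_at_mult: "real_analytic_at (\<lambda>t. f t * g t) x"
proof -
  obtain fc where fc: "fc analytic_on {complex_of_real x}"
    "agrees_on_reals fc f x"
    using assms(1) unfolding real_analytic_at_def by blast
  obtain gc where gc: "gc analytic_on {complex_of_real x}"
    "agrees_on_reals gc g x"
    using assms(2) unfolding real_analytic_at_def by blast
  have ev: "\<forall>\<^sub>F t in nhds x. fc (complex_of_real t) = complex_of_real (f t) \<and> gc (complex_of_real t) = complex_of_real (g t)"
    using fc(2) gc(2) by (rule eventually_conj)
  show "real_analytic_at (\<lambda>t. f t + g t) x"
    unfolding real_analytic_at_def
    by (rule exI[of _ "\<lambda>z. fc z + gc z"]) (auto intro!: analytic_on_add fc gc intro: eventually_mono[OF ev])
  show "real_analytic_at (\<lambda>t. f t - g t) x"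
    unfolding real_analytic_at_def
    by (rule exI[of _ "\<lambda>z. fc z - gc z"]) (auto intro!: analytic_on_diff fc gc intro: eventually_mono[OF ev])
  show "real_analytic_at (\<lambda>t. f t * g t) x"
    unfolding real_analytic_at_def
    by (rule exI[of _ "\<lambda>z. fc z * gc z"]) (auto intro!: analytic_on_mult fc gc intro: eventually_mono[OF ev])
qed

lemma real_analytic_at_minus: "real_analytic_at f x \<Longrightarrow> real_analytic_at (\<lambda>t. - f t) x"
  using real_analytic_at_diff[OF real_analytic_at_const[of 0 x], of f] by simp

lemma real_analytic_at_inverse:
  assumes "real_analytic_at f x" "f x \<noteq> 0"
  shows "real_analytic_at (\<lambda>t. inverse (f t)) x"
proof -
  obtain fc where fc: "fc analytic_on {complex_of_real x}"
    "agrees_on_reals fc f x"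
    using assms(1) unfolding real_analytic_at_def by blast
  have "fc (complex_of_real x) = complex_of_real (f x)" using fc(2) by (rule eventually_nhds_x_imp_x)
  thus ?thesis unfolding real_analytic_at_def using assms(2)
    by (intro exI[of _ "\<lambda>z. inverse (fc z)"]) (auto intro!: analytic_on_inverse fc intro: eventually_mono[OF fc(2)])
qed

lemma real_analytic_at_divide:
  assumes "real_analytic_at f x" "real_analytic_at g x" "g x \<noteq> 0"
  shows "real_analytic_at (\<lambda>t. f t / g t) x"
  using real_analytic_at_mult[OF assms(1) real_analytic_at_inverse[OF assms(2,3)]]
  by (simp add: divide_inverse)

lemma holomorphic_ball_of_analytic_at:
  assumes "fc analytic_on {complex_of_real x}"
    and "agrees_on_reals fc f x"
  obtains e where "e > 0" "fc holomorphic_on ball (complex_of_real x) e"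
    "\<And>t. \<bar>t - x\<bar> < e \<Longrightarrow> fc (complex_of_real t) = complex_of_real (f t)"
proof -
  obtain e1 where e1: "e1 > 0" "fc holomorphic_on ball (complex_of_real x) e1"
    using assms(1) unfolding analytic_on_def by auto
  obtain e2 where e2: "e2 > 0" "\<And>t. dist t x < e2 \<Longrightarrow> fc (complex_of_real t) = complex_of_real (f t)"
    using assms(2) unfolding eventually_nhds_metric by blast
  show ?thesis
  proof (rule that[of "min e1 e2"])
    show "fc holomorphic_on ball (complex_of_real x) (min e1 e2)"
      using e1(2) by (rule holomorphic_on_subset) auto
  qed (use e1 e2 in \<open>auto simp: dist_real_def\<close>)
qed

lemma dist_of_real_complex: "dist (complex_of_real a) (complex_of_real b) = \<bar>a - b\<bar>"
  by (metis dist_of_real dist_real_def)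

lemma real_analytic_at_eventually:
  assumes "real_analytic_at f x"
  shows "\<forall>\<^sub>F y in nhds x. real_analytic_at f y"
proof -
  obtain fc where fc: "fc analytic_on {complex_of_real x}"
    "agrees_on_reals fc f x"
    using assms(1) unfolding real_analytic_at_def by blast
  obtain e where e: "e > 0" "fc holomorphic_on ball (complex_of_real x) e"
    "\<And>t. \<bar>t - x\<bar> < e \<Longrightarrow> fc (complex_of_real t) = complex_of_real (f t)"
    using holomorphic_ball_of_analytic_at[OF fc] by metis
  have "real_analytic_at f y" if "y \<in> ball x e" for y
    unfolding real_analytic_at_def
  proof (intro exI conjI)
    have "complex_of_real y \<in> ball (complex_of_real x) e"
      using that by (simp add: dist_of_real_complex dist_real_def)
    thus "fc analytic_on {complex_of_real y}"
      using e(2) by (meson analytic_on_open analytic_on_subset empty_subsetI insert_subset open_ball)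
    have "\<forall>\<^sub>F t in nhds y. t \<in> ball x e" using that by (intro eventually_nhds_in_open) auto
    thus "agrees_on_reals fc f y"
      by eventually_elim (auto simp: e(3) dist_real_def abs_minus_commute)
  qed
  moreover have "\<forall>\<^sub>F y in nhds x. y \<in> ball x e" using e(1) by (intro eventually_nhds_in_open) auto
  ultimately show ?thesis by (auto elim: eventually_mono)
qed

text \<open>Taking real parts of the complex Taylor coefficients avoids showing that they are real.\<close>

lemma real_analytic_at_uniform_expansion:
  assumes "real_analytic_at f x0"
  shows "\<exists>r>0. \<forall>x. \<bar>x - x0\<bar> < r \<longrightarrow>
       (\<exists>F. fps_conv_radius F \<ge> ereal r \<and> (\<forall>t. \<bar>t\<bar> < r \<longrightarrow> (\<lambda>n. fps_nth F n * t ^ n) sums f (x + t)))"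
proof -
  obtain fc where fc: "fc analytic_on {complex_of_real x0}"
    "agrees_on_reals fc f x0"
    using assms(1) unfolding real_analytic_at_def by blast
  obtain e where e: "e > 0" "fc holomorphic_on ball (complex_of_real x0) e"
    "\<And>t. \<bar>t - x0\<bar> < e \<Longrightarrow> fc (complex_of_real t) = complex_of_real (f t)"
    using holomorphic_ball_of_analytic_at[OF fc] by metis
  \<comment> \<open>Halving the radius makes it independent of the centre: every centre closer than
    \<open>e/2\<close> to \<open>x0\<close> has a disc of radius \<open>e/2\<close> inside the
    original one. The edge argument re-expands at a nearby centre and needs its disc to cross the
    edge.\<close>
  have "\<exists>F. fps_conv_radius F \<ge> ereal (e/2) \<and> (\<forall>t. \<bar>t\<bar> < e/2 \<longrightarrow> (\<lambda>n. fps_nth F n * t ^ n) sums f (x + t))"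
    if x: "\<bar>x - x0\<bar> < e/2" for x
  proof -
    define F :: "real fps" where "F = Abs_fps (\<lambda>n. Re ((deriv ^^ n) fc (of_real x) / fact n))"
    have sub: "ball (complex_of_real x) (e/2) \<subseteq> ball (complex_of_real x0) e"
      using x dist_of_real_complex[of x x0] by (intro ball_subset_ball_iff[THEN iffD2] disjI1) linarith
    have s: "(\<lambda>n. fps_nth F n * t ^ n) sums f (x + t)" if t: "\<bar>t\<bar> < e/2" for t
    proof -
      have inb: "complex_of_real (x + t) \<in> ball (complex_of_real x) (e/2)"
        using t by (simp add: dist_norm)
      have "(\<lambda>n. (deriv ^^ n) fc (of_real x) / fact n * (of_real (x + t) - of_real x) ^ n) sums fc (of_real (x + t))"
        by (rule holomorphic_power_series[OF holomorphic_on_subset[OF e(2) sub] inb])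
      hence "(\<lambda>n. Re ((deriv ^^ n) fc (of_real x) / fact n * (of_real (x + t) - of_real x) ^ n)) sums Re (fc (of_real (x + t)))"
        by (rule sums_Re)
      moreover have "Re (c * (of_real (x + t) - of_real x) ^ n) = Re c * t ^ n" for c :: complex and n
        by (simp flip: of_real_power)
      moreover have "fc (of_real (x + t)) = of_real (f (x + t))" using t x by (intro e(3)) linarith
      ultimately show ?thesis by (simp only: F_def fps_nth_Abs_fps Re_complex_of_real)
    qed
    have "fps_conv_radius F \<ge> ereal (e/2)"
      unfolding fps_conv_radius_def
    proof (rule conv_radius_geI_ex)
      fix r' :: real assume r': "r' > 0" "ereal r' < ereal (e/2)"
      thus "\<exists>z. norm z = r' \<and> summable (\<lambda>n. fps_nth F n * z ^ n)"
        using s[of r'] by (intro exI[of _ r']) (auto simp: sums_iff)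
    qed
    with s show ?thesis by blast
  qed
  with e(1) show ?thesis by (intro exI[of _ "e/2"]) auto
qed

section \<open>Complexified power series and uniqueness of real expansions\<close>

text \<open>Identities between real series are proved for the complexified series, where agreement
  on the real axis spreads to a disc, and pulled back by injectivity.\<close>

definition complex_fps :: "real fps \<Rightarrow> complex fps" where
  "complex_fps F = Abs_fps (\<lambda>n. complex_of_real (fps_nth F n))"

lemma complex_fps_nth [simp]: "fps_nth (complex_fps F) n = complex_of_real (fps_nth F n)"
  by (simp add: complex_fps_def)

lemma complex_fps_mult: "complex_fps (F * G) = complex_fps F * complex_fps G"
  by (rule fps_ext) (simp add: fps_mult_nth)

lemma complex_fps_1: "complex_fps 1 = 1"
  by (rule fps_ext) simp

lemma complex_fps_power: "complex_fps (F ^ n) = complex_fps F ^ n"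
  by (induction n) (simp_all add: complex_fps_1 complex_fps_mult)

lemma complex_fps_compose: "complex_fps (F oo G) = complex_fps F oo complex_fps G"
  by (rule fps_ext) (simp add: fps_compose_nth flip: complex_fps_power)

lemma complex_fps_inj: "complex_fps F = complex_fps G \<Longrightarrow> F = G"
  by (metis complex_fps_nth fps_ext of_real_eq_iff)

lemma complex_fps_conv_radius: "fps_conv_radius (complex_fps F) = fps_conv_radius F"
proof -
  have "conv_radius (\<lambda>n. norm (fps_nth (complex_fps F) n)) = conv_radius (\<lambda>n. norm (fps_nth F n))"
    by simp
  thus ?thesis unfolding fps_conv_radius_def conv_radius_norm .
qed

lemma eval_complex_fps:
  assumes "ereal \<bar>t\<bar> < fps_conv_radius F"
  shows "eval_fps (complex_fps F) (complex_of_real t) = complex_of_real (eval_fps F t)"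
proof -
  have "(\<lambda>n. fps_nth F n * t ^ n) sums eval_fps F t"
    using assms by (intro sums_eval_fps) auto
  hence "(\<lambda>n. complex_of_real (fps_nth F n * t ^ n)) sums complex_of_real (eval_fps F t)"
    by (rule sums_of_real)
  thus ?thesis by (simp add: eval_fps_def sums_iff)
qed

lemma eventually_in_conv_radius:
  fixes F :: "'a :: {banach, real_normed_div_algebra} fps"
  assumes "fps_conv_radius F > 0"
  shows "\<forall>\<^sub>F t in nhds (0::'a). ereal (norm t) < fps_conv_radius F"
proof -
  have "\<forall>\<^sub>F t in nhds (0::'a). t \<in> eball 0 (fps_conv_radius F)"
    using assms by (intro eventually_nhds_in_open) (auto simp: zero_ereal_def)
  thus ?thesis by simp
qed

text \<open>For the converse direction, the complexified series, recentred at \<open>x\<close>, is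
  itself the holomorphic extension.\<close>

lemma real_analytic_at_iff_has_fps_expansion:
  "real_analytic_at f x \<longleftrightarrow> (\<exists>F. (\<lambda>t. f (x + t)) has_fps_expansion F)"
proof
  assume h: "real_analytic_at f x"
  obtain r where r: "r > 0"
    "\<forall>y. \<bar>y - x\<bar> < r \<longrightarrow>
       (\<exists>F. fps_conv_radius F \<ge> ereal r \<and> (\<forall>t. \<bar>t\<bar> < r \<longrightarrow> (\<lambda>n. fps_nth F n * t ^ n) sums f (y + t)))"
    using real_analytic_at_uniform_expansion[OF h] by (elim exE conjE)
  obtain F where F: "\<And>t. \<bar>t\<bar> < r \<Longrightarrow> (\<lambda>n. fps_nth F n * t ^ n) sums f (x + t)"
    using r(2)[rule_format, of x] r(1) by auto
  have "\<forall>\<^sub>F t in nhds 0. t \<in> ball 0 r" using r(1) by (intro eventually_nhds_in_open) auto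
  hence "(\<lambda>t. f (x + t)) has_fps_expansion F"
    by (rule has_fps_expansionI[OF eventually_mono]) (use F in \<open>auto simp: dist_real_def\<close>)
  thus "\<exists>F. (\<lambda>t. f (x + t)) has_fps_expansion F" by blast
next
  assume "\<exists>F. (\<lambda>t. f (x + t)) has_fps_expansion F"
  then obtain F where F: "fps_conv_radius F > 0" "\<forall>\<^sub>F t in nhds 0. eval_fps F t = f (x + t)"
    unfolding has_fps_expansion_def by blast
  have ev: "\<forall>\<^sub>F t in nhds 0. eval_fps (complex_fps F) (complex_of_real t) = complex_of_real (f (x + t))"
    using F(2) eventually_in_conv_radius[OF F(1)] by eventually_elim (simp add: eval_complex_fps)
  show "real_analytic_at f x"
    unfolding real_analytic_at_def
  proof (intro exI conjI)
    have "eval_fps (complex_fps F) has_fps_expansion complex_fps F"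
      using F(1) by (intro eval_fps_has_fps_expansion) (simp add: complex_fps_conv_radius)
    thus "(\<lambda>z. eval_fps (complex_fps F) (z - complex_of_real x)) analytic_on {complex_of_real x}"
      by (intro has_fps_expansion_imp_analytic[where F = "complex_fps F"]) simp
    have "filterlim (\<lambda>t. t - x) (nhds 0) (nhds x)"
      using isCont_filterlim_nhds[where f = "\<lambda>t. t - x" and x = x] by simp
    from eventually_compose_filterlim[OF ev this]
    show "\<forall>\<^sub>F t in nhds x. eval_fps (complex_fps F) (complex_of_real t - complex_of_real x) = complex_of_real (f t)"
      by simp
  qed
qed

lemma has_fps_expansion_complex_lift:
  assumes "f has_fps_expansion F"
  obtains fc where "fc has_fps_expansion complex_fps F"
    "agrees_on_reals fc f 0"
proof (rule that)
  have F: "fps_conv_radius F > 0" "\<forall>\<^sub>F t in nhds 0. eval_fps F t = f t"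
    using assms unfolding has_fps_expansion_def by blast+
  show "eval_fps (complex_fps F) has_fps_expansion complex_fps F"
    using F(1) by (intro eval_fps_has_fps_expansion) (simp add: complex_fps_conv_radius)
  show "\<forall>\<^sub>F t in nhds 0. eval_fps (complex_fps F) (complex_of_real t) = complex_of_real (f t)"
    using F(2) eventually_in_conv_radius[OF F(1)] by eventually_elim (simp add: eval_complex_fps)
qed

text \<open>Agreement is only required frequently at \<open>x\<close>, that is, at real points
  accumulating there: the zeros of \<open>fc - gc\<close> then have a limit point inside a disc. The
  weak hypothesis is what the closedness half of the identity theorem on intervals supplies.\<close>

lemma analytic_at_eq_if_eq_on_reals:
  assumes "fc analytic_on {complex_of_real x}" "gc analytic_on {complex_of_real x}"
    and "\<exists>\<^sub>F t in at x. fc (complex_of_real t) = gc (complex_of_real t)"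
  shows "\<forall>\<^sub>F z in nhds (complex_of_real x). fc z = gc z"
proof -
  have "(\<lambda>z. fc z - gc z) analytic_on {complex_of_real x}"
    using assms by (intro analytic_on_diff)
  then obtain e where e: "e > 0" "(\<lambda>z. fc z - gc z) holomorphic_on ball (complex_of_real x) e"
    unfolding analytic_on_def by auto
  let ?U = "{z \<in> ball (complex_of_real x) e. fc z - gc z = 0}"
  have "complex_of_real x islimpt ?U"
  proof (rule islimptI)
    fix T assume T: "complex_of_real x \<in> T" "open T"
    have "\<forall>\<^sub>F z in nhds (complex_of_real x). z \<in> T \<inter> ball (complex_of_real x) e"
      using T e(1) by (intro eventually_nhds_in_open) auto
    from eventually_nhds_of_real[OF this] have "\<forall>\<^sub>F t in at x. complex_of_real t \<in> T \<inter> ball (complex_of_real x) e"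
      by (rule eventually_nhds_imp_at)
    moreover have "\<forall>\<^sub>F t in at x. t \<noteq> x" by (simp add: eventually_at_filter)
    ultimately have "\<forall>\<^sub>F t in at x. complex_of_real t \<in> T \<inter> ball (complex_of_real x) e \<and> t \<noteq> x"
      by (rule eventually_conj)
    with assms(3) have "\<exists>\<^sub>F t in at x. fc (complex_of_real t) = gc (complex_of_real t) \<and>
        complex_of_real t \<in> T \<inter> ball (complex_of_real x) e \<and> t \<noteq> x"
      by (rule frequently_eventually_frequently)
    then obtain t where "fc (complex_of_real t) = gc (complex_of_real t)"
        "complex_of_real t \<in> T \<inter> ball (complex_of_real x) e" "t \<noteq> x"
      using frequently_ex by blast
    thus "\<exists>y\<in>?U. y \<in> T \<and> y \<noteq> complex_of_real x"
      by (intro bexI[of _ "complex_of_real t"]) auto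
  qed
  note lim = this
  have "fc z - gc z = 0" if "z \<in> ball (complex_of_real x) e" for z
    by (rule analytic_continuation[OF e(2) open_ball connected_ball _ _ lim _ that]) (use e(1) in auto)
  moreover have "\<forall>\<^sub>F z in nhds (complex_of_real x). z \<in> ball (complex_of_real x) e"
    using e(1) by (intro eventually_nhds_in_open) auto
  ultimately show ?thesis by (auto elim!: eventually_mono)
qed

text \<open>The existence of \<open>H\<close> is assumed, and the lemma only identifies it. Both
  complex lifts agree on the real axis near 0, hence near 0, so their coefficients coincide. With
  the identity as inner function this becomes uniqueness of expansions.\<close>

lemma has_fps_expansion_real_compose:
  fixes F G :: "real fps"
  assumes "f has_fps_expansion F" "g has_fps_expansion G" "fps_nth G 0 = 0"
    and "(\<lambda>t. f (g t)) has_fps_expansion H"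
  shows "H = F oo G"
proof -
  obtain fc where fc: "fc has_fps_expansion complex_fps F"
    "agrees_on_reals fc f 0"
    using has_fps_expansion_complex_lift[OF assms(1)] .
  obtain gc where gc: "gc has_fps_expansion complex_fps G"
    "agrees_on_reals gc g 0"
    using has_fps_expansion_complex_lift[OF assms(2)] .
  obtain hc where hc: "hc has_fps_expansion complex_fps H"
    "\<forall>\<^sub>F t in nhds 0. hc (complex_of_real t) = complex_of_real (f (g t))"
    using has_fps_expansion_complex_lift[OF assms(4)] .
  have c: "(fc \<circ> gc) has_fps_expansion (complex_fps F oo complex_fps G)"
    by (rule has_fps_expansion_compose[OF fc(1) gc(1)]) (simp add: assms(3))
  have g0: "g 0 = 0"
  proof -
    have "\<forall>\<^sub>F t in nhds 0. eval_fps G t = g t" using assms(2) unfolding has_fps_expansion_def by blast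
    from eventually_nhds_x_imp_x[OF this] show ?thesis by (simp add: eval_fps_at_0 assms(3))
  qed
  have "isCont g 0" using has_fps_expansion_imp_continuous[OF assms(2)] by simp
  hence "filterlim g (nhds 0) (nhds 0)"
    using isCont_filterlim_nhds g0 by fastforce
  from eventually_compose_filterlim[OF fc(2) this] gc(2) hc(2)
  have "\<forall>\<^sub>F t in nhds 0. hc (complex_of_real t) = (fc \<circ> gc) (complex_of_real t)"
    by eventually_elim simp
  hence "\<forall>\<^sub>F t in at 0. hc (complex_of_real t) = (fc \<circ> gc) (complex_of_real t)"
    by (rule eventually_nhds_imp_at)
  hence "\<exists>\<^sub>F t in at (0::real). hc (complex_of_real t) = (fc \<circ> gc) (complex_of_real t)"
    by (rule eventually_frequently[rotated]) simp
  hence "\<forall>\<^sub>F z in nhds (complex_of_real 0). hc z = (fc \<circ> gc) z"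
    using has_fps_expansion_imp_analytic_0[OF c] has_fps_expansion_imp_analytic_0[OF hc(1)]
    by (intro analytic_at_eq_if_eq_on_reals) (simp_all del: o_apply)
  hence ev0: "\<forall>\<^sub>F z in nhds 0. hc z = (fc \<circ> gc) z" by simp
  have ev1: "\<forall>\<^sub>F z in nhds 0. eval_fps (complex_fps H) z = hc z"
    "\<forall>\<^sub>F z in nhds 0. eval_fps (complex_fps F oo complex_fps G) z = (fc \<circ> gc) z"
    using c hc(1) unfolding has_fps_expansion_def by blast+
  from ev0 ev1 have ev: "\<forall>\<^sub>F z in nhds 0. eval_fps (complex_fps H) z = eval_fps (complex_fps F oo complex_fps G) z"
    by eventually_elim simp
  have "complex_fps H = complex_fps F oo complex_fps G"
    using c hc(1) ev unfolding has_fps_expansion_def by (intro eval_fps_eqD) auto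
  thus ?thesis by (intro complex_fps_inj) (simp add: complex_fps_compose)
qed

lemma has_fps_expansion_real_unique:
  fixes F G :: "real fps"
  assumes "f has_fps_expansion F" "f has_fps_expansion G"
  shows "F = G"
  using has_fps_expansion_real_compose[OF assms(1) has_fps_expansion_fps_X _ assms(2)] by simp

lemma has_fps_expansion_nth_0:
  fixes F :: "real fps"
  assumes "(\<lambda>t. f (x + t)) has_fps_expansion F"
  shows "f x = fps_nth F 0"
proof -
  have "\<forall>\<^sub>F t in nhds 0. eval_fps F t = f (x + t)" using assms unfolding has_fps_expansion_def by blast
  from eventually_nhds_x_imp_x[OF this] show ?thesis by (simp add: eval_fps_at_0)
qed

lemma has_fps_expansion_has_derivative:
  fixes F :: "real fps"
  assumes "(\<lambda>t. f (x + t)) has_fps_expansion F"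
  shows "(f has_real_derivative fps_nth F 1) (at x)"
proof -
  have F: "fps_conv_radius F > 0" "\<forall>\<^sub>F t in nhds 0. eval_fps F t = f (x + t)"
    using assms unfolding has_fps_expansion_def by blast+
  have "(eval_fps F has_field_derivative eval_fps (fps_deriv F) 0) (at 0)"
    using F(1) by (intro has_field_derivative_eval_fps) (auto simp: zero_ereal_def)
  hence "((\<lambda>t. f (x + t)) has_field_derivative eval_fps (fps_deriv F) 0) (at 0)"
    by (rule has_field_derivative_cong_eventually[THEN iffD1, rotated 2])
      (use F(2) eventually_nhds_x_imp_x[OF F(2)] in \<open>auto intro: eventually_nhds_imp_at\<close>)
  hence "(f has_field_derivative eval_fps (fps_deriv F) 0) (at x)"
    using DERIV_shift[of f _ 0 x] by (simp add: add.commute)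
  thus ?thesis by (simp add: eval_fps_at_0)
qed

lemma real_analytic_at_has_derivative:
  assumes "real_analytic_at f x"
  shows "(f has_real_derivative deriv f x) (at x)"
proof -
  obtain F where "(\<lambda>t. f (x + t)) has_fps_expansion F"
    using assms unfolding real_analytic_at_iff_has_fps_expansion by blast
  from has_fps_expansion_has_derivative[OF this] show ?thesis by (simp add: DERIV_imp_deriv)
qed

lemma real_analytic_at_isCont: "real_analytic_at f x \<Longrightarrow> isCont f x"
  using real_analytic_at_has_derivative DERIV_isCont by blast

lemma real_analytic_at_deriv:
  assumes "real_analytic_at f x"
  shows "real_analytic_at (deriv f) x"
proof -
  obtain F where F: "(\<lambda>t. f (x + t)) has_fps_expansion F"
    using assms unfolding real_analytic_at_iff_has_fps_expansion by blast
  have "deriv (\<lambda>t. f (x + t)) has_fps_expansion fps_deriv F"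
    using F by (rule has_fps_expansion_deriv)
  moreover have "\<forall>\<^sub>F t in nhds 0. deriv (\<lambda>t. f (x + t)) t = deriv f (x + t)"
  proof -
    have "filterlim (\<lambda>t. x + t) (nhds x) (nhds 0)"
      using isCont_filterlim_nhds[where f = "\<lambda>t. x + t" and x = 0] by simp
    from eventually_compose_filterlim[OF real_analytic_at_eventually[OF assms] this]
    show ?thesis
    proof eventually_elim
      case (elim t)
      have "((\<lambda>t. f (x + t)) has_real_derivative deriv f (x + t)) (at t)"
        using real_analytic_at_has_derivative[OF elim] DERIV_shift[of f _ t x] by (simp add: add.commute)
      thus ?case by (rule DERIV_imp_deriv)
    qed
  qed
  ultimately have "(\<lambda>t. deriv f (x + t)) has_fps_expansion fps_deriv F"
    using has_fps_expansion_cong[of "deriv (\<lambda>t. f (x + t))" "\<lambda>t. deriv f (x + t)"] by blast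
  thus ?thesis unfolding real_analytic_at_iff_has_fps_expansion by blast
qed

lemma real_analytic_at_compose:
  assumes "real_analytic_at f x" "real_analytic_at g (f x)"
  shows "real_analytic_at (\<lambda>t. g (f t)) x"
proof -
  obtain fc where fc: "fc analytic_on {complex_of_real x}"
    "agrees_on_reals fc f x"
    using assms(1) unfolding real_analytic_at_def by blast
  obtain gc where gc: "gc analytic_on {complex_of_real (f x)}"
    "agrees_on_reals gc g (f x)"
    using assms(2) unfolding real_analytic_at_def by blast
  have fx: "fc (complex_of_real x) = complex_of_real (f x)" using fc(2) by (rule eventually_nhds_x_imp_x)
  have "filterlim f (nhds (f x)) (nhds x)"
    using real_analytic_at_isCont[OF assms(1)] by (rule isCont_filterlim_nhds)
  from eventually_compose_filterlim[OF gc(2) this] fc(2)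
  have "\<forall>\<^sub>F t in nhds x. (gc \<circ> fc) (complex_of_real t) = complex_of_real (g (f t))"
    by eventually_elim simp
  moreover have "(gc \<circ> fc) analytic_on {complex_of_real x}"
    using fc(1) gc(1) fx by (intro analytic_on_compose) auto
  ultimately show ?thesis unfolding real_analytic_at_def by blast
qed

text \<open>A nonzero derivative makes the extension of \<open>f\<close> injective on a disc, with a
  holomorphic inverse there. Continuity keeps \<open>\<phi> y\<close> inside that disc for
  \<open>y\<close> near \<open>y0\<close>, so \<open>\<phi>\<close> is the restriction of this
  inverse.\<close>

lemma real_analytic_at_inverse_function:
  assumes f: "real_analytic_at f x0" "deriv f x0 \<noteq> 0"
    and \<phi>: "isCont \<phi> y0" "\<phi> y0 = x0" "\<forall>\<^sub>F y in nhds y0. f (\<phi> y) = y"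
  shows "real_analytic_at \<phi> y0"
proof -
  have fx0: "f x0 = y0" using eventually_nhds_x_imp_x[OF \<phi>(3)] \<phi>(2) by simp
  obtain fc where fc: "fc analytic_on {complex_of_real x0}"
    "agrees_on_reals fc f x0"
    using f(1) unfolding real_analytic_at_def by blast
  obtain e where e: "e > 0" "fc holomorphic_on ball (complex_of_real x0) e"
    "\<And>t. \<bar>t - x0\<bar> < e \<Longrightarrow> fc (complex_of_real t) = complex_of_real (f t)"
    using holomorphic_ball_of_analytic_at[OF fc] by metis
  have "deriv fc (complex_of_real x0) = complex_of_real (deriv f x0)"
  proof -
    have "(fc has_field_derivative deriv fc (complex_of_real x0)) (at (complex_of_real x0))"
      using e by (intro holomorphic_derivI[where S = "ball (complex_of_real x0) e"]) auto
    hence "((\<lambda>t. fc (complex_of_real t)) has_vector_derivative deriv fc (complex_of_real x0)) (at x0)"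
      by (rule has_vector_derivative_real_field)
    hence "((\<lambda>t. complex_of_real (f t)) has_vector_derivative deriv fc (complex_of_real x0)) (at x0)"
      by (rule has_vector_derivative_transform_within_open[where S = "ball x0 e"])
        (use e in \<open>auto simp: dist_real_def abs_minus_commute\<close>)
    moreover have "((\<lambda>t. complex_of_real (f t)) has_vector_derivative complex_of_real (deriv f x0)) (at x0)"
      using has_vector_derivative_of_real[OF real_analytic_at_has_derivative[OF f(1)]] .
    ultimately show ?thesis by (rule vector_derivative_unique_at)
  qed
  hence d0: "deriv fc (complex_of_real x0) \<noteq> 0" using f(2) by simp
  obtain r where r: "r > 0" "ball (complex_of_real x0) r \<subseteq> ball (complex_of_real x0) e"
      "inj_on fc (ball (complex_of_real x0) r)"
    using has_complex_derivative_locally_injective[OF e(2) _ _ d0] e(1) by auto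
  have holr: "fc holomorphic_on ball (complex_of_real x0) r"
    using e(2) r(2) by (rule holomorphic_on_subset)
  obtain g where g: "g holomorphic_on (fc ` ball (complex_of_real x0) r)"
      "\<And>z. z \<in> ball (complex_of_real x0) r \<Longrightarrow> g (fc z) = z"
    using holomorphic_has_inverse[OF holr open_ball r(3)] by metis
  have op: "open (fc ` ball (complex_of_real x0) r)"
    by (rule open_mapping_thm3[OF holr _ r(3)]) auto
  have y0: "complex_of_real y0 \<in> fc ` ball (complex_of_real x0) r"
    using e(3)[of x0] e(1) r(1) fx0 by (intro image_eqI[of _ _ "complex_of_real x0"]) auto
  show ?thesis
    unfolding real_analytic_at_def
  proof (intro exI conjI)
    show "g analytic_on {complex_of_real y0}"
      using g(1) op y0 by (meson analytic_on_open analytic_on_subset empty_subsetI insert_subset)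
    have "filterlim \<phi> (nhds x0) (nhds y0)"
      using isCont_filterlim_nhds[OF \<phi>(1)] \<phi>(2) by simp
    moreover have "\<forall>\<^sub>F x in nhds x0. x \<in> ball x0 (min r e)"
      using r(1) e(1) by (intro eventually_nhds_in_open) auto
    ultimately have "\<forall>\<^sub>F y in nhds y0. \<phi> y \<in> ball x0 (min r e)"
      by (rule eventually_compose_filterlim[rotated])
    thus "\<forall>\<^sub>F y in nhds y0. g (complex_of_real y) = complex_of_real (\<phi> y)"
      using \<phi>(3)
    proof eventually_elim
      case (elim y)
      hence b: "\<bar>\<phi> y - x0\<bar> < r" "\<bar>\<phi> y - x0\<bar> < e" by (auto simp: dist_real_def abs_minus_commute)
      have "complex_of_real (\<phi> y) \<in> ball (complex_of_real x0) r"
        using b(1) by (simp only: mem_ball dist_of_real_complex abs_minus_commute)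
      from g(2)[OF this] show ?case using e(3)[OF b(2)] elim(2) by simp
    qed
  qed
qed

text \<open>The points near which \<open>f\<close> and \<open>g\<close> agree form an open set by
  definition. It is closed in \<open>I\<close> because agreement at points accumulating at
  \<open>y\<close> already forces agreement near \<open>y\<close>. Connectedness concludes.\<close>

lemma real_analytic_identity:
  assumes I: "open I" "connected I"
    and f: "\<And>x. x \<in> I \<Longrightarrow> real_analytic_at f x" and g: "\<And>x. x \<in> I \<Longrightarrow> real_analytic_at g x"
    and x0: "x0 \<in> I" "\<forall>\<^sub>F t in nhds x0. f t = g t"
    and x: "x \<in> I"
  shows "f x = g x"
proof -
  define S where "S = {x \<in> I. \<forall>\<^sub>F t in nhds x. f t = g t}"
  have "openin (top_of_set I) S"
  proof (rule openin_open[THEN iffD2], rule exI, rule conjI)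
    show "open {x. \<forall>\<^sub>F t in nhds x. f t = g t}"
    proof (subst open_subopen, intro ballI)
      fix x assume "x \<in> {x. \<forall>\<^sub>F t in nhds x. f t = g t}"
      then obtain T where T: "open T" "x \<in> T" "\<And>t. t \<in> T \<Longrightarrow> f t = g t"
        unfolding eventually_nhds by blast
      hence "T \<subseteq> {x. \<forall>\<^sub>F t in nhds x. f t = g t}" unfolding eventually_nhds by blast
      with T show "\<exists>T. open T \<and> x \<in> T \<and> T \<subseteq> {x. \<forall>\<^sub>F t in nhds x. f t = g t}" by blast
    qed
    show "S = I \<inter> {x. \<forall>\<^sub>F t in nhds x. f t = g t}" by (auto simp: S_def)
  qed
  moreover have "closedin (top_of_set I) S"
  proof (rule closedin_limpt[THEN iffD2], intro conjI allI impI)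
    show "S \<subseteq> I" by (auto simp: S_def)
    fix y assume y: "y islimpt S \<and> y \<in> I"
    obtain fc where fc: "fc analytic_on {complex_of_real y}"
      "agrees_on_reals fc f y"
      using f y unfolding real_analytic_at_def by blast
    obtain gc where gc: "gc analytic_on {complex_of_real y}"
      "agrees_on_reals gc g y"
      using g y unfolding real_analytic_at_def by blast
    have "\<exists>\<^sub>F t in at y. t \<in> S"
      using y by (simp add: islimpt_conv_frequently_at)
    hence "\<exists>\<^sub>F t in at y. f t = g t"
      by (rule frequently_elim1) (auto simp: S_def dest: eventually_nhds_x_imp_x)
    hence "\<exists>\<^sub>F t in at y. f t = g t \<and> (fc (complex_of_real t) = complex_of_real (f t) \<and> gc (complex_of_real t) = complex_of_real (g t))"
      by (rule frequently_eventually_frequently)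
        (rule eventually_nhds_imp_at[OF eventually_conj[OF fc(2) gc(2)]])
    hence "\<exists>\<^sub>F t in at y. fc (complex_of_real t) = gc (complex_of_real t)"
      by (rule frequently_elim1) simp
    from analytic_at_eq_if_eq_on_reals[OF fc(1) gc(1) this]
    have "\<forall>\<^sub>F t in nhds y. fc (complex_of_real t) = gc (complex_of_real t)"
      by (rule eventually_nhds_of_real)
    with fc(2) gc(2) have "\<forall>\<^sub>F t in nhds y. f t = g t"
      by eventually_elim simp
    thus "y \<in> S" using y by (simp add: S_def)
  qed
  ultimately have "S = {} \<or> S = I" using I(2)[unfolded connected_clopen] by blast
  moreover have "x0 \<in> S" using x0 by (simp add: S_def)
  ultimately have "S = I" by blast
  thus ?thesis using x by (auto simp: S_def dest: eventually_nhds_x_imp_x)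
qed

lemma real_analytic_on_iff: "real_analytic_on f S \<longleftrightarrow> (\<forall>x\<in>S. real_analytic_at f x)"
proof (intro iffI ballI)
  fix x assume "real_analytic_on f S" "x \<in> S"
  then obtain r a where r: "r > 0" "\<And>y. \<bar>y - x\<bar> < r \<Longrightarrow> (\<lambda>n. a n * (y - x) ^ n) sums f y"
    unfolding real_analytic_on_def by blast
  have "\<forall>\<^sub>F t in nhds 0. t \<in> ball 0 r" using r(1) by (intro eventually_nhds_in_open) auto
  hence "\<forall>\<^sub>F t in nhds 0. (\<lambda>n. fps_nth (Abs_fps a) n * t ^ n) sums f (x + t)"
  proof eventually_elim
    case (elim t)
    thus ?case using r(2)[of "x + t"] by (simp add: dist_real_def)
  qed
  hence "(\<lambda>t. f (x + t)) has_fps_expansion (Abs_fps a)"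
    by (rule has_fps_expansionI)
  thus "real_analytic_at f x" unfolding real_analytic_at_iff_has_fps_expansion by blast
next
  assume *: "\<forall>x\<in>S. real_analytic_at f x"
  show "real_analytic_on f S" unfolding real_analytic_on_def
  proof
    fix x assume "x \<in> S"
    hence h: "real_analytic_at f x" using * by blast
    obtain r where r: "r > 0"
      "\<forall>y. \<bar>y - x\<bar> < r \<longrightarrow>
       (\<exists>F. fps_conv_radius F \<ge> ereal r \<and> (\<forall>t. \<bar>t\<bar> < r \<longrightarrow> (\<lambda>n. fps_nth F n * t ^ n) sums f (y + t)))"
      using real_analytic_at_uniform_expansion[OF h] by (elim exE conjE)
    obtain F where F: "\<And>t. \<bar>t\<bar> < r \<Longrightarrow> (\<lambda>n. fps_nth F n * t ^ n) sums f (x + t)"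
      using r(2)[rule_format, of x] r(1) by auto
    have "(\<lambda>n. fps_nth F n * (y - x) ^ n) sums f y" if "\<bar>y - x\<bar> < r" for y
      using F[OF that] by simp
    with r(1) show "\<exists>r>0. \<exists>a. \<forall>y. \<bar>y - x\<bar> < r \<longrightarrow> (\<lambda>n. a n * (y - x) ^ n) sums f y" by blast
  qed
qed

text \<open>Since \<open>f x0\<close> lies strictly between the endpoint values, the intermediate
  value theorem puts a neighbourhood of it into the image, which turns the left inverse into the
  right inverse demanded by \<open>real_analytic_at_inverse_function\<close>.\<close>

lemma real_analytic_at_left_inverse:
  fixes f \<phi> :: "real \<Rightarrow> real"
  assumes d: "d > 0" and f: "real_analytic_at f x0" "deriv f x0 \<noteq> 0"
    and cont: "\<And>x. \<bar>x - x0\<bar> \<le> d \<Longrightarrow> isCont f x"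
    and inv: "\<And>x. \<bar>x - x0\<bar> \<le> d \<Longrightarrow> \<phi> (f x) = x"
    and less: "f (x0 - d) < f x0" "f x0 < f (x0 + d)"
  shows "real_analytic_at \<phi> (f x0)"
proof (rule real_analytic_at_inverse_function[OF f])
  show "\<phi> (f x0) = x0" using inv[of x0] d by simp
  show "isCont \<phi> (f x0)"
    by (rule isCont_inverse_function[OF d]) (use inv cont in auto)
  have "\<forall>\<^sub>F y in nhds (f x0). y \<in> {f (x0 - d)<..<f (x0 + d)}"
    using less by (intro eventually_nhds_in_open) auto
  thus "\<forall>\<^sub>F y in nhds (f x0). f (\<phi> y) = y"
  proof eventually_elim
    case (elim y)
    have "\<forall>x. x0 - d \<le> x \<and> x \<le> x0 + d \<longrightarrow> isCont f x" using cont by auto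
    then obtain x where "x0 - d \<le> x" "x \<le> x0 + d" "f x = y"
      using IVT[of f "x0 - d" y "x0 + d"] elim d by auto
    thus ?case using inv[of x] by auto
  qed
qed

text \<open>The radius \<open>d\<close> on which the inverse is valid is returned and kept below a
  given \<open>e\<close>, so that the interval can be held inside the domain at hand.\<close>

lemma real_analytic_local_inverse:
  assumes f: "real_analytic_at f x0" "deriv f x0 > 0" and "e > 0"
  shows "\<exists>\<phi> d. 0 < d \<and> d \<le> e \<and> real_analytic_at \<phi> (f x0) \<and>
           (\<forall>x. \<bar>x - x0\<bar> \<le> d \<longrightarrow> \<phi> (f x) = x \<and> isCont f x)"
proof -
  have "isCont (deriv f) x0" using f(1) by (intro real_analytic_at_isCont real_analytic_at_deriv)
  hence "filterlim (deriv f) (nhds (deriv f x0)) (nhds x0)" by (rule isCont_filterlim_nhds)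
  hence "\<forall>\<^sub>F x in nhds x0. 0 < deriv f x" using f(2) by (rule order_tendstoD(1))
  with real_analytic_at_eventually[OF f(1)]
  have "\<forall>\<^sub>F x in nhds x0. real_analytic_at f x \<and> 0 < deriv f x" by (rule eventually_conj)
  then obtain d' where d': "d' > 0" "\<And>x. dist x x0 < d' \<Longrightarrow> real_analytic_at f x \<and> 0 < deriv f x"
    unfolding eventually_nhds_metric by blast
  define d where "d = min e (d' / 2)"
  have d: "0 < d" "d \<le> e" "d < d'" using d'(1) \<open>e > 0\<close> by (auto simp: d_def)
  have near: "real_analytic_at f x" "0 < deriv f x" if "\<bar>x - x0\<bar> \<le> d" for x
    using d'(2)[of x] that d by (auto simp: dist_real_def)
  have less: "f x < f y" if "\<bar>x - x0\<bar> \<le> d" "\<bar>y - x0\<bar> \<le> d" "x < y" for x y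
  proof (rule DERIV_pos_imp_increasing[OF that(3)])
    fix t assume "x \<le> t" "t \<le> y"
    hence "\<bar>t - x0\<bar> \<le> d" using that by auto
    thus "\<exists>y. (f has_real_derivative y) (at t) \<and> 0 < y"
      using near real_analytic_at_has_derivative by blast
  qed
  have inj: "inj_on f {x0-d..x0+d}"
  proof (rule inj_onI)
    fix x y assume "x \<in> {x0-d..x0+d}" "y \<in> {x0-d..x0+d}" "f x = f y"
    moreover from this have "\<bar>x - x0\<bar> \<le> d" "\<bar>y - x0\<bar> \<le> d" by auto
    ultimately show "x = y" using less[of x y] less[of y x] by (cases x y rule: linorder_cases) auto
  qed
  define \<phi> where "\<phi> = the_inv_into {x0-d..x0+d} f"
  have \<phi>: "\<phi> (f x) = x" if "\<bar>x - x0\<bar> \<le> d" for x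
    unfolding \<phi>_def by (rule the_inv_into_f_f[OF inj]) (use that in auto)
  have cont: "isCont f x" if "\<bar>x - x0\<bar> \<le> d" for x
    using near(1)[OF that] by (rule real_analytic_at_isCont)
  have "real_analytic_at \<phi> (f x0)"
    by (rule real_analytic_at_left_inverse[where f = f and ?x0.0 = x0 and d = d])
      (use d \<phi> f cont less in auto)
  thus ?thesis using d \<phi> cont by (intro exI[of _ \<phi>] exI[of _ d]) auto
qed

lemma real_analytic_at_eval_fps:
  fixes F :: "real fps"
  assumes "ereal \<bar>x\<bar> < fps_conv_radius F"
  shows "real_analytic_at (eval_fps F) x"
  unfolding real_analytic_at_def
proof (intro exI conjI)
  let ?B = "eball 0 (fps_conv_radius (complex_fps F))"
  have x: "complex_of_real x \<in> ?B" using assms by (simp add: complex_fps_conv_radius)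
  have "eval_fps (complex_fps F) analytic_on ?B" by (intro analytic_on_eval_fps) auto
  thus "eval_fps (complex_fps F) analytic_on {complex_of_real x}"
    by (rule analytic_on_subset) (use x in auto)
  have "\<forall>\<^sub>F t in nhds x. t \<in> eball 0 (fps_conv_radius F)"
    using assms by (intro eventually_nhds_in_open) auto
  thus "\<forall>\<^sub>F t in nhds x. eval_fps (complex_fps F) (complex_of_real t) = complex_of_real (eval_fps F t)"
    by eventually_elim (simp add: eval_complex_fps)
qed

section \<open>Power series with log-convex coefficients\<close>

text \<open>Log-convexity makes the ratios p(k+1)/p(k) nondecreasing. In the identities expressing
  that the product of \<open>P\<close> and its inverse has vanishing coefficients \<open>n\<close>
  and \<open>n - 1\<close>, a suitable multiple of the second cancels the term of e(0) in the first.
  What remains is a combination of earlier e(i), nonpositive by induction, with nonnegative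
  weights.\<close>

lemma kaluza:
  fixes P :: "real fps"
  assumes pos: "\<And>n. fps_nth P n > 0"
    and logconvex: "\<And>n. fps_nth P (Suc n) ^ 2 \<le> fps_nth P n * fps_nth P (Suc (Suc n))"
    and "n > 0"
  shows "fps_nth (inverse P) n \<le> 0"
  using \<open>n > 0\<close>
proof (induction n rule: less_induct)
  case (less n)
  define e where "e = fps_nth (inverse P)"
  define p where "p = fps_nth P"
  have p: "p k > 0" for k using pos by (simp add: p_def)
  have ratio_Suc: "p (Suc k) / p k \<le> p (Suc (Suc k)) / p (Suc k)" for k
    using logconvex[of k] p[of k] p[of "Suc k"] by (simp add: p_def field_simps power2_eq_square)
  have ratio: "p (Suc i) / p i \<le> p (Suc j) / p j" if "i \<le> j" for i j
    by (rule lift_Suc_mono_le[of "\<lambda>k. p (Suc k) / p k", OF ratio_Suc that])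
  have conv: "(\<Sum>i\<le>m. e i * p (m - i)) = 0" if "m > 0" for m
  proof -
    have "fps_nth (inverse P * P) m = 0"
      using that pos[of 0] by (subst inverse_mult_eq_1) auto
    thus ?thesis by (simp add: fps_mult_nth e_def p_def atLeast0AtMost)
  qed
  have e0: "e 0 = 1 / p 0" by (simp add: e_def p_def divide_inverse)
  show ?case
  proof (cases "n = 1")
    case True
    have "e 0 * p 1 + e 1 * p 0 = 0" using conv[of 1] by (simp add: atMost_Suc)
    hence "e 1 = - (e 0 * p 1) / p 0" using p[of 0] by (simp add: field_simps)
    also have "\<dots> \<le> 0" using p[of 0] p[of 1] e0 by simp
    finally show ?thesis using True by (simp add: e_def)
  next
    case False
    then obtain m where m: "n = Suc m" "m > 0" using less.prems by (cases n) auto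
    \<comment> \<open>This is the factor that matches e(0) p(n) with e(0) p(m). It is also the
      largest ratio occurring, so c p(m-i) - p(n-i) is nonnegative.\<close>
    define c where "c = p n / p m"
    have "c \<ge> 0" using p[of n] p[of m] by (simp add: c_def)
    have split: "(\<Sum>i\<le>k. f i) = f 0 + (\<Sum>i\<in>{1..k}. f i)" for f :: "nat \<Rightarrow> real" and k
      by (simp add: sum.atLeast_Suc_atMost flip: atLeast0AtMost)
    have s1: "e 0 * p n + (\<Sum>i\<in>{1..m}. e i * p (n - i)) + e n * p 0 = 0"
      using conv[of n] less.prems m by (simp add: split)
    have s2: "e 0 * p m + (\<Sum>i\<in>{1..m}. e i * p (m - i)) = 0"
      using conv[of m] m by (simp add: split)
    have s3: "e 0 * p n = - (\<Sum>i\<in>{1..m}. e i * (c * p (m - i)))"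
    proof -
      have "e 0 * p n = c * (e 0 * p m)" using p[of m] by (simp add: c_def)
      also have "e 0 * p m = - (\<Sum>i\<in>{1..m}. e i * p (m - i))" using s2 by linarith
      finally show ?thesis by (simp add: sum_distrib_left mult_ac)
    qed
    have "e n * p 0 = (\<Sum>i\<in>{1..m}. e i * (c * p (m - i) - p (n - i)))"
      using s1 s3 by (simp add: algebra_simps sum_subtractf)
    also have "\<dots> \<le> 0"
    proof (rule sum_nonpos)
      fix i assume i: "i \<in> {1..m}"
      have "p (Suc (m - i)) / p (m - i) \<le> c" unfolding c_def m(1) by (rule ratio) auto
      moreover have "Suc (m - i) = n - i" using i m by auto
      ultimately have "p (n - i) \<le> c * p (m - i)" using p[of "m - i"] by (simp add: field_simps)
      moreover have "e i \<le> 0" using less.IH[of i] i m by (simp add: e_def)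
      ultimately show "e i * (c * p (m - i) - p (n - i)) \<le> 0"
        by (simp add: mult_nonpos_nonneg)
    qed
    finally show ?thesis using p[of 0] by (simp add: e_def mult_le_0_iff)
  qed
qed

lemma fps_power_nth_nonneg:
  fixes a :: "real fps"
  assumes "\<And>j. j \<le> k \<Longrightarrow> fps_nth a j \<ge> 0"
  shows "fps_nth (a ^ i) k \<ge> 0"
  using assms
proof (induction i arbitrary: k)
  case (Suc i)
  show ?case unfolding power_Suc fps_mult_nth
    by (intro sum_nonneg mult_nonneg_nonneg Suc.prems Suc.IH) auto
qed (simp add: fps_one_nth)

text \<open>As \<open>a\<close> has no constant term, the coefficients of \<open>a\<^sup>i\<close> of index \<open>k\<close> with \<open>i \<ge> 2\<close> only involve
  coefficients of \<open>a\<close> of index less than \<open>k\<close>.\<close>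

lemma fps_power_nth_nonneg':
  fixes a :: "real fps"
  assumes a0: "fps_nth a 0 = 0" and "\<And>j. j < k \<Longrightarrow> fps_nth a j \<ge> 0" "i \<ge> 2"
  shows "fps_nth (a ^ i) k \<ge> 0"
proof (cases "k = 0")
  case True
  thus ?thesis using assms by (simp add: fps_nth_power_0)
next
  case False
  obtain i' where i': "i = Suc i'" "i' > 0" using assms(3) by (cases i) auto
  have "fps_nth a j * fps_nth (a ^ i') (k - j) \<ge> 0" if "j \<le> k" for j
  proof (cases "j = 0 \<or> j = k")
    case True
    thus ?thesis using a0 i' by (auto simp: fps_nth_power_0 power_0_left)
  next
    case False
    hence "j < k" using that by simp
    thus ?thesis using False assms(2) by (intro mult_nonneg_nonneg fps_power_nth_nonneg) auto
  qed
  thus ?thesis unfolding i'(1) power_Suc fps_mult_nth by (intro sum_nonneg) auto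
qed

text \<open>Separates the linear term: the remaining powers only see coefficients of
  \<open>a\<close> below index \<open>k\<close>, so coefficient comparison becomes a
  recursion.\<close>

lemma fps_compose_nth_split:
  fixes U a :: "real fps"
  assumes "fps_nth a 0 = 0" "k \<ge> 1"
  shows "fps_nth (U oo a) k = fps_nth U 1 * fps_nth a k + (\<Sum>i\<in>{2..k}. fps_nth U i * fps_nth (a ^ i) k)"
proof -
  have "fps_nth (U oo a) k = (\<Sum>i=0..k. fps_nth U i * fps_nth (a ^ i) k)"
    by (simp add: fps_compose_nth)
  also have "\<dots> = (\<Sum>i\<in>insert 0 (insert 1 {2..k}). fps_nth U i * fps_nth (a ^ i) k)"
    using assms(2) by (intro sum.cong) auto
  also have "\<dots> = fps_nth U 1 * fps_nth a k + (\<Sum>i\<in>{2..k}. fps_nth U i * fps_nth (a ^ i) k)"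
    using assms(2) by (subst sum.insert, simp, force, subst sum.insert) (auto simp: fps_one_nth)
  finally show ?thesis .
qed

text \<open>The coefficients of \<open>a\<close> and \<open>b\<close> satisfy a linear recursion with nonnegative inhomogeneity;
  its determinant is positive because the coefficients of index 1 are.\<close>

lemma subordination_coeffs_nonneg:
  fixes a b U V W :: "real fps"
  assumes a0: "fps_nth a 0 = 0" and b0: "fps_nth b 0 = 0"
    and a1: "fps_nth a 1 > 0" and b1: "fps_nth b 1 > 0"
    and U: "U oo a = W" "\<And>k. k \<ge> 1 \<Longrightarrow> fps_nth U k \<le> 0" "fps_nth U 1 \<le> -1"
    and V: "V oo b = W" "\<And>k. k \<ge> 1 \<Longrightarrow> fps_nth V k \<le> 0" "fps_nth V 1 \<le> -1"
    and eq: "\<And>k. k \<ge> 1 \<Longrightarrow> fps_nth a k + fps_nth b k + fps_nth W k = (if k = 1 then 1 else 0)"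
  shows "fps_nth a k \<ge> 0 \<and> fps_nth b k \<ge> 0"
proof -
  \<comment> \<open>Expanding \<open>W\<close> as \<open>U oo a\<close> gives a(k) the total factor
    1 + U(1) = -\<alpha>. Moved to the other side, it is nonnegative precisely because U(1) is at
    most -1.\<close>
  define \<alpha> where "\<alpha> = - fps_nth U 1 - 1"
  define \<beta> where "\<beta> = - fps_nth V 1 - 1"
  have nonneg: "\<alpha> \<ge> 0" "\<beta> \<ge> 0" using U(3) V(3) by (auto simp: \<alpha>_def \<beta>_def)
  define S where "S k = (if k = 1 then 1 else 0) - (\<Sum>i\<in>{2..k}. fps_nth U i * fps_nth (a ^ i) k)" for k
  define T where "T k = (if k = 1 then 1 else 0) - (\<Sum>i\<in>{2..k}. fps_nth V i * fps_nth (b ^ i) k)" for k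
  have eb: "fps_nth b k = \<alpha> * fps_nth a k + S k" if "k \<ge> 1" for k
    using eq[OF that] fps_compose_nth_split[OF a0 that, of U] U(1) by (simp add: S_def \<alpha>_def algebra_simps)
  have ea: "fps_nth a k = \<beta> * fps_nth b k + T k" if "k \<ge> 1" for k
    using eq[OF that] fps_compose_nth_split[OF b0 that, of V] V(1) by (simp add: T_def \<beta>_def algebra_simps)
  \<comment> \<open>At index 1 both inhomogeneities equal 1, so a(1) = \<alpha>\<beta> a(1) +
    \<beta> + 1. With a(1) positive, \<alpha>\<beta> \<ge> 1 would make the right side exceed
    a(1).\<close>
  have det: "\<alpha> * \<beta> < 1"
  proof (rule ccontr)
    assume "\<not> \<alpha> * \<beta> < 1"
    have "fps_nth a 1 = \<beta> * (\<alpha> * fps_nth a 1 + 1) + 1"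
      using ea[of 1] eb[of 1] by (simp add: S_def T_def)
    also have "\<dots> = (\<alpha> * \<beta>) * fps_nth a 1 + \<beta> + 1" by (simp add: algebra_simps)
    also have "\<dots> \<ge> 1 * fps_nth a 1 + \<beta> + 1"
      using \<open>\<not> \<alpha> * \<beta> < 1\<close> a1 by (intro add_mono mult_right_mono) auto
    finally show False using nonneg by simp
  qed
  show ?thesis
  proof (induction k rule: less_induct)
    case (less k)
    show ?case
    proof (cases "k = 0")
      case False
      hence k: "k \<ge> 1" by simp
      have "(\<Sum>i\<in>{2..k}. fps_nth U i * fps_nth (a ^ i) k) \<le> 0"
        using less U(2) a0 by (intro sum_nonpos mult_nonpos_nonneg fps_power_nth_nonneg') auto
      hence S: "S k \<ge> 0" by (simp add: S_def)
      have "(\<Sum>i\<in>{2..k}. fps_nth V i * fps_nth (b ^ i) k) \<le> 0"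
        using less V(2) b0 by (intro sum_nonpos mult_nonpos_nonneg fps_power_nth_nonneg') auto
      hence T: "T k \<ge> 0" by (simp add: T_def)
      have "fps_nth a k * (1 - \<alpha> * \<beta>) = \<beta> * S k + T k"
        using ea[OF k] eb[OF k] by (simp add: algebra_simps)
      also have "\<dots> \<ge> 0" using S T nonneg by simp
      finally have a: "fps_nth a k \<ge> 0" using det by (simp add: zero_le_mult_iff)
      thus ?thesis using eb[OF k] S nonneg by simp
    qed (simp add: a0 b0)
  qed
qed

text \<open>All terms beyond the linear one are nonnegative and may be dropped. This transfers a
  radius of convergence from the composite to the inner series.\<close>

lemma fps_compose_nth_ge:
  fixes P a :: "real fps"
  assumes "fps_nth a 0 = 0" "\<And>k. fps_nth a k \<ge> 0" "\<And>k. fps_nth P k \<ge> 0" "k \<ge> 1"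
  shows "fps_nth P 1 * fps_nth a k \<le> fps_nth (P oo a) k"
  using assms by (subst fps_compose_nth_split)
    (auto intro!: sum_nonneg mult_nonneg_nonneg fps_power_nth_nonneg)

section \<open>The Stieltjes transform of a compactly supported distribution\<close>

locale compact_distribution =
  fixes \<rho> :: "real measure"
  assumes compactly_supported: "compactly_supported \<rho>"

sublocale compact_distribution \<subseteq> real_distribution \<rho>
  using compactly_supported unfolding compactly_supported_def by blast

context compact_distribution
begin

abbreviation a where "a \<equiv> supp_lower \<rho>"
abbreviation b where "b \<equiv> supp_upper \<rho>"
abbreviation G where "G \<equiv> stieltjes \<rho>"
abbreviation edge where "edge \<equiv> stieltjes_lower_edge \<rho>"

lemma measurable_rho: "f \<in> borel_measurable borel \<Longrightarrow> f \<in> borel_measurable \<rho>"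
  using measurable_cong_sets[OF events_eq_borel refl] by blast

lemma compact_supp: "compact (supp \<rho>)"
  using compactly_supported unfolding compactly_supported_def by blast

text \<open>The complement of the support is the union of all open null sets, an uncountable family;
  Lindelof's theorem replaces it by a countable one.\<close>

lemma AE_supp: "AE x in \<rho>. x \<in> supp \<rho>"
proof -
  define \<F> where "\<F> = {U. open U \<and> emeasure \<rho> U = 0}"
  obtain \<F>' where F': "\<F>' \<subseteq> \<F>" "countable \<F>'" "\<Union>\<F>' = \<Union>\<F>"
    using Lindelof[of \<F>] unfolding \<F>_def by blast
  have "(\<Union>U\<in>\<F>'. U) \<in> null_sets \<rho>"
    using F'(1) by (intro null_sets_UN' F'(2)) (auto simp: \<F>_def null_sets_def)
  moreover have "(\<Union>U\<in>\<F>'. U) = - supp \<rho>"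
    using F'(3) by (auto simp: \<F>_def supp_def not_gr_zero)
  ultimately have "- supp \<rho> \<in> null_sets \<rho>" by simp
  from AE_not_in[OF this] show ?thesis by simp
qed

lemma supp_nonempty: "supp \<rho> \<noteq> {}"
proof
  assume "supp \<rho> = {}"
  hence "AE x in \<rho>. False" using AE_supp by simp
  thus False by simp
qed

lemma a_in_supp: "a \<in> supp \<rho>"
  unfolding supp_lower_def using compact_supp supp_nonempty
  by (intro closed_contains_Inf) (auto intro: bounded_imp_bdd_below compact_imp_bounded compact_imp_closed)

lemma supp_subset: "x \<in> supp \<rho> \<Longrightarrow> a \<le> x \<and> x \<le> b"
  unfolding supp_lower_def supp_upper_def using compact_supp
  by (auto intro!: cInf_lower cSup_upper bounded_imp_bdd_below bounded_imp_bdd_above compact_imp_bounded)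

lemma AE_range: "AE x in \<rho>. a \<le> x \<and> x \<le> b"
  using AE_supp by eventually_elim (rule supp_subset)

lemma AE_rangeI: "(\<And>x. a \<le> x \<Longrightarrow> x \<le> b \<Longrightarrow> P x) \<Longrightarrow> AE x in \<rho>. P x"
  using AE_range by (rule eventually_mono) blast

lemma a_le_b: "a \<le> b"
  using supp_subset[OF a_in_supp] by simp

lemma integrable_if_bounded:
  fixes f :: "real \<Rightarrow> real"
  assumes "f \<in> borel_measurable borel" "\<And>x. a \<le> x \<Longrightarrow> x \<le> b \<Longrightarrow> \<bar>f x\<bar> \<le> C"
  shows "integrable \<rho> f"
  by (rule integrable_const_bound[of _ C])
    (use assms(2) measurable_rho[OF assms(1)] in \<open>auto intro!: AE_rangeI\<close>)

text \<open>Termwise integration under a geometric bound, used both for the expansion of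
  \<open>G\<close> at a finite point and for its expansion at infinity.\<close>

lemma sums_integral_geometric:
  fixes f :: "nat \<Rightarrow> real \<Rightarrow> real"
  assumes f: "\<And>n. f n \<in> borel_measurable borel" and g: "g \<in> borel_measurable borel"
    and q: "0 \<le> q" "q < 1" and bound: "\<And>n x. a \<le> x \<Longrightarrow> x \<le> b \<Longrightarrow> \<bar>f n x\<bar> \<le> C * q ^ n"
    and sums: "\<And>x. a \<le> x \<Longrightarrow> x \<le> b \<Longrightarrow> (\<lambda>n. f n x) sums g x"
  shows "(\<lambda>n. \<integral>x. f n x \<partial>\<rho>) sums (\<integral>x. g x \<partial>\<rho>)"
proof -
  have geo: "summable (\<lambda>n. C * q ^ n)" using q by (intro summable_mult summable_geometric) auto
  have int: "integrable \<rho> (f n)" for n by (rule integrable_if_bounded[OF f bound])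
  have "(\<lambda>n. \<integral>x. f n x \<partial>\<rho>) sums (\<integral>x. (\<Sum>n. f n x) \<partial>\<rho>)"
  proof (rule sums_integral[OF int])
    show "AE x in \<rho>. summable (\<lambda>n. norm (f n x))"
      by (rule AE_rangeI, rule summable_comparison_test'[OF geo, of 0]) (use bound in auto)
    show "summable (\<lambda>n. \<integral>x. norm (f n x) \<partial>\<rho>)"
    proof (rule summable_comparison_test'[OF geo, of 0])
      fix n :: nat
      have "(\<integral>x. norm (f n x) \<partial>\<rho>) \<le> C * q ^ n"
        by (rule integral_le_const) (use int bound in \<open>auto intro!: AE_rangeI\<close>)
      thus "norm (\<integral>x. norm (f n x) \<partial>\<rho>) \<le> C * q ^ n" by simp
    qed
  qed
  moreover have "(\<integral>x. (\<Sum>n. f n x) \<partial>\<rho>) = (\<integral>x. g x \<partial>\<rho>)"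
  proof (rule integral_cong_AE)
    show "(\<lambda>x. \<Sum>n. f n x) \<in> borel_measurable \<rho>" by (intro measurable_rho borel_measurable_suminf f)
    show "AE x in \<rho>. (\<Sum>n. f n x) = g x" using sums by (intro AE_rangeI) (auto simp: sums_iff)
  qed (rule measurable_rho[OF g])
  ultimately show ?thesis by simp
qed

section \<open>Taylor expansion and monotonicity of the Stieltjes transform\<close>

text \<open>For \<open>z\<close> outside \<open>{a..b}\<close> exactly one of the two differences is
  positive, and it is the distance from \<open>z\<close> to the interval.\<close>

definition gap :: "real \<Rightarrow> real" where
  "gap z = max (a - z) (z - b)"

lemma gap_pos: "z \<notin> {a..b} \<Longrightarrow> gap z > 0"
  by (auto simp: gap_def)

lemma gap_le: "z \<notin> {a..b} \<Longrightarrow> a \<le> x \<Longrightarrow> x \<le> b \<Longrightarrow> gap z \<le> \<bar>x - z\<bar>"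
  by (auto simp: gap_def)

text \<open>The Taylor coefficients of \<open>G\<close> at \<open>z\<close>. For \<open>z\<close>
  left of the support they are also the moments of 1/(x - z) under the positive measure of density
  1/(x - z), which is why they are log-convex.\<close>

definition pole_moment :: "real \<Rightarrow> nat \<Rightarrow> real" where
  "pole_moment z n = (\<integral>x. (1 / (x - z)) ^ Suc n \<partial>\<rho>)"

lemma pole_power_bound:
  assumes "z \<notin> {a..b}" "a \<le> x" "x \<le> b"
  shows "\<bar>(1 / (x - z)) ^ n\<bar> \<le> (1 / gap z) ^ n"
proof -
  have "\<bar>1 / (x - z)\<bar> \<le> 1 / gap z"
    using gap_le[OF assms] gap_pos[OF assms(1)] by (simp add: frac_le)
  thus ?thesis unfolding power_abs by (intro power_mono) auto
qed

lemma integrable_pole_power: "z \<notin> {a..b} \<Longrightarrow> integrable \<rho> (\<lambda>x. (1 / (x - z)) ^ n)"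
  by (rule integrable_if_bounded[of _ "(1 / gap z) ^ n"]) (use pole_power_bound in auto)

lemma integrable_pole: "z \<notin> {a..b} \<Longrightarrow> integrable \<rho> (\<lambda>x. 1 / (x - z))"
  using integrable_pole_power[of z 1] by simp

lemma stieltjes_sums:
  assumes z: "z \<notin> {a..b}" and t: "\<bar>t\<bar> < gap z"
  shows "(\<lambda>n. pole_moment z n * t ^ n) sums G (z + t)"
proof -
  define f where "f n x = (1 / (x - z)) ^ Suc n * t ^ n" for n and x :: real
  have d: "gap z > 0" using gap_pos[OF z] .
  have bound: "\<bar>f n x\<bar> \<le> 1 / gap z * (\<bar>t\<bar> / gap z) ^ n" if "a \<le> x" "x \<le> b" for n x
  proof -
    have "\<bar>f n x\<bar> = \<bar>(1 / (x - z)) ^ Suc n\<bar> * \<bar>t\<bar> ^ n" by (simp add: f_def abs_mult power_abs)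
    also have "\<dots> \<le> (1 / gap z) ^ Suc n * \<bar>t\<bar> ^ n"
      using that by (intro mult_right_mono pole_power_bound z) auto
    also have "\<dots> = 1 / gap z * (\<bar>t\<bar> / gap z) ^ n" by (simp add: power_divide)
    finally show ?thesis .
  qed
  have pw: "(\<lambda>n. f n x) sums (1 / (x - (z + t)))" if "a \<le> x" "x \<le> b" for x
  proof -
    have ne: "\<bar>t\<bar> < \<bar>x - z\<bar>" using gap_le[OF z that] t by linarith
    hence "(\<lambda>n. (t / (x - z)) ^ n) sums (1 / (1 - t / (x - z)))"
      by (intro geometric_sums) (auto simp: field_simps)
    hence "(\<lambda>n. 1 / (x - z) * (t / (x - z)) ^ n) sums (1 / (x - z) * (1 / (1 - t / (x - z))))"
      by (rule sums_mult)
    moreover have "1 / (x - z) * (1 / (1 - t / (x - z))) = 1 / (x - (z + t))"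
    proof -
      have "(x - z) * (1 - t / (x - z)) = x - (z + t)" using ne by (auto simp: field_simps)
      thus ?thesis by simp
    qed
    moreover have "1 / (x - z) * (t / (x - z)) ^ n = f n x" for n
      by (simp add: f_def power_divide)
    ultimately show ?thesis by simp
  qed
  have "(\<lambda>n. \<integral>x. f n x \<partial>\<rho>) sums (\<integral>x. 1 / (x - (z + t)) \<partial>\<rho>)"
    by (rule sums_integral_geometric[OF _ _ _ _ bound pw]) (use d t in \<open>auto simp: f_def\<close>)
  moreover have "(\<integral>x. f n x \<partial>\<rho>) = pole_moment z n * t ^ n" for n
    unfolding f_def pole_moment_def by (rule integral_mult_left_zero)
  ultimately show ?thesis by (simp add: stieltjes_def)
qed

lemma stieltjes_has_fps_expansion:
  assumes z: "z \<notin> {a..b}"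
  shows "(\<lambda>t. G (z + t)) has_fps_expansion Abs_fps (pole_moment z)"
proof (rule has_fps_expansionI)
  have "\<forall>\<^sub>F t in nhds 0. t \<in> ball 0 (gap z)"
    using gap_pos[OF z] by (intro eventually_nhds_in_open) auto
  thus "\<forall>\<^sub>F t in nhds 0. (\<lambda>n. fps_nth (Abs_fps (pole_moment z)) n * t ^ n) sums G (z + t)"
    by eventually_elim (use stieltjes_sums[OF z] in \<open>auto simp: dist_real_def\<close>)
qed

lemma real_analytic_at_stieltjes: "z \<notin> {a..b} \<Longrightarrow> real_analytic_at G z"
  unfolding real_analytic_at_iff_has_fps_expansion using stieltjes_has_fps_expansion by blast

lemma stieltjes_has_derivative:
  "z \<notin> {a..b} \<Longrightarrow> (G has_real_derivative pole_moment z 1) (at z)"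
  using has_fps_expansion_has_derivative[OF stieltjes_has_fps_expansion] by simp

lemma pole_moment_1_pos:
  assumes z: "z \<notin> {a..b}"
  shows "pole_moment z 1 > 0"
proof -
  define M where "M = \<bar>a - z\<bar> + \<bar>b - z\<bar>"
  have M: "M > 0" using z a_le_b by (auto simp: M_def)
  have "1 / M ^ 2 \<le> pole_moment z 1"
    unfolding pole_moment_def
  proof (rule integral_ge_const)
    show "integrable \<rho> (\<lambda>x. (1 / (x - z)) ^ Suc 1)" by (rule integrable_pole_power[OF z])
    show "AE x in \<rho>. 1 / M ^ 2 \<le> (1 / (x - z)) ^ Suc 1"
      using AE_range
    proof eventually_elim
      case (elim x)
      have "\<bar>x - z\<bar> \<le> M" using elim by (auto simp: M_def)
      hence "(x - z) ^ 2 \<le> M ^ 2" using M by (metis abs_of_pos power2_abs power_mono abs_ge_zero)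
      moreover have "(x - z) ^ 2 > 0" using elim z by auto
      ultimately show ?case by (simp add: power_divide frac_le flip: power2_eq_square)
    qed
  qed
  moreover have "1 / M ^ 2 > 0" using M by simp
  ultimately show ?thesis by linarith
qed

lemma stieltjes_bounds:
  assumes z: "z \<notin> {a..b}"
  shows "1 / (b - z) \<le> G z" "G z \<le> 1 / (a - z)"
proof -
  have *: "1 / (b - z) \<le> 1 / (x - z) \<and> 1 / (x - z) \<le> 1 / (a - z)" if "a \<le> x" "x \<le> b" for x
  proof -
    have "0 < a - z \<or> b - z < 0" using z by auto
    thus ?thesis using that by (auto simp: frac_le field_simps)
  qed
  show "1 / (b - z) \<le> G z" unfolding stieltjes_def
    by (rule integral_ge_const[OF integrable_pole[OF z]]) (use * in \<open>auto intro!: AE_rangeI\<close>)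
  show "G z \<le> 1 / (a - z)" unfolding stieltjes_def
    by (rule integral_le_const[OF integrable_pole[OF z]]) (use * in \<open>auto intro!: AE_rangeI\<close>)
qed

lemma stieltjes_pos: "z < a \<Longrightarrow> G z > 0"
  using stieltjes_bounds(1)[of z] a_le_b by (smt (verit) atLeastAtMost_iff zero_less_divide_1_iff)

lemma stieltjes_neg: "b < z \<Longrightarrow> G z < 0"
  using stieltjes_bounds(2)[of z] a_le_b by (smt (verit) atLeastAtMost_iff divide_less_0_1_iff)

lemma stieltjes_less:
  assumes "x < y" "y < a \<or> b < x"
  shows "G x < G y"
proof (rule DERIV_pos_imp_increasing[OF assms(1)])
  fix z assume "x \<le> z" "z \<le> y"
  hence "z \<notin> {a..b}" using assms by auto
  thus "\<exists>d. (G has_real_derivative d) (at z) \<and> 0 < d"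
    using stieltjes_has_derivative pole_moment_1_pos by blast
qed

lemma stieltjes_less_iff: "x < a \<Longrightarrow> y < a \<Longrightarrow> G x < G y \<longleftrightarrow> x < y"
  using stieltjes_less by (metis not_less_iff_gr_or_eq)

lemma stieltjes_isCont: "z \<notin> {a..b} \<Longrightarrow> isCont G z"
  using stieltjes_has_derivative DERIV_isCont by blast

text \<open>On each half-line \<open>G\<close> is strictly increasing, and its sign tells the two
  half-lines apart.\<close>

lemma stieltjes_inj: "inj_on G (- {a..b})"
proof (rule inj_onI)
  have False if "x < y" "x \<notin> {a..b}" "y \<notin> {a..b}" "G x = G y" for x y
  proof -
    have "x < a \<or> b < x" "y < a \<or> b < y" using that(2,3) by auto
    then consider "y < a" | "b < x" | "x < a" "b < y" by blast
    thus False
    proof cases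
      case 3
      thus False using stieltjes_pos[of x] stieltjes_neg[of y] that(4) by simp
    qed (use stieltjes_less[of x y] that in auto)
  qed
  thus "x = y" if "x \<in> - {a..b}" "y \<in> - {a..b}" "G x = G y" for x y
    using that by (metis ComplD linorder_neqE_linordered_idom)
qed

abbreviation K where "K \<equiv> stieltjes_inv \<rho>"

lemma stieltjes_inv_stieltjes: "z \<notin> {a..b} \<Longrightarrow> K (G z) = z"
  unfolding stieltjes_inv_def by (rule the_inv_into_f_f[OF stieltjes_inj]) auto

section \<open>Edge values and the inverse of the Stieltjes transform\<close>

text \<open>The limit of a monotone function is its supremum, taken in the extended reals, so a
  possibly infinite edge value needs no separate case.\<close>

lemma stieltjes_tendsto_lower_edge:
  "((\<lambda>z. ereal (G z)) \<longlongrightarrow> (SUP z\<in>{..<a}. ereal (G z))) (at_left a)"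
proof (rule order_tendstoI)
  fix l assume "l < (SUP z\<in>{..<a}. ereal (G z))"
  then obtain z0 where z0: "z0 < a" "l < ereal (G z0)" by (auto simp: less_SUP_iff)
  have "\<forall>\<^sub>F z in at_left a. z \<in> {z0<..<a}" using z0(1) by (rule eventually_at_left_real)
  thus "\<forall>\<^sub>F z in at_left a. l < ereal (G z)"
  proof eventually_elim
    case (elim z)
    hence "G z0 < G z" using z0(1) by (intro stieltjes_less) auto
    thus ?case using z0(2) by (metis less_ereal.simps(1) order.strict_trans)
  qed
next
  fix u assume u: "(SUP z\<in>{..<a}. ereal (G z)) < u"
  have "\<forall>\<^sub>F z in at_left a. z \<in> {a - 1<..<a}" by (rule eventually_at_left_real) simp
  thus "\<forall>\<^sub>F z in at_left a. ereal (G z) < u"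
  proof eventually_elim
    case (elim z)
    hence "ereal (G z) \<le> (SUP z\<in>{..<a}. ereal (G z))" by (intro SUP_upper) auto
    thus ?case using u by simp
  qed
qed

lemma stieltjes_tendsto_upper_edge:
  "((\<lambda>z. ereal (G z)) \<longlongrightarrow> (INF z\<in>{b<..}. ereal (G z))) (at_right b)"
proof (rule order_tendstoI)
  fix l assume "(INF z\<in>{b<..}. ereal (G z)) < l"
  then obtain z0 where z0: "b < z0" "ereal (G z0) < l" by (auto simp: INF_less_iff)
  have "\<forall>\<^sub>F z in at_right b. z \<in> {b<..<z0}" using z0(1) by (rule eventually_at_right_real)
  thus "\<forall>\<^sub>F z in at_right b. ereal (G z) < l"
  proof eventually_elim
    case (elim z)
    hence "G z < G z0" using z0(1) by (intro stieltjes_less) auto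
    thus ?case using z0(2) by (metis less_ereal.simps(1) order.strict_trans)
  qed
next
  fix u assume u: "u < (INF z\<in>{b<..}. ereal (G z))"
  have "\<forall>\<^sub>F z in at_right b. z \<in> {b<..<b + 1}" by (rule eventually_at_right_real) simp
  thus "\<forall>\<^sub>F z in at_right b. u < ereal (G z)"
  proof eventually_elim
    case (elim z)
    hence "(INF z\<in>{b<..}. ereal (G z)) \<le> ereal (G z)" by (intro INF_lower) auto
    thus ?case using u by simp
  qed
qed

lemma lower_edge_eq: "edge = (SUP z\<in>{..<a}. ereal (G z))"
  unfolding stieltjes_lower_edge_def by (rule tendsto_Lim[OF _ stieltjes_tendsto_lower_edge]) simp

lemma upper_edge_eq: "stieltjes_upper_edge \<rho> = (INF z\<in>{b<..}. ereal (G z))"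
  unfolding stieltjes_upper_edge_def by (rule tendsto_Lim[OF _ stieltjes_tendsto_upper_edge]) simp

lemma stieltjes_less_lower_edge: "z < a \<Longrightarrow> ereal (G z) < edge"
proof -
  assume z: "z < a"
  have "ereal (G z) < ereal (G ((z + a) / 2))" using z by (simp add: stieltjes_less)
  also have "\<dots> \<le> edge" unfolding lower_edge_eq using z by (intro SUP_upper) auto
  finally show ?thesis .
qed

lemma upper_edge_less_stieltjes: "b < z \<Longrightarrow> stieltjes_upper_edge \<rho> < ereal (G z)"
proof -
  assume z: "b < z"
  have "stieltjes_upper_edge \<rho> \<le> ereal (G ((z + b) / 2))" unfolding upper_edge_eq using z by (intro INF_lower) auto
  also have "\<dots> < ereal (G z)" using z by (simp add: stieltjes_less)
  finally show ?thesis .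
qed

lemma lower_edge_pos: "0 < edge"
  using stieltjes_less_lower_edge[of "a - 1"] stieltjes_pos[of "a - 1"]
  by (smt (verit) ereal_less(2) order.strict_trans)

lemma upper_edge_neg: "stieltjes_upper_edge \<rho> < 0"
  using upper_edge_less_stieltjes[of "b + 1"] stieltjes_neg[of "b + 1"]
  by (smt (verit) ereal_less(1) order.strict_trans)

lemma stieltjes_surj_left:
  assumes "0 < g" "ereal g < edge"
  obtains z where "z < a" "G z = g"
proof -
  obtain z0 where z0: "z0 < a" "g < G z0" using assms(2) by (auto simp: lower_edge_eq less_SUP_iff)
  \<comment> \<open>Far enough to the left that the upper bound 1/(a - z1) for \<open>G z1\<close>
    drops below \<open>g\<close>.\<close>
  define z1 where "z1 = min z0 (a - 1 / g) - 1"
  have z1: "z1 < a" and le: "z1 \<le> z0" using z0 by (auto simp: z1_def)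
  have "a - z1 > 1 / g" by (auto simp: z1_def)
  hence "1 / (a - z1) < g" using assms(1) z1 by (simp add: field_simps)
  hence "G z1 < g" using stieltjes_bounds(2)[of z1] z1 by auto
  moreover have "\<forall>x. z1 \<le> x \<and> x \<le> z0 \<longrightarrow> isCont G x" using z0 by (auto intro: stieltjes_isCont)
  ultimately obtain x where "z1 \<le> x" "x \<le> z0" "G x = g"
    using IVT[of G z1 g z0] z0 le by auto
  thus ?thesis using z0 by (intro that[of x]) auto
qed

lemma stieltjes_surj_right:
  assumes "g < 0" "stieltjes_upper_edge \<rho> < ereal g"
  obtains z where "b < z" "G z = g"
proof -
  obtain z0 where z0: "b < z0" "G z0 < g" using assms(2) by (auto simp: upper_edge_eq INF_less_iff)
  define z1 where "z1 = max z0 (b - 1 / g) + 1"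
  have z1: "b < z1" and le: "z0 \<le> z1" using z0 by (auto simp: z1_def)
  have "b - z1 < 1 / g" by (auto simp: z1_def)
  hence "1 / (b - z1) > g" using assms(1) z1 by (simp add: field_simps)
  hence "g < G z1" using stieltjes_bounds(1)[of z1] z1 by auto
  moreover have "\<forall>x. z0 \<le> x \<and> x \<le> z1 \<longrightarrow> isCont G x" using z0 by (auto intro: stieltjes_isCont)
  ultimately obtain x where "z0 \<le> x" "x \<le> z1" "G x = g"
    using IVT[of G z0 g z1] z0 le by auto
  thus ?thesis using z0 by (intro that[of x]) auto
qed

lemma stieltjes_inv_left:
  assumes "0 < g" "ereal g < edge"
  shows "K g < a" "G (K g) = g"
proof -
  obtain z where "z < a" "G z = g" using stieltjes_surj_left[OF assms] .
  thus "K g < a" "G (K g) = g"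
    using stieltjes_inv_stieltjes[of z] by auto
qed

lemma stieltjes_inv_right:
  assumes "g < 0" "stieltjes_upper_edge \<rho> < ereal g"
  shows "b < K g" "G (K g) = g"
proof -
  obtain z where "b < z" "G z = g" using stieltjes_surj_right[OF assms] .
  thus "b < K g" "G (K g) = g"
    using stieltjes_inv_stieltjes[of z] by auto
qed

lemma real_analytic_at_stieltjes_inv:
  assumes "z \<notin> {a..b}"
  shows "real_analytic_at (K) (G z)"
proof (rule real_analytic_at_left_inverse[where f = G and ?x0.0 = z])
  show "real_analytic_at G z" using assms by (rule real_analytic_at_stieltjes)
  show "deriv G z \<noteq> 0"
    using DERIV_imp_deriv[OF stieltjes_has_derivative[OF assms]] pole_moment_1_pos[OF assms] by simp
  define d where "d = gap z / 2"
  show d: "d > 0" using gap_pos[OF assms] by (simp add: d_def)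
  have out: "x \<notin> {a..b}" if "\<bar>x - z\<bar> \<le> d" for x
    using gap_le[OF assms, of x] d that by (auto simp: d_def)
  show "isCont G x" if "\<bar>x - z\<bar> \<le> d" for x using out[OF that] by (rule stieltjes_isCont)
  show "K (G x) = x" if "\<bar>x - z\<bar> \<le> d" for x
    using out[OF that] by (rule stieltjes_inv_stieltjes)
  have "z < a \<or> b < z" using assms by auto
  hence "z + d < a \<or> b < z - d"
    using a_le_b by (auto simp: d_def gap_def max_def field_simps)
  thus "G (z - d) < G z" "G z < G (z + d)" using d by (auto intro!: stieltjes_less)
qed

section \<open>Existence of the R-transform\<close>

definition moment_transform :: "real \<Rightarrow> real" where
  "moment_transform w = (\<integral>x. w / (1 - w * x) \<partial>\<rho>)"

lemma moment_transform_has_fps_expansion: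
  "moment_transform has_fps_expansion (fps_X * Abs_fps (\<lambda>n. \<integral>x. x ^ n \<partial>\<rho>))"
proof -
  define M where "M = \<bar>a\<bar> + \<bar>b\<bar> + 1"
  have M: "M > 0" by (simp add: M_def)
  have Mb: "\<bar>x\<bar> \<le> M" if "a \<le> x" "x \<le> b" for x using that by (auto simp: M_def)
  have "(\<lambda>n. (\<integral>x. x ^ n \<partial>\<rho>) * w ^ n) sums (\<integral>x. 1 / (1 - w * x) \<partial>\<rho>)" if w: "\<bar>w\<bar> < 1 / M" for w
  proof -
    have wM: "\<bar>w\<bar> * M < 1" using w M by (simp add: field_simps)
    have bound: "\<bar>x ^ n * w ^ n\<bar> \<le> 1 * (\<bar>w\<bar> * M) ^ n" if "a \<le> x" "x \<le> b" for x n
    proof -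
      have "\<bar>x ^ n * w ^ n\<bar> = (\<bar>w\<bar> * \<bar>x\<bar>) ^ n" by (simp add: abs_mult power_abs power_mult_distrib)
      also have "\<dots> \<le> (\<bar>w\<bar> * M) ^ n" using Mb[OF that] by (intro power_mono mult_left_mono) auto
      finally show ?thesis by simp
    qed
    have pw: "(\<lambda>n. x ^ n * w ^ n) sums (1 / (1 - w * x))" if "a \<le> x" "x \<le> b" for x
    proof -
      have "\<bar>w\<bar> * \<bar>x\<bar> \<le> \<bar>w\<bar> * M" using Mb[OF that] by (intro mult_left_mono) auto
      hence "(\<lambda>n. (w * x) ^ n) sums (1 / (1 - w * x))"
        using wM by (intro geometric_sums) (simp add: abs_mult)
      thus ?thesis by (simp add: power_mult_distrib mult.commute)
    qed
    have "(\<lambda>n. \<integral>x. x ^ n * w ^ n \<partial>\<rho>) sums (\<integral>x. 1 / (1 - w * x) \<partial>\<rho>)"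
      by (rule sums_integral_geometric[OF _ _ _ wM bound pw]) (use M in auto)
    thus ?thesis by simp
  qed
  note sums = this
  have "\<forall>\<^sub>F w in nhds 0. w \<in> ball 0 (1 / M)"
    using M by (intro eventually_nhds_in_open) auto
  hence "\<forall>\<^sub>F w in nhds 0. (\<lambda>n. fps_nth (Abs_fps (\<lambda>n. \<integral>x. x ^ n \<partial>\<rho>)) n * w ^ n) sums (\<integral>x. 1 / (1 - w * x) \<partial>\<rho>)"
    by eventually_elim (use sums in \<open>auto simp: dist_real_def\<close>)
  hence "(\<lambda>w. \<integral>x. 1 / (1 - w * x) \<partial>\<rho>) has_fps_expansion Abs_fps (\<lambda>n. \<integral>x. x ^ n \<partial>\<rho>)"
    by (rule has_fps_expansionI)
  from has_fps_expansion_mult[OF has_fps_expansion_fps_X this]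
  have "(\<lambda>w. w * (\<integral>x. 1 / (1 - w * x) \<partial>\<rho>)) has_fps_expansion (fps_X * Abs_fps (\<lambda>n. \<integral>x. x ^ n \<partial>\<rho>))" .
  moreover have "w * (\<integral>x. 1 / (1 - w * x) \<partial>\<rho>) = moment_transform w" for w
    unfolding moment_transform_def by (simp flip: integral_mult_right_zero)
  ultimately show ?thesis by simp
qed

lemma moment_transform_stieltjes: "z \<noteq> 0 \<Longrightarrow> moment_transform (1 / z) = - G z"
proof -
  assume z: "z \<noteq> 0"
  have "(1 / z) / (1 - 1 / z * x) = - (1 / (x - z))" for x
    using z by (cases "x = z") (auto simp: field_simps)
  thus ?thesis unfolding moment_transform_def stieltjes_def by simp
qed

lemma R_hat_domain_iff:
  "t \<in> R_hat_domain \<rho> \<longleftrightarrow>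
     ereal (- t) < edge \<and> stieltjes_upper_edge \<rho> < ereal (- t)"
  unfolding R_hat_domain_def
  by (cases "edge"; cases "stieltjes_upper_edge \<rho>") auto

lemma R_hat_domainD:
  assumes "t \<in> R_hat_domain \<rho>" "t \<noteq> 0"
  shows "K (- t) \<notin> {a..b}" "G (K (- t)) = - t"
proof -
  have t': "ereal (- t) < edge" "stieltjes_upper_edge \<rho> < ereal (- t)"
    using assms(1) by (auto simp: R_hat_domain_iff)
  show "K (- t) \<notin> {a..b}" "G (K (- t)) = - t"
    using stieltjes_inv_left[of "-t"] stieltjes_inv_right[of "-t"] t' assms(2) a_le_b
    by (cases "t < 0"; auto)+
qed

lemma R_hat_domainI:
  assumes "0 < g" "ereal g < edge"
  shows "- g \<in> R_hat_domain \<rho>"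
proof -
  have "stieltjes_upper_edge \<rho> < ereal 0" using upper_edge_neg by (simp add: zero_ereal_def)
  also have "ereal 0 < ereal g" using assms(1) by simp
  finally show ?thesis using assms(2) by (simp add: R_hat_domain_iff)
qed

lemma zero_in_R_hat_domain: "0 \<in> R_hat_domain \<rho>"
  using upper_edge_neg lower_edge_pos by (simp add: R_hat_domain_iff zero_ereal_def)

lemma open_R_hat_domain: "open (R_hat_domain \<rho>)"
proof -
  have "R_hat_domain \<rho> = ereal -` {- edge <..< - stieltjes_upper_edge \<rho>}"
    by (auto simp: R_hat_domain_def)
  thus ?thesis by (auto intro!: open_ereal_vimage)
qed

lemma is_interval_R_hat_domain: "is_interval (R_hat_domain \<rho>)"
  unfolding is_interval_1
proof (intro ballI allI impI)
  fix x y t assume xy: "x \<in> R_hat_domain \<rho>" "y \<in> R_hat_domain \<rho>" "x \<le> t \<and> t \<le> y"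
  have "ereal (- t) \<le> ereal (- x)" "ereal (- y) \<le> ereal (- t)" using xy(3) by auto
  thus "t \<in> R_hat_domain \<rho>" using xy(1,2) unfolding R_hat_domain_iff
    by (meson le_less_trans less_le_trans)
qed

text \<open>In the coordinate \<open>1 / z\<close> at infinity, \<open>- stieltjes \<rho>\<close> is \<open>moment_transform\<close>, so near the origin
  \<open>\<phi> t = 1 / K (- t)\<close> inverts \<open>moment_transform\<close>, and \<open>R_hat \<rho> t = 1 / \<phi> t - 1 / t\<close>
  has a removable singularity because \<open>\<phi> t = t + O(t\<^sup>2)\<close>.\<close>

lemma R_hat_removable:
  obtains h where "real_analytic_at h 0" "\<forall>\<^sub>F t in at 0. h t = R_hat \<rho> t"
proof -
  define \<phi> where "\<phi> t = (if t = 0 then 0 else 1 / K (- t))" for t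
  define M where "M = \<bar>a\<bar> + \<bar>b\<bar> + 1"
  have M: "M > 0" by (simp add: M_def)
  have ev_dom: "\<forall>\<^sub>F t in nhds 0. t \<in> R_hat_domain \<rho>"
    using open_R_hat_domain zero_in_R_hat_domain by (intro eventually_nhds_in_open)
  have ev_M: "\<forall>\<^sub>F t in nhds 0. t \<in> ball 0 (1 / (2 * M))"
    using M by (intro eventually_nhds_in_open) auto
  \<comment> \<open>A crude form of the asymptotics of K at 0: the two-sided bounds on
    \<open>G\<close> give 1/|t| \<le> |z| + M, and \<open>M\<close> is absorbed because it is at
    most half of 1/|t|. Hence \<phi> is O(t) and in particular continuous at 0.\<close>
  have large: "\<bar>K (- t)\<bar> \<ge> 1 / (2 * \<bar>t\<bar>)"
    if "t \<in> R_hat_domain \<rho>" "t \<noteq> 0" "\<bar>t\<bar> < 1 / (2 * M)" for t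
  proof -
    define z where "z = K (- t)"
    have z: "z \<notin> {a..b}" "G z = - t" using R_hat_domainD[OF that(1,2)] by (auto simp: z_def)
    have zM: "\<bar>z\<bar> + M > 0" using M by linarith
    have "1 / (\<bar>z\<bar> + M) \<le> \<bar>t\<bar>"
    proof (cases "z < a")
      case True
      hence "1 / (\<bar>z\<bar> + M) \<le> 1 / (b - z)" using a_le_b by (intro frac_le) (auto simp: M_def)
      thus ?thesis using stieltjes_bounds(1)[OF z(1)] z(2) by linarith
    next
      case False
      hence "b < z" using z(1) by auto
      hence "1 / (\<bar>z\<bar> + M) \<le> 1 / (z - a)" using a_le_b by (intro frac_le) (auto simp: M_def)
      also have "\<dots> = - (1 / (a - z))" by (metis minus_diff_eq minus_divide_right)
      finally show ?thesis using stieltjes_bounds(2)[OF z(1)] z(2) by linarith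
    qed
    hence "1 / \<bar>t\<bar> \<le> \<bar>z\<bar> + M" using zM that(2) by (simp add: field_simps)
    moreover have "M \<le> 1 / (2 * \<bar>t\<bar>)" using that(2,3) M by (simp add: field_simps)
    moreover have "1 / \<bar>t\<bar> = 1 / (2 * \<bar>t\<bar>) + 1 / (2 * \<bar>t\<bar>)" by simp
    ultimately show ?thesis unfolding z_def by linarith
  qed
  have small: "\<forall>\<^sub>F t in nhds 0. \<bar>\<phi> t\<bar> \<le> 2 * \<bar>t\<bar>"
    using ev_dom ev_M
  proof eventually_elim
    case (elim t)
    show ?case
    proof (cases "t = 0")
      case False
      hence "1 / (2 * \<bar>t\<bar>) \<le> \<bar>K (- t)\<bar>" using elim by (intro large) (auto simp: dist_real_def)
      moreover have "1 / (2 * \<bar>t\<bar>) > 0" using False by simp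
      ultimately have "1 / \<bar>K (- t)\<bar> \<le> 1 / (1 / (2 * \<bar>t\<bar>))" by (intro divide_left_mono mult_pos_pos) auto
      thus ?thesis using False by (simp add: \<phi>_def)
    qed (simp add: \<phi>_def)
  qed
  have nonzero: "\<forall>\<^sub>F t in at 0. K (- t) \<noteq> 0 \<and> t \<in> R_hat_domain \<rho>"
    using eventually_nhds_imp_at[OF ev_dom] eventually_nhds_imp_at[OF ev_M] eventually_neq_at_within[of 0 0 UNIV]
  proof eventually_elim
    case (elim t)
    hence "1 / (2 * \<bar>t\<bar>) \<le> \<bar>K (- t)\<bar>" by (intro large) (auto simp: dist_real_def)
    moreover have "1 / (2 * \<bar>t\<bar>) > 0" using elim by simp
    ultimately show ?case using elim by auto
  qed
  have exp: "(\<lambda>t. moment_transform (0 + t)) has_fps_expansion (fps_X * Abs_fps (\<lambda>n. \<integral>x. x ^ n \<partial>\<rho>))"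
    using moment_transform_has_fps_expansion by simp
  have m0: "moment_transform 0 = 0" using has_fps_expansion_nth_0[OF exp] by simp
  have inv: "\<forall>\<^sub>F t in nhds 0. moment_transform (\<phi> t) = t"
  proof -
    have "\<forall>\<^sub>F t in at 0. moment_transform (\<phi> t) = t"
      using nonzero eventually_neq_at_within[of 0 0 UNIV]
      by eventually_elim (simp add: \<phi>_def moment_transform_stieltjes R_hat_domainD)
    thus ?thesis by (simp add: eventually_nhds_conv_at \<phi>_def m0)
  qed
  have "real_analytic_at \<phi> 0"
  proof (rule real_analytic_at_inverse_function)
    show "real_analytic_at moment_transform 0"
      unfolding real_analytic_at_iff_has_fps_expansion using exp by blast
    have "(moment_transform has_real_derivative 1) (at 0)"
      using has_fps_expansion_has_derivative[OF exp] prob_space by simp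
    thus "deriv moment_transform 0 \<noteq> 0" by (simp add: DERIV_imp_deriv)
    show "\<phi> 0 = 0" by (simp add: \<phi>_def)
    have "(\<phi> \<longlongrightarrow> 0) (at 0)"
    proof (rule Lim_null_comparison)
      show "\<forall>\<^sub>F t in at 0. norm (\<phi> t) \<le> 2 * \<bar>t\<bar>" using eventually_nhds_imp_at[OF small] by simp
      show "((\<lambda>t::real. 2 * \<bar>t\<bar>) \<longlongrightarrow> 0) (at 0)" by (auto intro!: tendsto_eq_intros)
    qed
    thus "isCont \<phi> 0" by (simp add: isCont_def \<phi>_def)
    show "\<forall>\<^sub>F t in nhds 0. moment_transform (\<phi> t) = t" by (rule inv)
  qed
  then obtain \<Phi> where \<Phi>: "(\<lambda>t. \<phi> (0 + t)) has_fps_expansion \<Phi>"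
    unfolding real_analytic_at_iff_has_fps_expansion by blast
  hence \<Phi>': "\<phi> has_fps_expansion \<Phi>" by simp
  have \<Phi>0: "fps_nth \<Phi> 0 = 0" using has_fps_expansion_nth_0[OF \<Phi>] by (simp add: \<phi>_def)
  \<comment> \<open>Comparing coefficients of index 1 in this identity, with total mass 1, gives
    \<phi> the slope 1. This makes t - \<phi>(t) vanish to second order.\<close>
  have "fps_X = (fps_X * Abs_fps (\<lambda>n. \<integral>x. x ^ n \<partial>\<rho>)) oo \<Phi>"
  proof (rule has_fps_expansion_real_compose[OF moment_transform_has_fps_expansion \<Phi>' \<Phi>0])
    have "(\<lambda>t::real. t) has_fps_expansion fps_X" by (rule has_fps_expansion_fps_X)
    thus "(\<lambda>t. moment_transform (\<phi> t)) has_fps_expansion fps_X"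
      by (rule has_fps_expansion_cong[THEN iffD1, rotated 2]) (use inv in \<open>auto elim: eventually_mono\<close>)
  qed
  hence "fps_nth fps_X 1 = fps_nth ((fps_X * Abs_fps (\<lambda>n. \<integral>x. x ^ n \<partial>\<rho>)) oo \<Phi>) 1" by simp
  hence \<Phi>1: "fps_nth \<Phi> 1 = 1"
    using prob_space by (subst (asm) fps_compose_nth_split[OF \<Phi>0]) auto
  define c where "c = fps_nth (fps_X - \<Phi>) 2"
  \<comment> \<open>Away from 0 this is 1/\<phi> - 1/t = (t - \<phi>)/(t \<phi>), arranged as a
    quotient of two shifted series whose denominator has constant term 1.\<close>
  define h where "h t = (if t = 0 then c else (t - \<phi> t) / t ^ 2) / (if t = 0 then 1 else \<phi> t / t ^ 1)" for t
  have "h has_fps_expansion fps_shift 2 (fps_X - \<Phi>) / fps_shift 1 \<Phi>"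
    unfolding h_def
  proof (rule has_fps_expansion_divide')
    show "(\<lambda>t. if t = 0 then c else (t - \<phi> t) / t ^ 2) has_fps_expansion fps_shift 2 (fps_X - \<Phi>)"
    proof (cases "fps_X - \<Phi> = 0")
      \<comment> \<open>A zero series has \<open>subdegree\<close> 0, so the shift argument does not
        cover it; here \<phi> is the identity near 0.\<close>
      case True
      have "(\<lambda>t. t - \<phi> t) has_fps_expansion (fps_X - \<Phi>)"
        by (intro has_fps_expansion_diff has_fps_expansion_fps_X \<Phi>')
      hence "\<forall>\<^sub>F t in nhds 0. t - \<phi> t = 0"
        using True unfolding has_fps_expansion_def by (auto elim: eventually_mono)
      hence "\<forall>\<^sub>F t in nhds 0. 0 = (if t = 0 then c else (t - \<phi> t) / t ^ 2)"
        by eventually_elim (simp add: c_def True)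
      moreover have "(\<lambda>t::real. 0) has_fps_expansion (fps_shift 2 (fps_X - \<Phi>))" using True by simp
      ultimately show ?thesis using has_fps_expansion_cong by fast
    next
      case False
      have "2 \<le> subdegree (fps_X - \<Phi>)"
      proof (rule subdegree_geI[OF False])
        fix i :: nat assume "i < 2"
        hence "i = 0 \<or> i = 1" by auto
        thus "fps_nth (fps_X - \<Phi>) i = 0" using \<Phi>0 \<Phi>1 by auto
      qed
      thus ?thesis
        by (intro has_fps_expansion_shift has_fps_expansion_diff has_fps_expansion_fps_X \<Phi>') (simp_all add: c_def)
    qed
    have "\<Phi> \<noteq> 0" using \<Phi>1 by auto
    hence "1 \<le> subdegree \<Phi>" using \<Phi>0 by (intro subdegree_geI) auto
    thus "(\<lambda>t. if t = 0 then 1 else \<phi> t / t ^ 1) has_fps_expansion fps_shift 1 \<Phi>"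
      using \<Phi>1 by (intro has_fps_expansion_shift \<Phi>') auto
    show "fps_nth (fps_shift 1 \<Phi>) 0 \<noteq> 0" using \<Phi>1 by simp
  qed
  hence "real_analytic_at h 0"
    unfolding real_analytic_at_iff_has_fps_expansion by auto
  moreover have "\<forall>\<^sub>F t in at 0. h t = R_hat \<rho> t"
    using nonzero eventually_neq_at_within[of 0 0 UNIV]
    by eventually_elim (simp add: h_def \<phi>_def R_hat_def field_simps power2_eq_square)
  ultimately show ?thesis by (rule that)
qed

lemma R_extension_R_hat_domain: "\<exists>f. R_extension \<rho> (R_hat_domain \<rho>) f"
proof -
  obtain h where h: "real_analytic_at h 0" "\<forall>\<^sub>F t in at 0. h t = R_hat \<rho> t"
    using R_hat_removable .
  define f where "f t = (if t = 0 then h 0 else R_hat \<rho> t)" for t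
  have "real_analytic_at f t" if t: "t \<in> R_hat_domain \<rho>" for t
  proof (cases "t = 0")
    case True
    have "\<forall>\<^sub>F t in nhds 0. h t = f t"
      using h(2) by (simp add: eventually_nhds_conv_at f_def) (auto simp: eventually_at_filter elim: eventually_mono)
    thus ?thesis using h(1) True real_analytic_at_cong by blast
  next
    case False
    note D = R_hat_domainD[OF t False]
    have "real_analytic_at (\<lambda>s. K (- s)) t"
      using real_analytic_at_compose[OF real_analytic_at_minus[OF real_analytic_at_id]]
        real_analytic_at_stieltjes_inv[OF D(1)] unfolding D(2) by blast
    moreover have "real_analytic_at (\<lambda>s. 1 / s) t"
      using False by (intro real_analytic_at_divide real_analytic_at_const real_analytic_at_id)
    ultimately have "real_analytic_at (R_hat \<rho>) t"
      unfolding R_hat_def by (rule real_analytic_at_diff)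
    moreover have "\<forall>\<^sub>F s in nhds t. s \<in> - {0}" using False by (intro eventually_nhds_in_open) auto
    hence "\<forall>\<^sub>F s in nhds t. R_hat \<rho> s = f s" by eventually_elim (simp add: f_def)
    ultimately show ?thesis by (rule real_analytic_at_cong)
  qed
  hence "R_extension \<rho> (R_hat_domain \<rho>) f"
    unfolding R_extension_def real_analytic_on_iff
    using open_R_hat_domain is_interval_R_hat_domain by (auto simp: f_def)
  thus ?thesis by blast
qed

section \<open>Gluing extensions to the maximal interval\<close>

lemma R_extension_unique:
  assumes "R_extension \<rho> I f" "R_extension \<rho> J g" "t \<in> I" "t \<in> J"
  shows "f t = g t"
proof -
  note I = assms(1)[unfolded R_extension_def real_analytic_on_iff]
  note J = assms(2)[unfolded R_extension_def real_analytic_on_iff]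
  obtain e where e: "e > 0" "ball 0 e \<subseteq> R_hat_domain \<rho>"
    using open_R_hat_domain zero_in_R_hat_domain open_contains_ball by blast
  \<comment> \<open>The base point must differ from 0, since the values of an extension are
    prescribed only on \<open>R_hat_domain \<rho> - {0}\<close>.\<close>
  define s where "s = e / 2"
  have s: "s \<noteq> 0" "s \<in> R_hat_domain \<rho>" using e by (auto simp: s_def)
  have "\<forall>\<^sub>F x in nhds s. x \<in> R_hat_domain \<rho> \<inter> - {0}"
    using s open_R_hat_domain by (intro eventually_nhds_in_open) auto
  hence ev: "\<forall>\<^sub>F x in nhds s. f x = g x"
    by eventually_elim (use I J in auto)
  show ?thesis
  proof (rule real_analytic_identity[where I = "I \<inter> J" and ?x0.0 = s and f = f and g = g and x = t])
    show "open (I \<inter> J)" using I J by auto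
    show "connected (I \<inter> J)" using I J by (intro is_interval_connected is_interval_Int) auto
    show "s \<in> I \<inter> J" using I J s by auto
    show "\<forall>\<^sub>F x in nhds s. f x = g x" by (rule ev)
  qed (use I J assms in auto)
qed

text \<open>The glued function picks any interval containing \<open>t\<close>; by uniqueness the
  pick does not influence the value, so near each point it is one fixed analytic extension. The
  union is an interval because all members contain 0.\<close>

lemma R_extension_R_transform: "R_extension \<rho> (R_domain \<rho>) (R_transform \<rho>)"
proof -
  define \<I> where "\<I> = {I. \<exists>f. R_extension \<rho> I f}"
  define pick where "pick I = (SOME f. R_extension \<rho> I f)" for I
  have pick: "R_extension \<rho> I (pick I)" if "I \<in> \<I>" for I
    using that someI_ex[of "R_extension \<rho> I"] unfolding \<I>_def pick_def by simp
  define f where "f t = pick (SOME I. I \<in> \<I> \<and> t \<in> I) t" for t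
  have f_eq: "f t = pick I t" if "I \<in> \<I>" "t \<in> I" for I t
  proof -
    have "(SOME I. I \<in> \<I> \<and> t \<in> I) \<in> \<I> \<and> t \<in> (SOME I. I \<in> \<I> \<and> t \<in> I)"
      using that by (intro someI_ex[of "\<lambda>I. I \<in> \<I> \<and> t \<in> I"]) blast
    thus ?thesis unfolding f_def using that by (intro R_extension_unique[OF pick pick]) auto
  qed
  have dom: "R_domain \<rho> = \<Union>\<I>" by (simp add: R_domain_def \<I>_def)
  have props: "open I" "is_interval I" "R_hat_domain \<rho> \<subseteq> I" "\<And>x. x \<in> I \<Longrightarrow> real_analytic_at (pick I) x"
    "\<And>t. t \<in> R_hat_domain \<rho> - {0} \<Longrightarrow> pick I t = R_hat \<rho> t" if "I \<in> \<I>" for I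
    using pick[OF that] unfolding R_extension_def real_analytic_on_iff by auto
  have ne: "\<exists>I. I \<in> \<I>" using R_extension_R_hat_domain by (auto simp: \<I>_def)
  have "R_extension \<rho> (\<Union>\<I>) f"
    unfolding R_extension_def real_analytic_on_iff
  proof (intro conjI ballI)
    show "open (\<Union>\<I>)" using props(1) by auto
    have "connected (\<Union>\<I>)"
    proof (rule connected_Union)
      show "connected S" if "S \<in> \<I>" for S using props(2)[OF that] by (rule is_interval_connected)
      show "\<Inter>\<I> \<noteq> {}" using props(3) zero_in_R_hat_domain by blast
    qed
    thus "is_interval (\<Union>\<I>)" by (simp add: is_interval_connected_1)
    show "R_hat_domain \<rho> \<subseteq> \<Union>\<I>" using ne props(3) by blast
    show "f t = R_hat \<rho> t" if "t \<in> R_hat_domain \<rho> - {0}" for t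
    proof -
      obtain I where "I \<in> \<I>" using ne by blast
      moreover have "t \<in> I" using props(3)[OF \<open>I \<in> \<I>\<close>] that by auto
      ultimately show ?thesis using f_eq props(5) that by simp
    qed
    fix x assume "x \<in> \<Union>\<I>"
    then obtain I where I: "I \<in> \<I>" "x \<in> I" by blast
    have "\<forall>\<^sub>F t in nhds x. t \<in> I" using props(1)[OF I(1)] I(2) by (intro eventually_nhds_in_open)
    hence "\<forall>\<^sub>F t in nhds x. pick I t = f t" by eventually_elim (simp add: f_eq[OF I(1)])
    thus "real_analytic_at f x" using props(4)[OF I] real_analytic_at_cong by blast
  qed
  thus ?thesis unfolding R_transform_def dom by (rule someI[of "R_extension \<rho> (\<Union>\<I>)"])
qed

lemma open_R_domain: "open (R_domain \<rho>)"
  and is_interval_R_domain: "is_interval (R_domain \<rho>)"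
  and R_hat_domain_subset: "R_hat_domain \<rho> \<subseteq> R_domain \<rho>"
  and real_analytic_at_R_transform: "t \<in> R_domain \<rho> \<Longrightarrow> real_analytic_at (R_transform \<rho>) t"
  and R_transform_eq_R_hat: "t \<in> R_hat_domain \<rho> \<Longrightarrow> t \<noteq> 0 \<Longrightarrow> R_transform \<rho> t = R_hat \<rho> t"
  using R_extension_R_transform unfolding R_extension_def real_analytic_on_iff by auto

lemma zero_in_R_domain: "0 \<in> R_domain \<rho>"
  using zero_in_R_hat_domain R_hat_domain_subset by blast

lemma R_transform_stieltjes:
  assumes "z < a"
  shows "- G z \<in> R_domain \<rho>" "R_transform \<rho> (- G z) = z + 1 / G z"
proof -
  have m: "- G z \<in> R_hat_domain \<rho>"
    using stieltjes_pos[OF assms] stieltjes_less_lower_edge[OF assms] by (rule R_hat_domainI)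
  thus "- G z \<in> R_domain \<rho>" using R_hat_domain_subset by blast
  show "R_transform \<rho> (- G z) = z + 1 / G z"
    using R_transform_eq_R_hat[OF m] stieltjes_pos[OF assms] stieltjes_inv_stieltjes[of z] assms
    by (simp add: R_hat_def)
qed

section \<open>Positivity at the edge of the support\<close>

text \<open>As \<open>a\<close> belongs to the support, the half-line below \<open>c\<close> has
  positive mass, and on it the integrand is at least its value at \<open>c\<close>.\<close>

lemma pole_moment_lower_bound:
  assumes z: "z < a" and c: "a < c"
  obtains m where "m > 0" "\<And>n. m * (1 / (c - z)) ^ Suc n \<le> pole_moment z n"
proof (rule that[of "measure \<rho> {..<c}"])
  have "emeasure \<rho> {..<c} > 0" using a_in_supp c unfolding supp_def by auto
  thus "measure \<rho> {..<c} > 0" by (simp add: emeasure_eq_measure)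
  fix n
  have sets: "{..<c} \<in> sets \<rho>" by simp
  have "(\<integral>x. indicator {..<c} x * (1 / (c - z)) ^ Suc n \<partial>\<rho>) \<le> pole_moment z n"
    unfolding pole_moment_def
  proof (rule integral_mono_AE)
    show "integrable \<rho> (\<lambda>x. indicator {..<c} x * (1 / (c - z)) ^ Suc n)"
      by (intro integrable_mult_left integrable_real_indicator sets) (simp add: emeasure_eq_measure)
    show "integrable \<rho> (\<lambda>x. (1 / (x - z)) ^ Suc n)" using z by (intro integrable_pole_power) auto
    show "AE x in \<rho>. indicator {..<c} x * (1 / (c - z)) ^ Suc n \<le> (1 / (x - z)) ^ Suc n"
    proof (rule AE_rangeI)
      fix x assume x: "a \<le> x" "x \<le> b"
      show "indicator {..<c} x * (1 / (c - z)) ^ Suc n \<le> (1 / (x - z)) ^ Suc n"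
      proof (cases "x < c")
        case True
        hence "(1 / (c - z)) ^ Suc n \<le> (1 / (x - z)) ^ Suc n"
          using x z by (intro power_mono divide_left_mono) auto
        thus ?thesis using True by simp
      next
        case False
        thus ?thesis using x z by simp
      qed
    qed
  qed
  moreover have "(\<integral>x. indicator {..<c} x * (1 / (c - z)) ^ Suc n \<partial>\<rho>) = measure \<rho> {..<c} * (1 / (c - z)) ^ Suc n"
    by (subst integral_mult_left_zero) simp
  ultimately show "measure \<rho> {..<c} * (1 / (c - z)) ^ Suc n \<le> pole_moment z n" by simp
qed

lemma pole_moment_pos:
  assumes "z < a"
  shows "pole_moment z n > 0"
proof -
  obtain m where m: "m > 0" "\<And>n. m * (1 / (a + 1 - z)) ^ Suc n \<le> pole_moment z n"
    using pole_moment_lower_bound[OF assms, of "a + 1"] by auto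
  have "0 < m * (1 / (a + 1 - z)) ^ Suc n" using m(1) assms by (intro mult_pos_pos zero_less_power) auto
  thus ?thesis using m(2)[of n] by linarith
qed

text \<open>With \<open>c\<close> strictly between \<open>a\<close> and z + s, the lower bound by
  powers of 1/(c - z) keeps the terms away from 0. So the radius of convergence at \<open>z\<close>
  is at most the distance to the edge.\<close>

lemma pole_moment_not_summable:
  assumes z: "z < a" and s: "a - z < s"
  shows "\<not> summable (\<lambda>n. pole_moment z n * s ^ n)"
proof
  assume "summable (\<lambda>n. pole_moment z n * s ^ n)"
  hence lim: "(\<lambda>n. pole_moment z n * s ^ n) \<longlonglongrightarrow> 0" by (rule summable_LIMSEQ_zero)
  define c where "c = (a + (z + s)) / 2"
  have c: "a < c" "c - z < s" "0 < c - z" using z s by (auto simp: c_def field_simps)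
  obtain m where m: "m > 0" "\<And>n. m * (1 / (c - z)) ^ Suc n \<le> pole_moment z n"
    using pole_moment_lower_bound[OF z c(1)] by blast
  have "m * (1 / (c - z)) \<le> pole_moment z n * s ^ n" for n
  proof -
    have "m * (1 / (c - z)) * 1 \<le> m * (1 / (c - z)) * (s / (c - z)) ^ n"
      using m c by (intro mult_left_mono one_le_power) auto
    also have "\<dots> = m * (1 / (c - z)) ^ Suc n * s ^ n" by (simp add: power_divide)
    also have "\<dots> \<le> pole_moment z n * s ^ n" using m(2) s z by (intro mult_right_mono) auto
    finally show ?thesis by simp
  qed
  hence "m * (1 / (c - z)) \<le> 0" using LIMSEQ_le_const[OF lim] by blast
  thus False using m c by (simp add: mult_le_0_iff divide_le_0_iff)
qed

text \<open>A Pringsheim-type argument: the Taylor coefficients of the Stieltjes transform to the left of the support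
  are positive, so the series cannot converge beyond the edge of the support.\<close>

lemma no_continuation_across_lower_edge:
  assumes "real_analytic_at J a" "\<forall>\<^sub>F z in at_left a. J z = G z"
  shows False
proof -
  obtain r where r: "r > 0" "\<forall>x. \<bar>x - a\<bar> < r \<longrightarrow>
       (\<exists>F. fps_conv_radius F \<ge> ereal r \<and> (\<forall>t. \<bar>t\<bar> < r \<longrightarrow> (\<lambda>n. fps_nth F n * t ^ n) sums J (x + t)))"
    using real_analytic_at_uniform_expansion[OF assms(1)] by (elim exE conjE)
  obtain e where e: "e < a" "\<And>y. e < y \<Longrightarrow> y < a \<Longrightarrow> J y = G y"
    using assms(2) unfolding eventually_at_left_field by blast
  \<comment> \<open>Close enough to \<open>a\<close> that a disc of radius \<open>r\<close> about
    \<open>x\<close> reaches beyond the edge, and right of \<open>e\<close>, where \<open>J\<close>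
    and \<open>G\<close> agree. The radius 3/4 r is then larger than a - x yet still inside the
    disc.\<close>
  define x where "x = max (a - r / 2) ((a + e) / 2)"
  have x: "e < x" "x < a" "a - x \<le> r / 2" using e(1) r(1) by (auto simp: x_def max_def field_simps)
  have "\<bar>x - a\<bar> < r" using x r by auto
  then obtain F where F: "\<And>t. \<bar>t\<bar> < r \<Longrightarrow> (\<lambda>n. fps_nth F n * t ^ n) sums J (x + t)"
    using r(2) by blast
  have ev: "\<forall>\<^sub>F t in nhds 0. t \<in> ball 0 (min r (min (x - e) (a - x)))"
    using r x by (intro eventually_nhds_in_open) auto
  hence "\<forall>\<^sub>F t in nhds 0. (\<lambda>n. fps_nth F n * t ^ n) sums G (x + t)"
  proof eventually_elim
    case (elim t)
    hence "e < x + t" "x + t < a" "\<bar>t\<bar> < r" by (auto simp: dist_real_def)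
    thus ?case using F[of t] e(2)[of "x + t"] by simp
  qed
  hence "(\<lambda>t. G (x + t)) has_fps_expansion F" by (rule has_fps_expansionI)
  moreover have "(\<lambda>t. G (x + t)) has_fps_expansion Abs_fps (pole_moment x)"
    using x by (intro stieltjes_has_fps_expansion) auto
  ultimately have "F = Abs_fps (pole_moment x)" by (rule has_fps_expansion_real_unique)
  hence "summable (\<lambda>n. pole_moment x n * (3 / 4 * r) ^ n)"
    using F[of "3 / 4 * r"] r(1) by (auto simp: sums_iff)
  moreover have "a - x < 3 / 4 * r" using x r(1) by linarith
  ultimately show False using pole_moment_not_summable[OF x(2)] by blast
qed

text \<open>Cauchy-Schwarz for the weight y^(n+1), obtained by expanding the integral of y^(n+1) (y
  - c)^2 at its minimising \<open>c\<close>.\<close>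

lemma pole_moment_logconvex:
  assumes z: "z < a"
  shows "pole_moment z (Suc n) ^ 2 \<le> pole_moment z n * pole_moment z (Suc (Suc n))"
proof -
  define c where "c = pole_moment z (Suc n) / pole_moment z n"
  have zn: "z \<notin> {a..b}" using z by auto
  note int = integrable_pole_power[OF zn]
  define y where "y x = 1 / (x - z)" for x
  have int': "integrable \<rho> (\<lambda>x. y x ^ k)" for k using int by (simp add: y_def)
  have "0 \<le> (\<integral>x. y x ^ Suc n * (y x - c) ^ 2 \<partial>\<rho>)"
    using z by (intro integral_nonneg_AE AE_rangeI) (auto simp: y_def)
  also have "\<dots> = (\<integral>x. y x ^ Suc (Suc (Suc n)) - (2 * c * y x ^ Suc (Suc n) - c ^ 2 * y x ^ Suc n) \<partial>\<rho>)"
    by (intro Bochner_Integration.integral_cong) (auto simp: power2_eq_square algebra_simps)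
  also have "\<dots> = pole_moment z (Suc (Suc n)) - (2 * c * pole_moment z (Suc n) - c ^ 2 * pole_moment z n)"
    using int' by (simp add: pole_moment_def del: power_Suc flip: y_def)
  finally have "2 * c * pole_moment z (Suc n) - c ^ 2 * pole_moment z n \<le> pole_moment z (Suc (Suc n))" by simp
  moreover have "2 * c * pole_moment z (Suc n) - c ^ 2 * pole_moment z n = pole_moment z (Suc n) ^ 2 / pole_moment z n"
    using pole_moment_pos[OF z, of n] by (simp add: c_def field_simps power2_eq_square)
  ultimately have "pole_moment z (Suc n) ^ 2 / pole_moment z n \<le> pole_moment z (Suc (Suc n))" by linarith
  thus ?thesis using pole_moment_pos[OF z, of n] by (simp add: field_simps)
qed

text \<open>The variance of 1/(x - z) is nonnegative. In terms of 1/G this says that its derivative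
  is at most -1.\<close>

lemma pole_moment_0_sq_le:
  assumes z: "z < a"
  shows "pole_moment z 0 ^ 2 \<le> pole_moment z 1"
proof -
  define c where "c = pole_moment z 0"
  have zn: "z \<notin> {a..b}" using z by auto
  define y where "y x = 1 / (x - z)" for x
  have int': "integrable \<rho> (\<lambda>x. y x ^ k)" for k using integrable_pole_power[OF zn] by (simp add: y_def)
  have int1: "integrable \<rho> y" using int'[of 1] by simp
  have "0 \<le> (\<integral>x. (y x - c) ^ 2 \<partial>\<rho>)" by (intro integral_nonneg_AE) auto
  also have "\<dots> = (\<integral>x. y x ^ 2 - (2 * c * y x - c ^ 2) \<partial>\<rho>)"
    by (intro Bochner_Integration.integral_cong) (auto simp: power2_eq_square algebra_simps)
  also have "\<dots> = pole_moment z 1 - (2 * c * pole_moment z 0 - c ^ 2)"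
    using int'[of 2] int1 prob_space by (simp add: pole_moment_def numeral_2_eq_2 flip: y_def)
  finally show ?thesis by (simp add: c_def power2_eq_square)
qed

text \<open>The sign conditions that \<open>subordination_coeffs_nonneg\<close> requires of
  \<open>U\<close> and \<open>V\<close>, here for the series of 1/G.\<close>

lemma inverse_stieltjes_coeffs:
  assumes z: "z < a"
  shows "k \<ge> 1 \<Longrightarrow> fps_nth (inverse (Abs_fps (pole_moment z))) k \<le> 0"
    and "fps_nth (inverse (Abs_fps (pole_moment z))) 1 \<le> -1"
proof -
  let ?P = "Abs_fps (pole_moment z)"
  show "k \<ge> 1 \<Longrightarrow> fps_nth (inverse ?P) k \<le> 0"
    using pole_moment_pos[OF z] pole_moment_logconvex[OF z] by (intro kaluza) auto
  have p0: "pole_moment z 0 > 0" by (rule pole_moment_pos[OF z])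
  have "fps_nth (inverse ?P * ?P) 1 = 0"
    using p0 by (subst inverse_mult_eq_1) auto
  hence "pole_moment z 1 / pole_moment z 0 + fps_nth (inverse ?P) 1 * pole_moment z 0 = 0"
    by (simp add: fps_mult_nth numeral_2_eq_2 field_simps)
  hence "fps_nth (inverse ?P) 1 = - pole_moment z 1 / pole_moment z 0 ^ 2"
    using p0 by (simp add: field_simps power2_eq_square add_eq_0_iff)
  also have "\<dots> \<le> -1" using pole_moment_0_sq_le[OF z] p0 by (simp add: field_simps)
  finally show "fps_nth (inverse ?P) 1 \<le> -1" .
qed

end

section \<open>Comparison of the edge values\<close>

text \<open>One half of the subordination pair, to be applied with either summand in the role of
  \<mu>. \<open>A\<close> is the centred series of \<omega> = K_\<mu> o G_\<rho>, and
  \<open>P oo A = Q\<close> expresses G_\<mu> o \<omega> = G_\<rho> as an identity of series; its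
  coefficient of index 1 gives the positive slope of \<omega>.\<close>

lemma subordination_expansion:
  fixes \<mu> \<rho> :: "real measure"
  assumes \<mu>: "compact_distribution \<mu>" and \<rho>: "compact_distribution \<rho>"
    and x: "x < supp_lower \<rho>" and w: "w < supp_lower \<mu>" and eq: "stieltjes \<mu> w = stieltjes \<rho> x"
    and P_def: "P = Abs_fps (compact_distribution.pole_moment \<mu> w)"
    and Q_def: "Q = Abs_fps (compact_distribution.pole_moment \<rho> x)"
  obtains A where "(\<lambda>t. stieltjes_inv \<mu> (stieltjes \<rho> (x + t)) - w) has_fps_expansion A"
    "fps_nth A 0 = 0" "fps_nth A 1 > 0" "P oo A = Q" "inverse P oo A = inverse Q"
    "\<forall>\<^sub>F t in nhds 0. stieltjes \<mu> (stieltjes_inv \<mu> (stieltjes \<rho> (x + t))) = stieltjes \<rho> (x + t)"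
proof -
  interpret M: compact_distribution \<mu> by (rule \<mu>)
  interpret R: compact_distribution \<rho> by (rule \<rho>)
  define \<omega> where "\<omega> t = M.K (R.G (x + t)) - w" for t
  have Q: "(\<lambda>t. R.G (x + t)) has_fps_expansion Q"
    unfolding Q_def using x by (intro R.stieltjes_has_fps_expansion) auto
  have P: "(\<lambda>t. M.G (w + t)) has_fps_expansion P"
    unfolding P_def using w by (intro M.stieltjes_has_fps_expansion) auto
  have GR: "real_analytic_at (\<lambda>t. R.G (x + t)) 0"
    unfolding real_analytic_at_iff_has_fps_expansion using Q by auto
  have "real_analytic_at M.K (M.G w)" using w by (intro M.real_analytic_at_stieltjes_inv) auto
  hence "real_analytic_at \<omega> 0" unfolding \<omega>_def eq
    using real_analytic_at_compose[OF GR] by (intro real_analytic_at_diff real_analytic_at_const) simp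
  then obtain A where A: "\<omega> has_fps_expansion A"
    unfolding real_analytic_at_iff_has_fps_expansion by auto
  have "\<omega> 0 = fps_nth A 0" using has_fps_expansion_nth_0[of \<omega> 0 A] A by simp
  moreover have "M.K (M.G w) = w" using w by (intro M.stieltjes_inv_stieltjes) auto
  ultimately have A0: "fps_nth A 0 = 0" by (simp add: \<omega>_def eq)
  have "\<forall>\<^sub>F g in nhds (R.G x). g \<in> {0<..} \<inter> ereal -` {..<M.edge}"
    using R.stieltjes_pos[OF x] M.stieltjes_less_lower_edge[OF w] eq
    by (intro eventually_nhds_in_open open_Int open_ereal_vimage) auto
  moreover have "filterlim (\<lambda>t. R.G (x + t)) (nhds (R.G x)) (nhds 0)"
    using isCont_filterlim_nhds[OF real_analytic_at_isCont[OF GR]] by simp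
  ultimately have "\<forall>\<^sub>F t in nhds 0. R.G (x + t) \<in> {0<..} \<inter> ereal -` {..<M.edge}"
    by (rule eventually_compose_filterlim)
  hence ev: "\<forall>\<^sub>F t in nhds 0. M.G (M.K (R.G (x + t))) = R.G (x + t)"
    by eventually_elim (simp add: M.stieltjes_inv_left)
  have PA: "P oo A = Q"
  proof (rule has_fps_expansion_real_compose[OF P A A0, symmetric])
    have "\<forall>\<^sub>F t in nhds 0. R.G (x + t) = M.G (w + \<omega> t)"
      using ev by eventually_elim (simp add: \<omega>_def)
    thus "(\<lambda>t. M.G (w + \<omega> t)) has_fps_expansion Q"
      using Q has_fps_expansion_cong by fast
  qed
  have Ppos: "fps_nth P k > 0" for k unfolding P_def using M.pole_moment_pos[OF w] by simp
  have "fps_nth P 1 * fps_nth A 1 = fps_nth Q 1"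
    using fps_compose_nth_split[OF A0, of 1 P] PA by simp
  also have "\<dots> > 0" unfolding Q_def using R.pole_moment_pos[OF x] by simp
  finally have "fps_nth A 1 > 0" using Ppos[of 1] by (metis zero_less_mult_pos)
  moreover have "inverse P oo A = inverse Q"
    using Ppos[of 0] A0 PA by (subst fps_inverse_compose) auto
  ultimately show ?thesis using that A A0 PA ev unfolding \<omega>_def by blast
qed

text \<open>With \<open>K\<^sub>\<rho>\<close> the inverse of the Stieltjes transform \<open>G\<^sub>\<rho>\<close>, the subordination function
  \<open>\<omega> = K\<^sub>\<mu> \<circ> G\<^sub>\<rho>\<close> has nonnegative Taylor coefficients, which are dominated by those of \<open>G\<^sub>\<rho>\<close>. Hence its Taylor
  series converges up to the edge of \<open>\<rho>\<close>. If it reached the edge of \<open>\<mu>\<close> before, then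
  \<open>G\<^sub>\<rho> \<circ> \<omega>\<^sup>-\<^sup>1\<close> would continue \<open>G\<^sub>\<mu>\<close> across the edge of \<open>\<mu>\<close>.\<close>

lemma subordination_lower_edge_le:
  fixes \<mu> \<nu> \<rho> :: "real measure"
  assumes \<mu>: "compact_distribution \<mu>" and \<nu>: "compact_distribution \<nu>" and \<rho>: "compact_distribution \<rho>"
    and g0: "0 < g0" "ereal g0 < stieltjes_lower_edge \<mu>" "ereal g0 < stieltjes_lower_edge \<nu>"
      "ereal g0 < stieltjes_lower_edge \<rho>"
    and eq: "\<forall>\<^sub>F g in nhds g0. stieltjes_inv \<rho> g = stieltjes_inv \<mu> g + stieltjes_inv \<nu> g + 1 / g"
  shows "stieltjes_lower_edge \<rho> \<le> stieltjes_lower_edge \<mu>"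
proof -
  interpret M: compact_distribution \<mu> by (rule \<mu>)
  interpret N: compact_distribution \<nu> by (rule \<nu>)
  interpret R: compact_distribution \<rho> by (rule \<rho>)
  define x0 where "x0 = R.K g0"
  define w1 where "w1 = M.K g0"
  define w2 where "w2 = N.K g0"
  have x0: "x0 < R.a" "R.G x0 = g0" using R.stieltjes_inv_left[OF g0(1,4)] by (auto simp: x0_def)
  have w1: "w1 < M.a" "M.G w1 = g0" using M.stieltjes_inv_left[OF g0(1,2)] by (auto simp: w1_def)
  have w2: "w2 < N.a" "N.G w2 = g0" using N.stieltjes_inv_left[OF g0(1,3)] by (auto simp: w2_def)
  define P where "P = Abs_fps (M.pole_moment w1)"
  define S where "S = Abs_fps (N.pole_moment w2)"
  define Q where "Q = Abs_fps (R.pole_moment x0)"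
  have Q: "(\<lambda>t. R.G (x0 + t)) has_fps_expansion Q"
    unfolding Q_def using x0 by (intro R.stieltjes_has_fps_expansion) auto
  have Ppos: "fps_nth P k > 0" for k unfolding P_def using M.pole_moment_pos[OF w1(1)] by simp
  have Q0: "fps_nth Q 0 = g0" using has_fps_expansion_nth_0[OF Q] x0(2) by simp
  obtain A where A: "(\<lambda>t. M.K (R.G (x0 + t)) - w1) has_fps_expansion A"
    and A0: "fps_nth A 0 = 0" and A1: "fps_nth A 1 > 0" and PA: "P oo A = Q" "inverse P oo A = inverse Q"
    and inv: "\<forall>\<^sub>F t in nhds 0. M.G (M.K (R.G (x0 + t))) = R.G (x0 + t)"
    by (rule subordination_expansion[OF \<mu> \<rho> x0(1) w1(1) _ P_def Q_def]) (use w1 x0 in auto)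
  obtain B where B: "(\<lambda>t. N.K (R.G (x0 + t)) - w2) has_fps_expansion B"
    and B0: "fps_nth B 0 = 0" and B1: "fps_nth B 1 > 0" and SB: "inverse S oo B = inverse Q"
    by (rule subordination_expansion[OF \<nu> \<rho> x0(1) w2(1) _ S_def Q_def]) (use w2 x0 in auto)
  define \<omega>1 where "\<omega>1 t = M.K (R.G (x0 + t)) - w1" for t
  define \<omega>2 where "\<omega>2 t = N.K (R.G (x0 + t)) - w2" for t
  note A = A[folded \<omega>1_def] and B = B[folded \<omega>2_def]
  \<comment> \<open>The hypothesis \<open>eq\<close> evaluated at g = G_\<rho>(x0 + t). The offsets
    only affect the constant coefficient, so the recursion is used from index 1 on.\<close>
  have sum: "A + B + inverse Q = fps_X + fps_const (x0 - w1 - w2)"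
  proof (rule has_fps_expansion_real_unique)
    show "(\<lambda>t. \<omega>1 t + \<omega>2 t + inverse (R.G (x0 + t))) has_fps_expansion (A + B + inverse Q)"
      using Q0 g0(1) by (intro has_fps_expansion_add has_fps_expansion_inverse A B Q) auto
    have "(\<lambda>t. t + (x0 - w1 - w2)) has_fps_expansion (fps_X + fps_const (x0 - w1 - w2))"
      by (intro has_fps_expansion_add has_fps_expansion_fps_X has_fps_expansion_const)
    moreover have "\<forall>\<^sub>F t in nhds 0. t + (x0 - w1 - w2) = \<omega>1 t + \<omega>2 t + inverse (R.G (x0 + t))"
    proof -
      have "\<forall>\<^sub>F t in nhds 0. t \<in> {..<R.a - x0}" using x0 by (intro eventually_nhds_in_open) auto
      moreover have "filterlim (\<lambda>t. R.G (x0 + t)) (nhds g0) (nhds 0)"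
        using isCont_filterlim_nhds[OF has_fps_expansion_imp_continuous[OF Q, of UNIV]] x0(2) by simp
      from eventually_compose_filterlim[OF eq this]
      have "\<forall>\<^sub>F t in nhds 0. R.K (R.G (x0 + t)) = M.K (R.G (x0 + t)) + N.K (R.G (x0 + t)) + 1 / R.G (x0 + t)" .
      ultimately show ?thesis
      proof eventually_elim
        case (elim t)
        have "R.K (R.G (x0 + t)) = x0 + t"
          using elim(1) by (intro R.stieltjes_inv_stieltjes) auto
        thus ?case using elim(2) by (simp add: \<omega>1_def \<omega>2_def divide_inverse)
      qed
    qed
    ultimately show "(\<lambda>t. \<omega>1 t + \<omega>2 t + inverse (R.G (x0 + t))) has_fps_expansion (fps_X + fps_const (x0 - w1 - w2))"
      using has_fps_expansion_cong by fast
  qed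
  have "fps_nth A k \<ge> 0 \<and> fps_nth B k \<ge> 0" for k
  proof (rule subordination_coeffs_nonneg[OF A0 B0 A1 B1])
    show "inverse P oo A = inverse Q" by (rule PA(2))
    show "inverse S oo B = inverse Q" by (rule SB)
    show "fps_nth (inverse P) k \<le> 0" if "k \<ge> 1" for k
      unfolding P_def by (rule M.inverse_stieltjes_coeffs(1)[OF w1(1) that])
    show "fps_nth (inverse S) k \<le> 0" if "k \<ge> 1" for k
      unfolding S_def by (rule N.inverse_stieltjes_coeffs(1)[OF w2(1) that])
    show "fps_nth (inverse P) 1 \<le> -1"
      unfolding P_def by (rule M.inverse_stieltjes_coeffs(2)[OF w1(1)])
    show "fps_nth (inverse S) 1 \<le> -1"
      unfolding S_def by (rule N.inverse_stieltjes_coeffs(2)[OF w2(1)])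
    show "fps_nth A k + fps_nth B k + fps_nth (inverse Q) k = (if k = 1 then 1 else 0)" if "k \<ge> 1" for k
      using arg_cong[OF sum, of "\<lambda>F. fps_nth F k"] that by simp
  qed
  hence Ann: "fps_nth A k \<ge> 0" for k by blast
  have dom: "fps_nth A k \<le> fps_nth Q k / fps_nth P 1" if "k \<ge> 1" for k
    using fps_compose_nth_ge[OF A0 Ann less_imp_le[OF Ppos] that] PA(1) Ppos[of 1] by (simp add: field_simps)
  define L where "L = R.a - x0"
  have L: "L > 0" "R.gap x0 = L" using x0 R.a_le_b by (auto simp: L_def R.gap_def)
  have x0n: "x0 \<notin> {R.a..R.b}" using x0 by auto
  have radius: "fps_conv_radius A \<ge> ereal L"
    unfolding fps_conv_radius_def
  proof (rule conv_radius_geI_ex)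
    fix r :: real assume r: "0 < r" "ereal r < ereal L"
    have "summable (\<lambda>n. fps_nth Q n * r ^ n)"
      using R.stieltjes_sums[OF x0n, of r] r L by (auto simp: Q_def sums_iff)
    hence "summable (\<lambda>n. fps_nth Q n * r ^ n / fps_nth P 1)" by (rule summable_divide)
    hence "summable (\<lambda>n. fps_nth A n * r ^ n)"
    proof (rule summable_comparison_test'[of _ 1])
      fix n :: nat assume "n \<ge> 1"
      have "fps_nth A n * r ^ n \<le> fps_nth Q n / fps_nth P 1 * r ^ n"
        using dom[OF \<open>n \<ge> 1\<close>] r by (intro mult_right_mono) auto
      thus "norm (fps_nth A n * r ^ n) \<le> fps_nth Q n * r ^ n / fps_nth P 1" using Ann[of n] r by simp
    qed
    thus "\<exists>z. norm z = r \<and> summable (\<lambda>n. fps_nth A n * z ^ n)" using r by (intro exI[of _ r]) auto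
  qed
  define s where "s = eval_fps A"
  have rad: "ereal \<bar>\<tau>\<bar> < fps_conv_radius A" if "\<bar>\<tau>\<bar> < L" for \<tau>
    using that radius by (metis less_ereal.simps(1) less_le_trans)
  have s0: "s 0 = 0" by (simp add: s_def eval_fps_at_0 A0)
  have s_sums: "(\<lambda>n. fps_nth A n * \<tau> ^ n) sums s \<tau>" if "\<bar>\<tau>\<bar> < L" for \<tau>
    unfolding s_def using rad[OF that] by (intro sums_eval_fps) auto
  have s_an: "real_analytic_at s \<tau>" if "\<bar>\<tau>\<bar> < L" for \<tau>
    unfolding s_def by (rule real_analytic_at_eval_fps[OF rad[OF that]])
  have s_deriv: "\<exists>d. (s has_real_derivative d) (at \<tau>) \<and> 0 < d" if "0 \<le> \<tau>" "\<tau> < L" for \<tau>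
  proof (intro exI conjI)
    have r: "ereal \<bar>\<tau>\<bar> < fps_conv_radius A" using that by (intro rad) simp
    show "(s has_real_derivative eval_fps (fps_deriv A) \<tau>) (at \<tau>)"
      unfolding s_def using r by (intro has_field_derivative_eval_fps) auto
    have "ereal \<bar>\<tau>\<bar> < fps_conv_radius (fps_deriv A)" using r fps_conv_radius_deriv[of A] by order
    hence "(\<lambda>n. fps_nth (fps_deriv A) n * \<tau> ^ n) sums eval_fps (fps_deriv A) \<tau>"
      by (intro sums_eval_fps) auto
    hence "summable (\<lambda>n. fps_nth (fps_deriv A) n * \<tau> ^ n)"
      "(\<Sum>n. fps_nth (fps_deriv A) n * \<tau> ^ n) = eval_fps (fps_deriv A) \<tau>" by (auto simp: sums_iff)
    hence "(\<Sum>n\<in>{0}. fps_nth (fps_deriv A) n * \<tau> ^ n) \<le> eval_fps (fps_deriv A) \<tau>"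
      using sum_le_suminf[of "\<lambda>n. fps_nth (fps_deriv A) n * \<tau> ^ n" "{0}"] Ann that by simp
    thus "0 < eval_fps (fps_deriv A) \<tau>" using A1 by simp
  qed
  have s_less: "s x < s y" if "0 \<le> x" "x < y" "y < L" for x y
    by (rule DERIV_pos_imp_increasing[OF that(2)]) (use s_deriv that in auto)
  \<comment> \<open>The identity theorem is applied on an interval symmetric about 0. Nonnegative
    coefficients bound \<open>s\<close> at negative arguments by its value at |\<tau>|, so w1 +
    s(\<tau>) stays left of the edge of \<mu> there too.\<close>
  have s_abs: "s \<tau> \<le> s \<bar>\<tau>\<bar>" if "\<bar>\<tau>\<bar> < L" for \<tau>
  proof (rule sums_le[OF _ s_sums[OF that] s_sums])
    show "fps_nth A n * \<tau> ^ n \<le> fps_nth A n * \<bar>\<tau>\<bar> ^ n" for n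
      using Ann by (intro mult_left_mono) (auto simp flip: power_abs)
  qed (use that in auto)
  define D where "D = M.a - w1"
  \<comment> \<open>The parameter \<open>T\<close> serves two uses: the time at which
    \<open>s\<close> would reach the edge of \<mu>, inside the contradiction, and the full length
    \<open>L\<close> once that is excluded.\<close>
  have identity: "M.G (w1 + s \<tau>) = R.G (x0 + \<tau>)"
    if T: "0 < T" "T \<le> L" "\<And>\<tau>. 0 \<le> \<tau> \<Longrightarrow> \<tau> < T \<Longrightarrow> s \<tau> < D" and \<tau>: "\<bar>\<tau>\<bar> < T" for T \<tau>
  proof (rule real_analytic_identity[where I = "{-T<..<T}" and f = "\<lambda>\<tau>. M.G (w1 + s \<tau>)"
        and g = "\<lambda>\<tau>. R.G (x0 + \<tau>)" and ?x0.0 = 0 and x = \<tau>])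
    fix x assume x: "x \<in> {-T<..<T}"
    hence x': "\<bar>x\<bar> < T" by auto
    have "s x < D" using s_abs[of x] T(2) T(3)[of "\<bar>x\<bar>"] x' by auto
    hence "w1 + s x < M.a" by (simp add: D_def)
    hence "real_analytic_at M.G (w1 + s x)" by (intro M.real_analytic_at_stieltjes) auto
    thus "real_analytic_at (\<lambda>\<tau>. M.G (w1 + s \<tau>)) x"
      using x' T(2) by (intro real_analytic_at_compose[where f = "\<lambda>\<tau>. w1 + s \<tau>" and g = M.G] real_analytic_at_add
        real_analytic_at_const s_an) auto
    have "x0 + x < R.a" using x' T(2) by (auto simp: L_def)
    hence "real_analytic_at R.G (x0 + x)" by (intro R.real_analytic_at_stieltjes) auto
    thus "real_analytic_at (\<lambda>\<tau>. R.G (x0 + \<tau>)) x"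
      by (intro real_analytic_at_compose[where f = "\<lambda>\<tau>. x0 + \<tau>" and g = R.G] real_analytic_at_add
        real_analytic_at_const real_analytic_at_id)
  next
    have "\<forall>\<^sub>F t in nhds 0. s t = \<omega>1 t" using A unfolding has_fps_expansion_def s_def by blast
    thus "\<forall>\<^sub>F t in nhds 0. M.G (w1 + s t) = R.G (x0 + t)"
      using inv by eventually_elim (simp add: \<omega>1_def)
  qed (use T(1) \<tau> in auto)
  have below: "s \<tau> < D" if \<tau>: "0 \<le> \<tau>" "\<tau> < L" for \<tau>
  proof (rule ccontr)
    assume "\<not> s \<tau> < D"
    moreover have "D > 0" using w1 by (simp add: D_def)
    moreover have "\<forall>x. 0 \<le> x \<and> x \<le> \<tau> \<longrightarrow> isCont s x"
      using that s_an real_analytic_at_isCont by auto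
    ultimately obtain T where T: "0 \<le> T" "T \<le> \<tau>" "s T = D"
      using IVT[of s 0 D \<tau>] s0 \<tau> by auto
    have T0: "T > 0" using T s0 \<open>D > 0\<close> by (cases "T = 0") auto
    have TL: "T < L" using T \<tau> by simp
    have sD: "s x < D" if "0 \<le> x" "x < T" for x using s_less[of x T] that T TL by simp
    have "deriv s T > 0" using s_deriv[of T] T0 TL DERIV_imp_deriv by fastforce
    \<comment> \<open>The bound keeps [T - d, T + d] inside (0, L), where \<open>s\<close> is
      increasing and the left part of the interval is still covered by
      \<open>identity\<close>.\<close>
    hence "\<exists>\<sigma> d. 0 < d \<and> d \<le> min T (L - T) / 2 \<and> real_analytic_at \<sigma> (s T) \<and>
           (\<forall>x. \<bar>x - T\<bar> \<le> d \<longrightarrow> \<sigma> (s x) = x \<and> isCont s x)"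
      using s_an[of T] T0 TL by (intro real_analytic_local_inverse) auto
    then obtain \<sigma> d where d': "0 < d" "d \<le> min T (L - T) / 2" and \<sigma>_an: "real_analytic_at \<sigma> (s T)"
      and \<sigma>: "\<And>x. \<bar>x - T\<bar> \<le> d \<Longrightarrow> \<sigma> (s x) = x"
      by blast
    have d: "d > 0" "T - d > 0" "T + d < L" using d' T0 TL by (auto simp: min_def field_simps split: if_splits)
    define J where "J y = R.G (x0 + \<sigma> (y - w1))" for y
    have J1: "real_analytic_at (\<lambda>y. \<sigma> (y - w1)) M.a"
    proof (rule real_analytic_at_compose[where f = "\<lambda>y. y - w1" and g = \<sigma>])
      show "real_analytic_at \<sigma> (M.a - w1)" using \<sigma>_an T(3) by (simp add: D_def)
    qed (intro real_analytic_at_diff real_analytic_at_id real_analytic_at_const)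
    have "\<sigma> (M.a - w1) = T" using \<sigma>[of T] T(3) d by (simp add: D_def)
    hence "real_analytic_at R.G (x0 + \<sigma> (M.a - w1))"
      using TL by (intro R.real_analytic_at_stieltjes) (auto simp: L_def)
    hence "real_analytic_at J M.a" unfolding J_def
      by (intro real_analytic_at_compose[where f = "\<lambda>y. x0 + \<sigma> (y - w1)" and g = R.G] real_analytic_at_add
        real_analytic_at_const J1)
    moreover have "\<forall>\<^sub>F y in at_left M.a. J y = M.G y"
    proof -
      have "s (T - d) < D" using sD[of "T - d"] d by simp
      hence "w1 + s (T - d) < M.a" by (simp add: D_def)
      hence "\<forall>\<^sub>F y in at_left M.a. y \<in> {w1 + s (T - d)<..<M.a}" by (rule eventually_at_left_real)
      thus ?thesis
      proof eventually_elim
        case (elim y)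
        have "\<forall>x. T - d \<le> x \<and> x \<le> T \<longrightarrow> isCont s x"
          using d T0 TL by (auto intro!: real_analytic_at_isCont s_an)
        then obtain t where t: "T - d \<le> t" "t \<le> T" "s t = y - w1"
          using IVT[of s "T - d" "y - w1" T] elim T(3) d by (auto simp: D_def)
        have "t < T" using t elim T(3) by (cases "t = T") (auto simp: D_def)
        have "M.G (w1 + s t) = R.G (x0 + t)"
          by (rule identity[of T]) (use T0 TL sD t \<open>t < T\<close> d in auto)
        moreover have "\<sigma> (y - w1) = t" using \<sigma>[of t] t d by simp
        ultimately show ?case using t by (simp add: J_def)
      qed
    qed
    ultimately show False by (rule M.no_continuation_across_lower_edge)
  qed
  show ?thesis
    unfolding R.lower_edge_eq
  proof (rule SUP_least)
    fix z assume "z \<in> {..<R.a}"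
    \<comment> \<open>Points left of \<open>x0\<close> are moved to \<open>x0\<close> by
      monotonicity of G_\<rho>; the series is only controlled on [0, L).\<close>
    define \<tau> where "\<tau> = max 0 (z - x0)"
    have \<tau>: "0 \<le> \<tau>" "\<tau> < L" using \<open>z \<in> {..<R.a}\<close> L by (auto simp: \<tau>_def L_def)
    have "z \<le> x0 + \<tau>" "x0 + \<tau> < R.a" using \<tau> by (auto simp: \<tau>_def L_def)
    hence "R.G z \<le> R.G (x0 + \<tau>)" using R.stieltjes_less[of z "x0 + \<tau>"] by (cases "z = x0 + \<tau>") auto
    also have "R.G (x0 + \<tau>) = M.G (w1 + s \<tau>)"
      by (rule identity[of L, symmetric]) (use \<tau> L below in auto)
    finally have "ereal (R.G z) \<le> ereal (M.G (w1 + s \<tau>))" by simp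
    also have "\<dots> < M.edge"
      using below[OF \<tau>] by (intro M.stieltjes_less_lower_edge) (simp add: D_def)
    finally show "ereal (R.G z) \<le> M.edge" by (rule less_imp_le)
  qed
qed

section \<open>The functions F and E for a free convolution\<close>

text \<open>Positivity is required only in the open interval, since one endpoint will be a critical
  point of E.\<close>

lemma deriv_pos_imp_less:
  fixes f f' :: "real \<Rightarrow> real"
  assumes "x < y" "\<And>t. x \<le> t \<Longrightarrow> t \<le> y \<Longrightarrow> (f has_real_derivative f' t) (at t)"
    "\<And>t. x < t \<Longrightarrow> t < y \<Longrightarrow> f' t > 0"
  shows "f x < f y"
proof (rule DERIV_pos_imp_increasing_open[where f = f and a = x and b = y, OF assms(1)])
  show "\<exists>d. (f has_real_derivative d) (at t) \<and> 0 < d" if "x < t" "t < y" for t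
    using assms(2)[of t] assms(3)[of t] that by auto
  show "continuous_on {x..y} f"
    by (intro continuous_at_imp_continuous_on ballI) (rule DERIV_isCont[OF assms(2)], auto)
qed

lemma
  fixes f f' :: "real \<Rightarrow> real"
  assumes D: "\<forall>\<^sub>F x in nhds c. (f has_real_derivative f' x) (at x)"
  shows eventually_at_left_of_deriv_pos:
      "\<forall>\<^sub>F x in at_left c. f' x > 0 \<Longrightarrow> \<forall>\<^sub>F x in at_left c. f x < f c"
    and eventually_at_right_of_deriv_pos:
      "\<forall>\<^sub>F x in at_right c. f' x > 0 \<Longrightarrow> \<forall>\<^sub>F x in at_right c. f c < f x"
proof -
  obtain d where d: "d > 0" "\<And>x. dist x c < d \<Longrightarrow> (f has_real_derivative f' x) (at x)"
    using D unfolding eventually_nhds_metric by blast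
  {
    assume "\<forall>\<^sub>F x in at_left c. f' x > 0"
    then obtain l where l: "l < c" "\<And>y. l < y \<Longrightarrow> y < c \<Longrightarrow> f' y > 0"
      unfolding eventually_at_left_field by blast
    have "\<forall>\<^sub>F x in at_left c. x \<in> {max l (c - d)<..<c}"
      using d l by (intro eventually_at_left_real) auto
    thus "\<forall>\<^sub>F x in at_left c. f x < f c"
      by eventually_elim (rule deriv_pos_imp_less[of _ c f f'], auto intro!: d(2) l(2) simp: dist_real_def)
  }
  {
    assume "\<forall>\<^sub>F x in at_right c. f' x > 0"
    then obtain u where u: "c < u" "\<And>y. c < y \<Longrightarrow> y < u \<Longrightarrow> f' y > 0"
      unfolding eventually_at_right_field by blast
    have "\<forall>\<^sub>F x in at_right c. x \<in> {c<..<min u (c + d)}"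
      using d u by (intro eventually_at_right_real) auto
    thus "\<forall>\<^sub>F x in at_right c. f c < f x"
      by eventually_elim (rule deriv_pos_imp_less[of c _ f f'], auto intro!: d(2) u(2) simp: dist_real_def)
  }
qed

lemma
  fixes f f' :: "real \<Rightarrow> real"
  assumes D: "\<forall>\<^sub>F x in nhds c. (f has_real_derivative f' x) (at x)"
  shows eventually_at_left_of_deriv_neg:
      "\<forall>\<^sub>F x in at_left c. f' x < 0 \<Longrightarrow> \<forall>\<^sub>F x in at_left c. f c < f x"
    and eventually_at_right_of_deriv_neg:
      "\<forall>\<^sub>F x in at_right c. f' x < 0 \<Longrightarrow> \<forall>\<^sub>F x in at_right c. f x < f c"
proof -
  have D': "\<forall>\<^sub>F x in nhds c. ((\<lambda>x. - f x) has_real_derivative - f' x) (at x)"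
    using D by eventually_elim (rule DERIV_minus)
  show "\<forall>\<^sub>F x in at_left c. f' x < 0 \<Longrightarrow> \<forall>\<^sub>F x in at_left c. f c < f x"
    using eventually_at_left_of_deriv_pos[OF D'] by simp
  show "\<forall>\<^sub>F x in at_right c. f' x < 0 \<Longrightarrow> \<forall>\<^sub>F x in at_right c. f x < f c"
    using eventually_at_right_of_deriv_pos[OF D'] by simp
qed

text \<open>A strict comparison on one side suffices; \<open>F'\<close> is instantiated by
  \<open>at_left\<close> and \<open>at_right\<close>.\<close>

lemma
  assumes "open S" "F' \<le> at x" "F' \<noteq> bot"
  shows not_local_min_onI: "\<forall>\<^sub>F y in F'. f y < f x \<Longrightarrow> \<not> local_min_on S f x"
    and not_local_max_onI: "\<forall>\<^sub>F y in F'. f x < f y \<Longrightarrow> \<not> local_max_on S f x"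
proof -
  have *: "eventually P F'" if "eventually P (at x within S)" "x \<in> S" for P
    using that filter_leD[OF assms(2)] by (simp add: at_within_open[OF _ assms(1)])
  show "\<not> local_min_on S f x" if ev: "\<forall>\<^sub>F y in F'. f y < f x"
  proof
    assume "local_min_on S f x"
    hence "\<forall>\<^sub>F y in F'. f x \<le> f y" by (auto simp: local_min_on_def intro: *)
    with ev have "\<forall>\<^sub>F y in F'. False" by eventually_elim simp
    thus False using assms(3) by (simp add: trivial_limit_def)
  qed
  show "\<not> local_max_on S f x" if ev: "\<forall>\<^sub>F y in F'. f x < f y"
  proof
    assume "local_max_on S f x"
    hence "\<forall>\<^sub>F y in F'. f y \<le> f x" by (auto simp: local_max_on_def intro: *)
    with ev have "\<forall>\<^sub>F y in F'. False" by eventually_elim simp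
    thus False using assms(3) by (simp add: trivial_limit_def)
  qed
qed

section \<open>Logarithmic moments to the left of the support\<close>

context compact_distribution
begin

text \<open>Left of the support this is the logarithmic potential without the absolute value. For
  \<nu> it is the second term of E, evaluated at z - R_\<mu>(-g).\<close>

definition log_moment :: "real \<Rightarrow> real" where
  "log_moment h = (\<integral>x. ln (x - h) \<partial>\<rho>)"

lemma log_potential_eq_log_moment: "z < a \<Longrightarrow> log_potential \<rho> z = log_moment z"
  unfolding log_potential_def log_moment_def
  by (intro integral_cong_AE measurable_rho AE_rangeI) auto

lemma integrable_ln: "h < a \<Longrightarrow> integrable \<rho> (\<lambda>x. ln (x - h))"
proof (rule integrable_if_bounded)
  fix x assume "h < a" "a \<le> x" "x \<le> b"
  hence "ln (a - h) \<le> ln (x - h)" "ln (x - h) \<le> ln (b - h)" by auto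
  thus "\<bar>ln (x - h)\<bar> \<le> \<bar>ln (a - h)\<bar> + \<bar>ln (b - h)\<bar>" by linarith
qed measurable

lemma log_moment_bounds:
  assumes "h < a"
  shows "ln (a - h) \<le> log_moment h" "log_moment h \<le> ln (b - h)"
proof -
  have *: "ln (a - h) \<le> ln (x - h)" "ln (x - h) \<le> ln (b - h)" if "a \<le> x" "x \<le> b" for x
    using that assms by auto
  show "ln (a - h) \<le> log_moment h" unfolding log_moment_def
    by (rule integral_ge_const[OF integrable_ln[OF assms]]) (use * in \<open>auto intro!: AE_rangeI\<close>)
  show "log_moment h \<le> ln (b - h)" unfolding log_moment_def
    by (rule integral_le_const[OF integrable_ln[OF assms]]) (use * in \<open>auto intro!: AE_rangeI\<close>)
qed

text \<open>Differentiation under the integral through a quadratic remainder bound uniform over the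
  support: |ln(1 + u) - u| \<le> 2 u^2 for |u| \<le> 1/2. Moving \<open>h\<close> by less than half
  its distance to the edge ensures the condition on u and yields the constant
  \<open>C\<close>.\<close>

lemma log_moment_has_derivative:
  assumes h: "h < a"
  shows "(log_moment has_real_derivative - G h) (at h)"
proof -
  define C where "C = 2 / (a - h) ^ 2"
  have bound: "\<bar>log_moment k - log_moment h + (k - h) * G h\<bar> \<le> C * (k - h) ^ 2"
    if k: "\<bar>k - h\<bar> < (a - h) / 2" for k
  proof -
    have "k - h < (a - h) / 2" by (rule le_less_trans[OF abs_ge_self k])
    hence ka: "k < a" using h by (simp add: field_simps)
    have hn: "h \<notin> {a..b}" using h by auto
    have pw: "\<bar>ln (x - k) - ln (x - h) + (k - h) * (1 / (x - h))\<bar> \<le> C * (k - h) ^ 2" if x: "a \<le> x" "x \<le> b" for x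
    proof -
      define u where "u = (k - h) / (x - h)"
      have xh: "x - h > 0" "a - h \<le> x - h" using x h by auto
      have u: "\<bar>u\<bar> \<le> 1 / 2" using k xh h by (simp add: u_def abs_divide field_simps)
      have "x - k = (x - h) * (1 - u)" using xh by (simp add: u_def field_simps)
      hence "ln (x - k) = ln (x - h) + ln (1 - u)" using xh u by (simp add: ln_mult)
      hence "\<bar>ln (x - k) - ln (x - h) + (k - h) * (1 / (x - h))\<bar> = \<bar>ln (1 + (- u)) - (- u)\<bar>"
        by (simp add: u_def)
      also have "\<dots> \<le> 2 * (- u) ^ 2" using u by (intro abs_ln_one_plus_x_minus_x_bound) auto
      also have "\<dots> = 2 * (k - h) ^ 2 / (x - h) ^ 2" by (simp add: u_def power_divide)
      also have "\<dots> \<le> 2 * (k - h) ^ 2 / (a - h) ^ 2"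
        using xh h by (intro divide_left_mono power_mono mult_pos_pos) auto
      finally show ?thesis by (simp add: C_def)
    qed
    have int: "integrable \<rho> (\<lambda>x. ln (x - k) - ln (x - h) + (k - h) * (1 / (x - h)))"
      by (intro Bochner_Integration.integrable_add Bochner_Integration.integrable_diff integrable_ln ka h
          integrable_mult_right integrable_pole hn)
    have eq: "log_moment k - log_moment h + (k - h) * G h =
        (\<integral>x. ln (x - k) - ln (x - h) + (k - h) * (1 / (x - h)) \<partial>\<rho>)"
      unfolding log_moment_def stieltjes_def
      using integrable_ln[OF ka] integrable_ln[OF h] integrable_pole[OF hn]
      by (simp only: Bochner_Integration.integral_add Bochner_Integration.integral_diff
          Bochner_Integration.integrable_diff integral_mult_right_zero integrable_mult_right)
    have "(\<integral>x. ln (x - k) - ln (x - h) + (k - h) * (1 / (x - h)) \<partial>\<rho>) \<le> C * (k - h) ^ 2"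
      by (rule integral_le_const[OF int]) (use pw in \<open>force intro!: AE_rangeI\<close>)
    moreover have "- (C * (k - h) ^ 2) \<le> (\<integral>x. ln (x - k) - ln (x - h) + (k - h) * (1 / (x - h)) \<partial>\<rho>)"
      by (rule integral_ge_const[OF int]) (use pw in \<open>force intro!: AE_rangeI\<close>)
    ultimately show ?thesis unfolding eq by linarith
  qed
  show ?thesis
    unfolding has_field_derivative_iff
  proof (rule LIM_zero_cancel, rule Lim_null_comparison)
    have "\<forall>\<^sub>F k in at h. k \<in> ball h ((a - h) / 2)"
      using h by (intro eventually_nhds_imp_at eventually_nhds_in_open) auto
    thus "\<forall>\<^sub>F k in at h. norm ((log_moment k - log_moment h) / (k - h) - - G h) \<le> C * \<bar>k - h\<bar>"
      using eventually_neq_at_within[of h h UNIV]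
    proof eventually_elim
      case (elim k)
      have "(log_moment k - log_moment h) / (k - h) - - G h = (log_moment k - log_moment h + (k - h) * G h) / (k - h)"
        using elim by (simp add: field_simps)
      moreover have "\<bar>log_moment k - log_moment h + (k - h) * G h\<bar> \<le> C * \<bar>k - h\<bar> * \<bar>k - h\<bar>"
      proof -
        have eq: "C * \<bar>k - h\<bar> * \<bar>k - h\<bar> = C * (k - h) ^ 2" by (simp add: power2_eq_square mult.assoc)
        have "\<bar>k - h\<bar> < (a - h) / 2" using elim by (simp only: mem_ball dist_real_def abs_minus_commute)
        thus ?thesis unfolding eq by (rule bound)
      qed
      ultimately show ?case using elim by (simp add: abs_divide divide_le_eq)
    qed
    show "((\<lambda>k. C * \<bar>k - h\<bar>) \<longlongrightarrow> 0) (at h)" by (auto intro!: tendsto_eq_intros)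
  qed
qed

lemma stieltjes_tendsto_0_at_bot: "(G \<longlongrightarrow> 0) at_bot"
proof (rule tendsto_sandwich)
  have ev: "\<forall>\<^sub>F z in at_bot. z < a" by (rule eventually_gt_at_bot)
  thus "\<forall>\<^sub>F z in at_bot. 0 \<le> G z" by eventually_elim (simp add: stieltjes_pos less_imp_le)
  from ev show "\<forall>\<^sub>F z in at_bot. G z \<le> 1 / (a - z)" by eventually_elim (auto intro: stieltjes_bounds)
  show "((\<lambda>z. 1 / (a - z)) \<longlongrightarrow> 0) at_bot" by real_asymp
qed simp

end

section \<open>The function F up to the edge value\<close>

locale free_convolution =
  M: compact_distribution \<mu> + N: compact_distribution \<nu> + R: compact_distribution \<rho>
  for \<mu> \<nu> \<rho> :: "real measure" +
  assumes is_free_convolution: "is_free_convolution \<mu> \<nu> \<rho>"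
begin

abbreviation R' where "R' \<equiv> deriv (R_transform \<mu>)"
abbreviation F where "F \<equiv> F_fun \<mu> \<nu>"
abbreviation E where "E \<equiv> E_fun \<mu> \<nu>"
abbreviation F_dom where "F_dom \<equiv> F_domain \<mu> \<nu>"
abbreviation E_dom where "E_dom \<equiv> E_domain \<mu> \<nu>"
abbreviation E_critical where "E_critical z \<equiv> critical_point_on (E_dom z) (E z)"
abbreviation E_max where "E_max z \<equiv> local_max_on (E_dom z) (E z)"
abbreviation E_min where "E_min z \<equiv> local_min_on (E_dom z) (E z)"

lemma R_transform_add:
  assumes "t \<in> R_domain \<mu>" "t \<in> R_domain \<nu>"
  shows "t \<in> R_domain \<rho>" "R_transform \<rho> t = R_transform \<mu> t + R_transform \<nu> t"
  using is_free_convolution assms unfolding is_free_convolution_def by auto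

text \<open>For g below all three edge values, additivity of R reads K_\<rho> + 1/g = (K_\<mu> +
  1/g) + (K_\<nu> + 1/g). This local equation at a single \<open>g0\<close> is all the subordination
  argument needs, and it is symmetric in \<mu> and \<nu>.\<close>

lemma lower_edge_le:
  "R.edge \<le> M.edge" "R.edge \<le> N.edge"
proof -
  define e where "e = min (min (M.edge) (N.edge)) (R.edge)"
  have "0 < e" using M.lower_edge_pos N.lower_edge_pos R.lower_edge_pos by (simp add: e_def)
  then obtain g0 where "ereal 0 < ereal g0" "ereal g0 < e"
    using ereal_dense2[of 0 e] by (auto simp: zero_ereal_def)
  hence g0: "0 < g0" "ereal g0 < e" by auto
  have eq: "\<forall>\<^sub>F g in nhds g0. R.K g = M.K g + N.K g + 1 / g"
  proof -
    have "\<forall>\<^sub>F g in nhds g0. g \<in> {0<..} \<inter> ereal -` {..<e}"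
      using g0 by (intro eventually_nhds_in_open open_Int open_ereal_vimage) auto
    thus ?thesis
    proof eventually_elim
      case (elim g)
      hence g: "0 < g" "ereal g < M.edge" "ereal g < N.edge"
          "ereal g < R.edge" by (auto simp: e_def)
      have m: "- g \<in> R_hat_domain \<mu>" "- g \<in> R_hat_domain \<nu>" "- g \<in> R_hat_domain \<rho>"
        using g by (auto intro: M.R_hat_domainI N.R_hat_domainI R.R_hat_domainI)
      have "R_transform \<rho> (- g) = R_transform \<mu> (- g) + R_transform \<nu> (- g)"
        using m M.R_hat_domain_subset N.R_hat_domain_subset by (intro R_transform_add) auto
      thus ?case
        using M.R_transform_eq_R_hat[OF m(1)] N.R_transform_eq_R_hat[OF m(2)] R.R_transform_eq_R_hat[OF m(3)] g(1)
        by (simp add: R_hat_def)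
    qed
  qed
  have c: "compact_distribution \<mu>" "compact_distribution \<nu>" "compact_distribution \<rho>" by unfold_locales
  show "R.edge \<le> M.edge"
    by (rule subordination_lower_edge_le[OF c g0(1) _ _ _ eq]) (use g0(2) in \<open>auto simp: e_def\<close>)
  have eq': "\<forall>\<^sub>F g in nhds g0. R.K g = N.K g + M.K g + 1 / g"
    using eq by eventually_elim simp
  show "R.edge \<le> N.edge"
    by (rule subordination_lower_edge_le[OF c(2,1,3) g0(1) _ _ _ eq']) (use g0(2) in \<open>auto simp: e_def\<close>)
qed

lemma mem_uminus_R_domain [simp]: "g \<in> uminus ` R_domain \<mu> \<longleftrightarrow> - g \<in> R_domain \<mu>"
  by (metis image_iff minus_minus)

lemma F_domain_iff: "h \<in> F_dom \<longleftrightarrow> h < N.a \<and> - N.G h \<in> R_domain \<mu>"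
  by (simp add: F_domain_def)

lemma E_domain_iff: "g \<in> E_dom z \<longleftrightarrow> - g \<in> R_domain \<mu> \<and> z - R_transform \<mu> (- g) < N.a"
  by (simp add: E_domain_def)

lemma R_domain_between: "s \<in> R_domain \<mu> \<Longrightarrow> t \<in> R_domain \<mu> \<Longrightarrow> s \<le> x \<Longrightarrow> x \<le> t \<Longrightarrow> x \<in> R_domain \<mu>"
  using M.is_interval_R_domain unfolding is_interval_1 by blast

lemma F_domain_downward: "h \<in> F_dom \<Longrightarrow> k \<le> h \<Longrightarrow> k \<in> F_dom"
  using R_domain_between[of "- N.G h" 0 "- N.G k"] M.zero_in_R_domain N.stieltjes_pos[of k] N.stieltjes_less_iff[of h k]
  by (auto simp: F_domain_iff not_less[symmetric])

lemma F_real_analytic: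
  assumes "h \<in> F_dom"
  shows "real_analytic_at F h"
proof -
  have h: "h < N.a" "- N.G h \<in> R_domain \<mu>" using assms by (auto simp: F_domain_iff)
  have "real_analytic_at (\<lambda>h. - N.G h) h"
    using h by (intro real_analytic_at_minus N.real_analytic_at_stieltjes) auto
  from real_analytic_at_compose[OF this M.real_analytic_at_R_transform[OF h(2)]]
  have "real_analytic_at (\<lambda>h. R_transform \<mu> (- N.G h) + h) h"
    by (intro real_analytic_at_add real_analytic_at_id)
  thus ?thesis unfolding F_fun_def[abs_def] .
qed

lemma F_isCont: "h \<in> F_dom \<Longrightarrow> isCont F h"
  by (rule real_analytic_at_isCont[OF F_real_analytic])

text \<open>With g = G_\<nu>(h), h equals R_\<nu>(-g) - 1/g, so F(h) = R_\<rho>(-g) - 1/g =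
  K_\<rho>(g). The edge comparison puts -g into the domain of R_\<mu>.\<close>

lemma F_below_edge:
  assumes h: "h < N.a" and g: "ereal (N.G h) < R.edge"
  shows "h \<in> F_dom" "F h < R.a" "R.G (F h) = N.G h"
proof -
  have pos: "N.G h > 0" by (rule N.stieltjes_pos[OF h])
  have m: "- N.G h \<in> R_hat_domain \<mu>" "- N.G h \<in> R_hat_domain \<rho>"
    using g pos lower_edge_le(1) by (auto intro!: M.R_hat_domainI R.R_hat_domainI)
  have mem: "- N.G h \<in> R_domain \<mu>" using m M.R_hat_domain_subset by blast
  thus "h \<in> F_dom" using h by (simp add: F_domain_iff)
  have "R_transform \<rho> (- N.G h) = R_transform \<mu> (- N.G h) + (h + 1 / N.G h)"
    using R_transform_add(2)[OF mem] N.R_transform_stieltjes[OF h] by simp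
  hence F: "F h = R.K (N.G h)"
    using R.R_transform_eq_R_hat[OF m(2)] pos by (simp add: F_fun_def R_hat_def)
  show "F h < R.a" "R.G (F h) = N.G h" unfolding F using R.stieltjes_inv_left[OF pos g] by auto
qed

lemma F_solution:
  assumes z: "z < R.a"
  obtains h where "h \<in> F_dom" "F h = z" "N.G h = R.G z"
proof -
  have g: "0 < R.G z" "ereal (R.G z) < R.edge"
    using R.stieltjes_pos[OF z] R.stieltjes_less_lower_edge[OF z] by auto
  have "ereal (R.G z) < N.edge" using g(2) lower_edge_le(2) by simp
  then obtain h where h: "h < N.a" "N.G h = R.G z" using N.stieltjes_surj_left[OF g(1)] by blast
  have "R.G (F h) = R.G z" "F h < R.a" "h \<in> F_dom"
    using F_below_edge[OF h(1)] h(2) g(2) by auto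
  moreover have "F h = z"
    using inj_onD[OF R.stieltjes_inj calculation(1)] calculation(2) z by auto
  ultimately show ?thesis using h by (intro that[of h]) auto
qed

lemma F_less_iff:
  assumes "h < N.a" "k < N.a" "ereal (N.G h) < R.edge" "ereal (N.G k) < R.edge"
  shows "F h < F k \<longleftrightarrow> h < k"
  using F_below_edge[OF assms(1,3)] F_below_edge[OF assms(2,4)]
    R.stieltjes_less_iff[of "F h" "F k"] N.stieltjes_less_iff[of h k] assms by simp

text \<open>If the derivative of \<open>F\<close> did not vanish, then \<open>stieltjes \<nu>\<close> composed with the local inverse of \<open>F\<close> would
  continue \<open>stieltjes \<rho>\<close> across the edge of \<open>\<rho>\<close>.\<close>

lemma F_edge_point:
  assumes h: "h \<in> F_dom" and edge: "R.edge \<le> ereal (N.G h)"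
  obtains k where "k \<le> h" "k \<in> F_dom" "ereal (N.G k) = R.edge" "F k = R.a"
    "(F has_real_derivative 0) (at k)"
proof -
  have ha: "h < N.a" using h by (simp add: F_domain_iff)
  obtain g where g: "R.edge = ereal g"
    using edge R.lower_edge_pos by (cases "R.edge") auto
  have gpos: "g > 0" using R.lower_edge_pos g by simp
  have "ereal g < N.edge"
    using edge N.stieltjes_less_lower_edge[OF ha] unfolding g by (rule le_less_trans)
  then obtain k where k: "k < N.a" "N.G k = g" using N.stieltjes_surj_left[OF gpos] by blast
  have kh: "k \<le> h" using N.stieltjes_less_iff[OF ha k(1)] edge g k(2) by (auto simp: not_less[symmetric])
  have kd: "k \<in> F_dom" using F_domain_downward[OF h kh] .
  have below: "ereal (N.G x) < R.edge" "x < N.a" if "x < k" for x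
    using N.stieltjes_less[of x k] k that g by auto
  have lim: "(F \<longlongrightarrow> F k) (at_left k)"
    using F_isCont[OF kd] by (simp add: isCont_def filterlim_at_split)
  have limG: "(N.G \<longlongrightarrow> N.G k) (at_left k)"
    using N.stieltjes_isCont[of k] k by (simp add: isCont_def filterlim_at_split)
  have evl: "\<forall>\<^sub>F x in at_left k. x < k" by (auto simp: eventually_at_filter)
  \<comment> \<open>Approaching \<open>k\<close> from the left bounds the value by the edge. A
    smaller value would, by continuity of G_\<rho>, be a point left of the support where G_\<rho>
    already attains its edge value.\<close>
  have "F k \<le> R.a"
    by (rule tendsto_upperbound[OF lim])
      (use evl in \<open>auto elim!: eventually_mono intro!: less_imp_le F_below_edge below\<close>)
  moreover have "\<not> F k < R.a"
  proof
    assume less: "F k < R.a"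
    hence "isCont R.G (F k)" by (intro R.stieltjes_isCont) auto
    from isCont_tendsto_compose[OF this lim] have "((\<lambda>x. R.G (F x)) \<longlongrightarrow> R.G (F k)) (at_left k)" .
    moreover have "\<forall>\<^sub>F x in at_left k. R.G (F x) = N.G x"
      using evl by eventually_elim (auto intro!: F_below_edge below)
    hence "((\<lambda>x. R.G (F x)) \<longlongrightarrow> N.G k) (at_left k)"
      using limG by (simp add: tendsto_cong)
    ultimately have "R.G (F k) = N.G k" by (rule tendsto_unique[rotated]) simp
    thus False using R.stieltjes_less_lower_edge[OF less] k g by simp
  qed
  ultimately have Fk: "F k = R.a" by simp
  have Fless: "F x < F k" if "x < k" for x using F_below_edge(2)[OF below(2,1)] that Fk by simp
  have "deriv F k = 0"
  proof (rule ccontr)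
    assume ne: "deriv F k \<noteq> 0"
    have D: "(F has_real_derivative deriv F k) (at k)"
      by (rule real_analytic_at_has_derivative[OF F_real_analytic[OF kd]])
    have "\<not> deriv F k < 0"
    proof
      assume "deriv F k < 0"
      from DERIV_neg_dec_left[OF D this] obtain d where "d > 0" "\<And>e. e > 0 \<Longrightarrow> e < d \<Longrightarrow> F k < F (k - e)" by blast
      hence "F k < F (k - d / 2)" by simp
      thus False using Fless[of "k - d / 2"] \<open>d > 0\<close> by simp
    qed
    hence pos: "deriv F k > 0" using ne by simp
    obtain \<phi> d where \<phi>: "0 < d" "real_analytic_at \<phi> (F k)"
      "\<And>x. \<bar>x - k\<bar> \<le> d \<Longrightarrow> \<phi> (F x) = x" "\<And>x. \<bar>x - k\<bar> \<le> d \<Longrightarrow> isCont F x"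
      using real_analytic_local_inverse[OF F_real_analytic[OF kd] pos zero_less_one] by blast
    have "\<phi> (F k) = k" using \<phi>(1,3) by simp
    hence "real_analytic_at N.G (\<phi> (F k))" using k by (intro N.real_analytic_at_stieltjes) auto
    from real_analytic_at_compose[OF \<phi>(2) this] have "real_analytic_at (\<lambda>y. N.G (\<phi> y)) R.a"
      unfolding Fk .
    moreover have "\<forall>\<^sub>F y in at_left R.a. N.G (\<phi> y) = R.G y"
    proof -
      have "\<forall>\<^sub>F y in at_left R.a. y \<in> {F (k - d)<..<R.a}"
        using Fless[of "k - d"] \<phi>(1) Fk by (intro eventually_at_left_real) auto
      thus ?thesis
      proof eventually_elim
        case (elim y)
        have "\<forall>x. k - d \<le> x \<and> x \<le> k \<longrightarrow> isCont F x" using \<phi>(4) by auto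
        then obtain x where x: "k - d \<le> x" "x \<le> k" "F x = y"
          using IVT[of F "k - d" y k] elim Fk \<phi>(1) by auto
        hence "x < k" using elim Fk by (cases "x = k") auto
        have "R.G (F x) = N.G x" by (rule F_below_edge(3)[OF below(2,1)[OF \<open>x < k\<close>]])
        moreover have "\<phi> (F x) = x" using x by (intro \<phi>(3)) auto
        ultimately show ?case using x(3) by simp
      qed
    qed
    ultimately show False by (rule R.no_continuation_across_lower_edge)
  qed
  thus ?thesis using that[OF kh kd] k g Fk real_analytic_at_has_derivative[OF F_real_analytic[OF kd]] by simp
qed

section \<open>The derivative of E and its critical points\<close>

abbreviation E_deriv :: "real \<Rightarrow> real \<Rightarrow> real" where
  "E_deriv z g \<equiv> R' (- g) * (g - N.G (z - R_transform \<mu> (- g)))"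

definition E_drift :: "real \<Rightarrow> real" where
  "E_drift g = (LBINT s=ereal 0..ereal g. s * R' (- s))"

lemma E_fun_eq: "E z g = E_drift g + N.log_moment (z - R_transform \<mu> (- g))"
  by (simp add: E_fun_def E_drift_def N.log_moment_def algebra_simps)

lemma R_transform_reflected_has_derivative:
  assumes "- g \<in> R_domain \<mu>"
  shows "((\<lambda>g. R_transform \<mu> (- g)) has_real_derivative - R' (- g)) (at g)"
proof -
  have "(R_transform \<mu> has_real_derivative R' (- g)) (at (- g))"
    by (rule real_analytic_at_has_derivative[OF M.real_analytic_at_R_transform[OF assms]])
  from DERIV_chain2[OF this DERIV_minus[OF DERIV_ident]] show ?thesis by simp
qed

lemma E_drift_has_derivative:
  assumes g: "- g \<in> R_domain \<mu>"
  shows "(E_drift has_real_derivative g * R' (- g)) (at g)"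
proof -
  obtain e where e: "e > 0" "cball (- g) e \<subseteq> R_domain \<mu>"
    using M.open_R_domain g open_contains_cball by blast
  \<comment> \<open>The interval contains both 0 and a neighbourhood of \<open>g\<close>, whatever
    the sign of \<open>g\<close>, so one application of the fundamental theorem covers the oriented
    integral.\<close>
  define l where "l = min 0 (g - e)"
  define u where "u = max 0 (g + e)"
  have e1: "- g - e \<in> cball (- g) e" "- g + e \<in> cball (- g) e" using e(1) by (auto simp: dist_real_def)
  have ends: "- u \<in> R_domain \<mu>" "- l \<in> R_domain \<mu>"
    using e(2) e1 M.zero_in_R_domain by (auto simp: l_def u_def min_def max_def)
  have mem: "- s \<in> R_domain \<mu>" if "s \<in> {l..u}" for s
    using R_domain_between[OF ends] that by auto
  have cont: "continuous_on {l..u} (\<lambda>s. s * R' (- s))"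
  proof (intro continuous_at_imp_continuous_on ballI)
    fix s assume "s \<in> {l..u}"
    hence "real_analytic_at R' (- s)"
      by (intro real_analytic_at_deriv M.real_analytic_at_R_transform mem)
    hence "isCont R' (- s)" by (rule real_analytic_at_isCont)
    hence "isCont (\<lambda>s. R' (- s)) s" using isCont_o2[where f = uminus and g = R' and a = s] by simp
    thus "isCont (\<lambda>s. s * R' (- s)) s" by simp
  qed
  have "l \<le> 0" "0 \<le> u" "l < g" "g < u" using e(1) by (auto simp: l_def u_def)
  hence "((\<lambda>y. LBINT s=ereal 0..ereal y. s * R' (- s)) has_vector_derivative g * R' (- g)) (at g within {l..u})"
    using interval_integral_FTC2[of l 0 u "\<lambda>s. s * R' (- s)" g] cont by simp
  moreover have "at g within {l..u} = at g" using \<open>l < g\<close> \<open>g < u\<close> by (intro at_within_interior) auto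
  ultimately show ?thesis
    unfolding E_drift_def[abs_def] by (simp add: has_real_derivative_iff_has_vector_derivative)
qed

lemma E_drift_0: "E_drift 0 = 0"
  by (simp add: E_drift_def)

lemma E_fun_has_derivative:
  assumes "g \<in> E_dom z"
  shows "(E z has_real_derivative E_deriv z g) (at g)"
proof -
  have g: "- g \<in> R_domain \<mu>" "z - R_transform \<mu> (- g) < N.a" using assms by (auto simp: E_domain_iff)
  have "((\<lambda>g. z - R_transform \<mu> (- g)) has_real_derivative 0 - (- R' (- g))) (at g)"
    by (intro DERIV_diff DERIV_const R_transform_reflected_has_derivative g)
  hence "((\<lambda>g. z - R_transform \<mu> (- g)) has_real_derivative R' (- g)) (at g)" by simp
  from DERIV_chain2[OF N.log_moment_has_derivative[OF g(2)] this]
  have "((\<lambda>g. N.log_moment (z - R_transform \<mu> (- g))) has_real_derivative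
      - N.G (z - R_transform \<mu> (- g)) * R' (- g)) (at g)" .
  from DERIV_add[OF E_drift_has_derivative[OF g(1)] this]
  show ?thesis by (simp add: E_fun_eq[abs_def] algebra_simps)
qed

lemma E_domain_eventually:
  assumes "g \<in> E_dom z"
  shows "\<forall>\<^sub>F g in nhds g. g \<in> E_dom z"
proof -
  have g: "- g \<in> R_domain \<mu>" "z - R_transform \<mu> (- g) < N.a" using assms by (auto simp: E_domain_iff)
  have "isCont (\<lambda>g. z - R_transform \<mu> (- g)) g"
    using R_transform_reflected_has_derivative[OF g(1)] by (intro continuous_intros) (rule DERIV_isCont)
  from order_tendstoD(2)[OF isCont_filterlim_nhds[OF this] g(2)]
  have "\<forall>\<^sub>F g in nhds g. z - R_transform \<mu> (- g) < N.a" .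
  moreover have "isCont uminus g" by simp
  from eventually_compose_filterlim[OF eventually_nhds_in_open[OF M.open_R_domain g(1)] isCont_filterlim_nhds[OF this]]
  have "\<forall>\<^sub>F g in nhds g. - g \<in> R_domain \<mu>" .
  ultimately show ?thesis by eventually_elim (simp add: E_domain_iff)
qed

lemma open_E_domain: "open (E_dom z)"
proof (subst open_subopen, intro ballI)
  fix g assume "g \<in> E_dom z"
  from E_domain_eventually[OF this]
  show "\<exists>T. open T \<and> g \<in> T \<and> T \<subseteq> E_dom z" unfolding eventually_nhds by blast
qed

lemma at_within_E_domain: "g \<in> E_dom z \<Longrightarrow> at g within E_dom z = at g"
  by (rule at_within_open[OF _ open_E_domain])

lemma E_fun_eventually_has_derivative:
  "g \<in> E_dom z \<Longrightarrow> \<forall>\<^sub>F g in nhds g. (E z has_real_derivative E_deriv z g) (at g)"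
  by (rule eventually_mono[OF E_domain_eventually E_fun_has_derivative])

lemma solution_in_E_domain:
  "h \<in> F_dom \<Longrightarrow> z \<le> F h \<Longrightarrow> N.G h \<in> E_dom z"
  by (auto simp: F_domain_iff E_domain_iff F_fun_def)

text \<open>Once R' is nonzero the other factor of the derivative must vanish, and then h = z -
  R_\<mu>(-g) is the solution of F(h) = z belonging to g.\<close>

lemma critical_point_E_iff:
  assumes "g \<in> E_dom z" "R' (- g) > 0"
  shows "E_critical z g \<longleftrightarrow>
    (\<exists>h\<in>F_dom. F h = z \<and> g = N.G h)"
proof -
  have "E_critical z g \<longleftrightarrow> E_deriv z g = 0"
    unfolding critical_point_on_def using assms(1) E_fun_has_derivative[OF assms(1)] DERIV_unique by metis
  also have "\<dots> \<longleftrightarrow> g = N.G (z - R_transform \<mu> (- g))" using assms(2) by auto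
  also have "\<dots> \<longleftrightarrow> (\<exists>h\<in>F_dom. F h = z \<and> g = N.G h)"
  proof
    assume "g = N.G (z - R_transform \<mu> (- g))"
    thus "\<exists>h\<in>F_dom. F h = z \<and> g = N.G h"
      using assms(1) by (intro bexI[of _ "z - R_transform \<mu> (- g)"]) (auto simp: F_domain_iff E_domain_iff F_fun_def)
  next
    assume "\<exists>h\<in>F_dom. F h = z \<and> g = N.G h"
    thus "g = N.G (z - R_transform \<mu> (- g))" by (auto simp: F_fun_def)
  qed
  finally show ?thesis .
qed

lemma critical_point_at_solution:
  assumes "h \<in> F_dom" "F h = z"
  shows "E_critical z (N.G h)"
  using E_fun_has_derivative[OF solution_in_E_domain, of h z] solution_in_E_domain[of h z] assms
  by (auto simp: critical_point_on_def F_fun_def)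

text \<open>For g = G_\<nu>(h) the point z - R_\<mu>(-g) is h - (F(h) - z), hence left of h, and
  G_\<nu> is increasing.\<close>

lemma E_deriv_pos:
  assumes "h < N.a" "N.G h \<in> E_dom z" "R' (- N.G h) > 0" "z < F h"
  shows "E_deriv z (N.G h) > 0"
proof -
  have "N.G (z - R_transform \<mu> (- N.G h)) < N.G h"
    using assms by (intro N.stieltjes_less) (auto simp: F_fun_def)
  thus ?thesis using assms(3) by simp
qed

lemma E_deriv_neg:
  assumes "h < N.a" "N.G h \<in> E_dom z" "R' (- N.G h) > 0" "F h < z"
  shows "E_deriv z (N.G h) < 0"
proof -
  have "N.G h < N.G (z - R_transform \<mu> (- N.G h))"
    using assms by (intro N.stieltjes_less) (auto simp: F_fun_def E_domain_iff)
  thus ?thesis using assms(3) by (simp add: mult_pos_neg)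
qed

text \<open>F is studied in the coordinate h and E in g = G_\<nu>(h). Monotonicity of the change of
  coordinate lets statements holding on one side be carried from h to g.\<close>

lemma stieltjes_inv_one_sided:
  assumes h: "h < N.a"
  shows "filterlim N.K (at_left h) (at_left (N.G h))"
    and "filterlim N.K (at_right h) (at_right (N.G h))"
    and "\<forall>\<^sub>F g in nhds (N.G h). N.K g < N.a \<and> N.G (N.K g) = g"
proof -
  have inv: "N.K (N.G h) = h" using h by (intro N.stieltjes_inv_stieltjes) auto
  have "isCont N.K (N.G h)"
    using h by (intro real_analytic_at_isCont N.real_analytic_at_stieltjes_inv) auto
  hence lim: "filterlim N.K (nhds h) (nhds (N.G h))"
    using isCont_filterlim_nhds inv by fastforce
  have "\<forall>\<^sub>F g in nhds (N.G h). g \<in> {0<..} \<inter> ereal -` {..<N.edge}"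
    using h N.stieltjes_pos N.stieltjes_less_lower_edge
    by (intro eventually_nhds_in_open open_Int open_ereal_vimage) auto
  thus ev: "\<forall>\<^sub>F g in nhds (N.G h). N.K g < N.a \<and> N.G (N.K g) = g"
    by eventually_elim (auto intro: N.stieltjes_inv_left)
  have nhds_left: "at_left (N.G h) \<le> nhds (N.G h)" and nhds_right: "at_right (N.G h) \<le> nhds (N.G h)"
    by (simp_all add: at_within_def)
  have "\<forall>\<^sub>F g in at_left (N.G h). N.K g \<in> {..<h} \<and> N.K g \<noteq> h"
  proof -
    have "\<forall>\<^sub>F g in at_left (N.G h). g < N.G h" by (auto simp: eventually_at_filter)
    thus ?thesis using filter_leD[OF nhds_left ev]
    proof eventually_elim
      case (elim g)
      hence "N.K g < h" using N.stieltjes_less_iff[of "N.K g" h] h by simp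
      thus ?case by auto
    qed
  qed
  thus "filterlim N.K (at_left h) (at_left (N.G h))"
    unfolding filterlim_at using filterlim_mono[OF lim order_refl nhds_left] by (simp add: conj_commute)
  have "\<forall>\<^sub>F g in at_right (N.G h). N.K g \<in> {h<..} \<and> N.K g \<noteq> h"
  proof -
    have "\<forall>\<^sub>F g in at_right (N.G h). N.G h < g" by (auto simp: eventually_at_filter)
    thus ?thesis using filter_leD[OF nhds_right ev]
    proof eventually_elim
      case (elim g)
      hence "h < N.K g" using N.stieltjes_less_iff[of h "N.K g"] h by simp
      thus ?case by auto
    qed
  qed
  thus "filterlim N.K (at_right h) (at_right (N.G h))"
    unfolding filterlim_at using filterlim_mono[OF lim order_refl nhds_right] by (simp add: conj_commute)
qed

text \<open>Each case needs the sign of R' and of F - z on one side only; the third and fourth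
  conclusions are independent of what happens on the left.\<close>

lemma E_fun_near_solution:
  assumes h: "h \<in> F_dom" "F h = z"
  shows "\<forall>\<^sub>F g in at_left (N.G h). R' (- g) > 0 \<Longrightarrow> \<forall>\<^sub>F k in at_left h. z < F k \<Longrightarrow>
      \<forall>\<^sub>F g in at_left (N.G h). E z g < E z (N.G h)"
    and "\<forall>\<^sub>F g in at_left (N.G h). R' (- g) > 0 \<Longrightarrow> \<forall>\<^sub>F k in at_left h. F k < z \<Longrightarrow>
      \<forall>\<^sub>F g in at_left (N.G h). E z (N.G h) < E z g"
    and "\<forall>\<^sub>F g in at_right (N.G h). R' (- g) > 0 \<Longrightarrow> \<forall>\<^sub>F k in at_right h. z < F k \<Longrightarrow>
      \<forall>\<^sub>F g in at_right (N.G h). E z (N.G h) < E z g"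
    and "\<forall>\<^sub>F g in at_right (N.G h). R' (- g) > 0 \<Longrightarrow> \<forall>\<^sub>F k in at_right h. F k < z \<Longrightarrow>
      \<forall>\<^sub>F g in at_right (N.G h). E z g < E z (N.G h)"
proof -
  have ha: "h < N.a" using h by (simp add: F_domain_iff)
  have dom: "N.G h \<in> E_dom z" using h by (intro solution_in_E_domain) auto
  note D = E_fun_eventually_has_derivative[OF dom]
  note inv = stieltjes_inv_one_sided[OF ha]
  have le: "at_left (N.G h) \<le> nhds (N.G h)" "at_right (N.G h) \<le> nhds (N.G h)"
    by (simp_all add: at_within_def)
  have pos: "\<forall>\<^sub>F g in A. E_deriv z g > 0"
    if A: "A \<le> nhds (N.G h)" "\<forall>\<^sub>F g in A. R' (- g) > 0" "\<forall>\<^sub>F g in A. z < F (N.K g)" for A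
    using A(2,3) filter_leD[OF A(1) inv(3)] filter_leD[OF A(1) E_domain_eventually[OF dom]]
  proof eventually_elim
    case (elim g)
    thus ?case using E_deriv_pos[of "N.K g" z] by simp
  qed
  have neg: "\<forall>\<^sub>F g in A. E_deriv z g < 0"
    if A: "A \<le> nhds (N.G h)" "\<forall>\<^sub>F g in A. R' (- g) > 0" "\<forall>\<^sub>F g in A. F (N.K g) < z" for A
    using A(2,3) filter_leD[OF A(1) inv(3)] filter_leD[OF A(1) E_domain_eventually[OF dom]]
  proof eventually_elim
    case (elim g)
    thus ?case using E_deriv_neg[of "N.K g" z] by simp
  qed
  note l = eventually_compose_filterlim[OF _ inv(1)] and r = eventually_compose_filterlim[OF _ inv(2)]
  show "\<forall>\<^sub>F g in at_left (N.G h). R' (- g) > 0 \<Longrightarrow> \<forall>\<^sub>F k in at_left h. z < F k \<Longrightarrow>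
      \<forall>\<^sub>F g in at_left (N.G h). E z g < E z (N.G h)"
    by (rule eventually_at_left_of_deriv_pos[OF D pos[OF le(1) _ l]])
  show "\<forall>\<^sub>F g in at_left (N.G h). R' (- g) > 0 \<Longrightarrow> \<forall>\<^sub>F k in at_left h. F k < z \<Longrightarrow>
      \<forall>\<^sub>F g in at_left (N.G h). E z (N.G h) < E z g"
    by (rule eventually_at_left_of_deriv_neg[OF D neg[OF le(1) _ l]])
  show "\<forall>\<^sub>F g in at_right (N.G h). R' (- g) > 0 \<Longrightarrow> \<forall>\<^sub>F k in at_right h. z < F k \<Longrightarrow>
      \<forall>\<^sub>F g in at_right (N.G h). E z (N.G h) < E z g"
    by (rule eventually_at_right_of_deriv_pos[OF D pos[OF le(2) _ r]])
  show "\<forall>\<^sub>F g in at_right (N.G h). R' (- g) > 0 \<Longrightarrow> \<forall>\<^sub>F k in at_right h. F k < z \<Longrightarrow>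
      \<forall>\<^sub>F g in at_right (N.G h). E z g < E z (N.G h)"
    by (rule eventually_at_right_of_deriv_neg[OF D neg[OF le(2) _ r]])
qed

text \<open>An explicit formula for the solution at g = G_\<rho>(z), from which its derivative in z
  can be read off.\<close>

lemma h_solution_eq:
  assumes z: "z < R.a"
  defines "h \<equiv> z - R_transform \<mu> (- R.G z)"
  shows "h \<in> F_dom" "F h = z" "N.G h = R.G z"
proof -
  obtain k where k: "k \<in> F_dom" "F k = z" "N.G k = R.G z" using F_solution[OF z] .
  hence "k = h" by (simp add: h_def F_fun_def)
  thus "h \<in> F_dom" "F h = z" "N.G h = R.G z" using k by auto
qed

section \<open>The logarithmic potential as a value of E\<close>

lemma log_potential_eq_E_fun:
  assumes z: "z < R.a"
  shows "log_potential \<rho> z = E z (R.G z)"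
proof -
  define h where "h z = z - R_transform \<mu> (- R.G z)" for z
  have h: "h x < N.a" "N.G (h x) = R.G x" "- R.G x \<in> R_domain \<mu>" if "x < R.a" for x
    using h_solution_eq[OF that] by (auto simp: h_def F_domain_iff)
  define \<Delta> where "\<Delta> z = R.log_moment z - (E_drift (R.G z) + N.log_moment (h z))" for z
  have "(\<Delta> has_real_derivative 0) (at x)" if x: "x < R.a" for x
  proof -
    define d where "d = R.pole_moment x 1"
    have G: "(R.G has_real_derivative d) (at x)"
      unfolding d_def using x by (intro R.stieltjes_has_derivative) auto
    have A: "((\<lambda>z. E_drift (R.G z)) has_real_derivative (R.G x * R' (- R.G x)) * d) (at x)"
      by (rule DERIV_chain2[OF E_drift_has_derivative[OF h(3)[OF x]] G])
    have "((\<lambda>z. z - R_transform \<mu> (- R.G z)) has_real_derivative 1 - (- R' (- R.G x)) * d) (at x)"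
      by (intro DERIV_diff DERIV_ident DERIV_chain2[OF R_transform_reflected_has_derivative[OF h(3)[OF x]] G])
    hence H: "(h has_real_derivative 1 + R' (- R.G x) * d) (at x)" unfolding h_def[abs_def] by simp
    have L: "((\<lambda>z. N.log_moment (h z)) has_real_derivative - R.G x * (1 + R' (- R.G x) * d)) (at x)"
      using DERIV_chain2[OF N.log_moment_has_derivative[OF h(1)[OF x]] H] h(2)[OF x] by simp
    \<comment> \<open>The terms containing \<open>d\<close>, which come from moving g with z, cancel
      because g is a critical point of E; only the explicit dependence on z survives.\<close>
    have "(\<Delta> has_real_derivative - R.G x - ((R.G x * R' (- R.G x)) * d + - R.G x * (1 + R' (- R.G x) * d))) (at x)"
      unfolding \<Delta>_def[abs_def]
      by (intro DERIV_diff DERIV_add A L R.log_moment_has_derivative x)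
    thus ?thesis by (simp add: algebra_simps)
  qed
  hence "\<forall>x\<in>{..<R.a}. (\<Delta> has_real_derivative 0) (at x within {..<R.a})"
    by (auto intro: has_field_derivative_at_within)
  then obtain c where c: "\<And>x. x < R.a \<Longrightarrow> \<Delta> x = c"
    using has_field_derivative_zero_constant[of "{..<R.a}" \<Delta>] by auto
  have R0: "((\<lambda>x. R_transform \<mu> (- R.G x)) \<longlongrightarrow> R_transform \<mu> 0) at_bot"
  proof -
    have "isCont (R_transform \<mu>) 0"
      by (intro real_analytic_at_isCont M.real_analytic_at_R_transform M.zero_in_R_domain)
    moreover have "((\<lambda>x. - R.G x) \<longlongrightarrow> 0) at_bot"
      using tendsto_minus[OF R.stieltjes_tendsto_0_at_bot] by simp
    ultimately show ?thesis by (rule isCont_tendsto_compose)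
  qed
  have A0: "((\<lambda>x. E_drift (R.G x)) \<longlongrightarrow> 0) at_bot"
  proof -
    have "isCont E_drift 0" using E_drift_has_derivative[of 0] M.zero_in_R_domain by (auto intro: DERIV_isCont)
    from isCont_tendsto_compose[OF this R.stieltjes_tendsto_0_at_bot] show ?thesis by (simp add: E_drift_0)
  qed
  \<comment> \<open>The point h(x) differs from x by R_\<mu>(-G_\<rho>(x)), which stays bounded as x
    tends to minus infinity, so the ratio of the two arguments tends to 1. Taking \<alpha> and
    \<beta> among the support endpoints gives both sides of the sandwich.\<close>
  have ln0: "((\<lambda>x. ln (\<alpha> - x) - ln (\<beta> - h x)) \<longlongrightarrow> 0) at_bot"
    if \<beta>: "\<And>x. x < R.a \<Longrightarrow> h x < \<beta>" for \<alpha> \<beta>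
  proof -
    define q where "q x = (\<alpha> - x) / (\<beta> - h x)" for x
    have den: "filterlim (\<lambda>x. \<beta> - h x) at_top at_bot"
    proof -
      have "((\<lambda>x. \<beta> + R_transform \<mu> (- R.G x)) \<longlongrightarrow> \<beta> + R_transform \<mu> 0) at_bot" by (intro tendsto_intros R0)
      from filterlim_tendsto_add_at_top[OF this filterlim_uminus_at_top_at_bot]
      show ?thesis by (simp add: h_def algebra_simps)
    qed
    have "((\<lambda>x. (\<alpha> - \<beta> - R_transform \<mu> (- R.G x)) / (\<beta> - h x)) \<longlongrightarrow> 0) at_bot"
      by (rule tendsto_divide_0[where c = "\<alpha> - \<beta> - R_transform \<mu> 0"])
        (auto intro!: tendsto_intros R0 filterlim_at_top_imp_at_infinity den)
    hence "((\<lambda>x. 1 + (\<alpha> - \<beta> - R_transform \<mu> (- R.G x)) / (\<beta> - h x)) \<longlongrightarrow> 1 + 0) at_bot"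
      by (intro tendsto_add tendsto_const)
    moreover have "\<forall>\<^sub>F x in at_bot. 1 + (\<alpha> - \<beta> - R_transform \<mu> (- R.G x)) / (\<beta> - h x) = q x"
      using eventually_gt_at_bot[of R.a]
    proof eventually_elim
      case (elim x)
      thus ?case using \<beta>[OF elim] by (simp add: q_def h_def field_simps)
    qed
    ultimately have "(q \<longlongrightarrow> 1) at_bot" by (simp add: tendsto_cong)
    from tendsto_ln[OF this] have "((\<lambda>x. ln (q x)) \<longlongrightarrow> 0) at_bot" by simp
    moreover have "\<forall>\<^sub>F x in at_bot. ln (q x) = ln (\<alpha> - x) - ln (\<beta> - h x)"
      using eventually_gt_at_bot[of "min R.a \<alpha>"]
    proof eventually_elim
      case (elim x)
      hence "x < R.a" "x < \<alpha>" by auto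
      thus ?case using \<beta>[of x] by (simp add: q_def ln_div)
    qed
    ultimately show ?thesis by (simp add: tendsto_cong)
  qed
  have "((\<lambda>x. R.log_moment x - N.log_moment (h x)) \<longlongrightarrow> 0) at_bot"
  proof (rule tendsto_sandwich)
    show "((\<lambda>x. ln (R.a - x) - ln (N.b - h x)) \<longlongrightarrow> 0) at_bot"
      using h(1) N.a_le_b by (intro ln0) force
    show "((\<lambda>x. ln (R.b - x) - ln (N.a - h x)) \<longlongrightarrow> 0) at_bot"
      using h(1) by (intro ln0)
    have *: "ln (R.a - x) - ln (N.b - h x) \<le> R.log_moment x - N.log_moment (h x)"
      "R.log_moment x - N.log_moment (h x) \<le> ln (R.b - x) - ln (N.a - h x)" if "x < R.a" for x
      using R.log_moment_bounds[OF that] N.log_moment_bounds[OF h(1)[OF that]] by linarith+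
    show "\<forall>\<^sub>F x in at_bot. ln (R.a - x) - ln (N.b - h x) \<le> R.log_moment x - N.log_moment (h x)"
      using eventually_gt_at_bot[of R.a] by eventually_elim (rule *)
    show "\<forall>\<^sub>F x in at_bot. R.log_moment x - N.log_moment (h x) \<le> ln (R.b - x) - ln (N.a - h x)"
      using eventually_gt_at_bot[of R.a] by eventually_elim (rule *)
  qed
  from tendsto_diff[OF this A0] have "(\<Delta> \<longlongrightarrow> 0) at_bot"
    by (simp add: \<Delta>_def[abs_def] algebra_simps)
  moreover have "(\<Delta> \<longlongrightarrow> c) at_bot"
    by (rule tendsto_eventually[OF eventually_mono[OF eventually_gt_at_bot[of R.a] c]])
  ultimately have "0 = c" by (rule tendsto_unique[rotated]) simp
  hence "\<Delta> z = 0" using c[OF z] by simp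
  thus ?thesis using R.log_potential_eq_log_moment[OF z] by (simp add: E_fun_eq \<Delta>_def h_def)
qed

end

section \<open>Solutions of F(h) = z\<close>

lemma strictly_concave_on_between:
  assumes f: "strictly_concave_on S f" and S: "x \<in> S" "y \<in> S" and w: "x < w" "w < y"
    and c: "c \<le> f x" "c \<le> f y"
  shows "c < f w"
proof -
  define t where "t = (w - x) / (y - x)"
  have t: "0 < t" "t < 1" using w by (auto simp: t_def field_simps)
  have "t * (y - x) = w - x" using w by (simp add: t_def)
  hence "w = (1 - t) * x + t * y" by (simp add: algebra_simps)
  moreover have "(1 - t) * f x + t * f y < f ((1 - t) * x + t * y)"
    using f S w t unfolding strictly_concave_on_def by auto
  moreover have "(1 - t) * c + t * c \<le> (1 - t) * f x + t * f y"
    using t c by (intro add_mono mult_left_mono) auto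
  moreover have "(1 - t) * c + t * c = c" by (simp add: algebra_simps)
  ultimately show ?thesis by simp
qed

text \<open>If f(h) were at least f(k), strict concavity would give the midpoint a value strictly
  above f(k), even in the case of equality. The chord from k to the midpoint would then have
  positive slope and bound the zero derivative from below.\<close>

lemma strictly_concave_on_less_max:
  assumes f: "strictly_concave_on S f" and k: "k \<in> S" "(f has_real_derivative 0) (at k)"
    and h: "h \<in> S" "h \<noteq> k"
  shows "f h < f k"
proof (rule ccontr)
  assume "\<not> f h < f k"
  define m where "m = (1 - 1 / 2) * k + (1 / 2) * h"
  have conc: "(1 - t) * f x + t * f y < f ((1 - t) * x + t * y)"
    if "x \<in> S" "y \<in> S" "x \<noteq> y" "0 < t" "t < 1" for x y t
    using f that unfolding strictly_concave_on_def by blast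
  have "(1 - 1 / 2) * f k + (1 / 2) * f h < f m" unfolding m_def by (rule conc) (use k h in auto)
  hence fm: "f m > f k" using \<open>\<not> f h < f k\<close> by simp
  have "convex S" using f unfolding strictly_concave_on_def by blast
  hence m: "m \<in> S" unfolding m_def using convexD[of S k h "1 - 1 / 2" "1 / 2"] k h by simp
  have mk: "k \<noteq> m" using fm by auto
  define \<phi> where "\<phi> t = f ((1 - t) * k + t * m)" for t
  have "((\<lambda>t. (1 - t) * k + t * m) has_real_derivative (m - k)) (at 0)"
    by (auto intro!: derivative_eq_intros)
  from DERIV_chain2[of f 0 "\<lambda>t. (1 - t) * k + t * m", OF _ this] k(2)
  have "(\<phi> has_real_derivative 0) (at 0)" by (simp add: \<phi>_def[abs_def])
  hence "((\<lambda>t. (\<phi> t - \<phi> 0) / (t - 0)) \<longlongrightarrow> 0) (at_right 0)"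
    unfolding has_field_derivative_iff by (rule tendsto_within_subset) auto
  moreover have "\<forall>\<^sub>F t in at_right 0. f m - f k \<le> (\<phi> t - \<phi> 0) / (t - 0)"
    using eventually_at_right_real[OF zero_less_one]
  proof eventually_elim
    case (elim t)
    hence "(1 - t) * f k + t * f m < \<phi> t" unfolding \<phi>_def by (intro conc k m mk) auto
    hence "t * (f m - f k) \<le> \<phi> t - f k" by (simp add: algebra_simps)
    thus ?case using elim by (simp add: \<phi>_def field_simps)
  qed
  ultimately have "f m - f k \<le> 0" by (rule tendsto_lowerbound) simp
  thus False using fm by simp
qed

text \<open>Of two candidates the smaller one is counted among the solutions left of the larger, but
  not among those left of itself; nested sets of the same finite size would have to be
  equal.\<close>

lemma F_second_solution_unique:
  assumes "F_second_solution \<mu> \<nu> z h" "F_second_solution \<mu> \<nu> z k"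
  shows "h = k"
proof -
  have False if hk: "F_second_solution \<mu> \<nu> z h" "F_second_solution \<mu> \<nu> z k" "h < k" for h k
  proof -
    let ?S = "\<lambda>h. {h' \<in> F_domain \<mu> \<nu>. h' < h \<and> F_fun \<mu> \<nu> h' = z}"
    have card: "card (?S h) = 1" "card (?S k) = 1" and h: "h \<in> ?S k" "h \<notin> ?S h" and sub: "?S h \<subseteq> ?S k"
      using hk unfolding F_second_solution_def by auto
    have "finite (?S k)" by (rule card_ge_0_finite) (simp add: card)
    from card_subset_eq[OF this sub] card have "?S h = ?S k" by simp
    thus False using h by blast
  qed
  thus ?thesis using assms by (metis linorder_neqE_linordered_idom)
qed

lemma h_second_eq: "F_second_solution \<mu> \<nu> z h \<Longrightarrow> h_second \<mu> \<nu> z = h"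
  unfolding h_second_def using F_second_solution_unique by (auto intro!: the_equality)

section \<open>Locating the solutions of F(h) = z below the edge\<close>

context free_convolution
begin

lemma mem_uminus_R_domain_plus:
  "g \<in> uminus ` R_domain_plus \<mu> \<longleftrightarrow> - g \<in> R_domain \<mu> \<and> R' (- g) > 0"
proof -
  have "g \<in> uminus ` R_domain_plus \<mu> \<longleftrightarrow> - g \<in> R_domain_plus \<mu>" by (metis image_iff minus_minus)
  thus ?thesis by (simp add: R_domain_plus_def)
qed

lemma F_less_below:
  assumes z: "z < R.a" and k: "k < N.a" "N.G k < R.G z"
  shows "F k < z"
proof -
  have "ereal (N.G k) < ereal (R.G z)" using k(2) by simp
  also have "\<dots> < R.edge" by (rule R.stieltjes_less_lower_edge[OF z])
  finally have e: "ereal (N.G k) < R.edge" .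
  show ?thesis using F_below_edge[OF k(1) e] R.stieltjes_less_iff[of "F k" z] k(2) z by simp
qed

text \<open>Before the edge value this is monotonicity. Past it, F has taken the value
  \<open>R.a\<close>, which exceeds z, so a return to z would by continuity produce a solution that
  \<open>no\<close> excludes.\<close>

lemma F_greater_above:
  assumes z: "z < R.a" and h: "h \<in> F_dom" "R.G z < N.G h"
    and no: "\<And>k. k \<in> F_dom \<Longrightarrow> k \<le> h \<Longrightarrow> F k = z \<Longrightarrow> N.G k \<le> R.G z"
  shows "z < F h"
proof (cases "ereal (N.G h) < R.edge")
  case True
  have "h < N.a" using h by (simp add: F_domain_iff)
  from F_below_edge[OF this True] show ?thesis using R.stieltjes_less_iff[of z "F h"] h(2) z by simp
next
  case False
  hence "R.edge \<le> ereal (N.G h)" by simp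
  then obtain k where k: "k \<le> h" "k \<in> F_dom" "ereal (N.G k) = R.edge" "F k = R.a"
    using F_edge_point[OF h(1)] by metis
  show ?thesis
  proof (rule ccontr)
    assume "\<not> z < F h"
    moreover have "\<forall>x. k \<le> x \<and> x \<le> h \<longrightarrow> isCont F x"
      using F_domain_downward[OF h(1)] by (auto intro: F_isCont)
    ultimately obtain x where x: "k \<le> x" "x \<le> h" "F x = z"
      using IVT2[of F h z k] k z by auto
    have xd: "x \<in> F_dom" using F_domain_downward[OF h(1) x(2)] .
    have "N.G k \<le> N.G x" using N.stieltjes_less[of k x] x(1) xd by (cases "k = x") (auto simp: F_domain_iff)
    hence "N.G k \<le> R.G z" using no[OF xd x(2,3)] by simp
    hence "ereal (N.G k) \<le> ereal (R.G z)" by simp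
    also have "\<dots> < ereal (N.G k)" using R.stieltjes_less_lower_edge[OF z] k(3) by simp
    finally show False by simp
  qed
qed

lemma solution_below_edge_unique:
  assumes z: "z < R.a" and k: "k \<in> F_dom" "F k = z" "ereal (N.G k) < R.edge"
  shows "N.G k = R.G z"
  using F_below_edge(3)[of k] k by (simp add: F_domain_iff)

lemma solution_not_below_edge:
  assumes z: "z < R.a" and k: "k \<in> F_dom" "F k = z" "R.G z < N.G k"
  shows "R.edge \<le> ereal (N.G k)"
  using solution_below_edge_unique[OF z k(1,2)] k(3) by force

text \<open>A least solution past the edge point \<open>e\<close> exists because solutions in
  \<open>{e..k}\<close> form a compact set. Exactly one solution lies left of \<open>e\<close>, so
  this least one has the required count.\<close>

lemma second_solution_if_solution:
  assumes z: "z < R.a" and k: "k \<in> F_dom" "F k = z" "R.G z < N.G k"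
  obtains m where "m \<le> k" "F_second_solution \<mu> \<nu> z m"
proof -
  obtain h1 where h1: "h1 \<in> F_dom" "F h1 = z" "N.G h1 = R.G z" using F_solution[OF z] .
  obtain e where e: "e \<le> k" "e \<in> F_dom" "ereal (N.G e) = R.edge"
    using F_edge_point[OF k(1) solution_not_below_edge[OF z k]] by metis
  define T where "T = {x \<in> {e..k}. F x = z}"
  have "continuous_on {e..k} F"
    using F_domain_downward[OF k(1)] by (intro continuous_at_imp_continuous_on) (auto intro: F_isCont)
  hence "closed T" unfolding T_def
    using continuous_closed_preimage_constant[of "{e..k}" F z] by auto
  moreover have "bounded T" by (rule bounded_subset[of "{e..k}"]) (auto simp: T_def)
  ultimately have "compact T" by (simp add: compact_eq_bounded_closed)
  moreover have "T \<noteq> {}" using k e by (auto simp: T_def)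
  ultimately have "\<exists>m\<in>T. \<forall>x\<in>T. m \<le> x" by (rule compact_attains_inf)
  then obtain m where m: "m \<in> T" "\<And>x. x \<in> T \<Longrightarrow> m \<le> x" by blast
  have mk: "e \<le> m" "m \<le> k" "F m = z" using m by (auto simp: T_def)
  have md: "m \<in> F_dom" using F_domain_downward[OF k(1) mk(2)] .
  have lt: "h1 < e"
  proof -
    have "ereal (N.G h1) < ereal (N.G e)" using R.stieltjes_less_lower_edge[OF z] h1(3) e(3) by simp
    thus ?thesis using N.stieltjes_less_iff[of h1 e] h1(1) e(2) by (simp add: F_domain_iff)
  qed
  have "{h' \<in> F_dom. h' < m \<and> F h' = z} = {h1}"
  proof (intro equalityI subsetI)
    fix x assume x: "x \<in> {h' \<in> F_dom. h' < m \<and> F h' = z}"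
    hence "x < e" using m(2)[of x] mk by (force simp: T_def)
    hence "ereal (N.G x) < ereal (N.G e)" using e(2) by (simp add: N.stieltjes_less F_domain_iff)
    hence "N.G x = R.G z" using x e(3) by (intro solution_below_edge_unique[OF z]) auto
    hence "N.G x = N.G h1" using h1(3) by simp
    hence "x = h1" using inj_onD[OF N.stieltjes_inj, of x h1] x h1(1) by (auto simp: F_domain_iff)
    thus "x \<in> {h1}" by simp
  qed (use h1 lt mk in auto)
  hence "F_second_solution \<mu> \<nu> z m" unfolding F_second_solution_def using md mk by simp
  thus ?thesis using mk(2) that by blast
qed

lemma F_domain_nonempty: "F_dom \<noteq> {}"
proof -
  have "R.a - 1 < R.a" by simp
  from F_solution[OF this] show ?thesis by blast
qed

lemma h_second_le: "h_second \<mu> \<nu> z \<le> N.a"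
proof (cases "\<exists>h. F_second_solution \<mu> \<nu> z h")
  case True
  then obtain h where h: "F_second_solution \<mu> \<nu> z h" ..
  thus ?thesis using h_second_eq[OF h] by (auto simp: F_second_solution_def F_domain_iff)
next
  case False
  hence "h_second \<mu> \<nu> z = Sup (F_dom)" by (simp add: h_second_def)
  also have "\<dots> \<le> N.a" by (rule cSup_least[OF F_domain_nonempty]) (auto simp: F_domain_iff)
  finally show ?thesis .
qed

lemma F_domain_eventually:
  assumes "h \<in> F_dom"
  shows "\<forall>\<^sub>F k in nhds h. k \<in> F_dom"
proof -
  have h: "h < N.a" "- N.G h \<in> R_domain \<mu>" using assms by (auto simp: F_domain_iff)
  have "isCont (\<lambda>k. - N.G k) h" using h by (intro continuous_intros N.stieltjes_isCont) auto
  from eventually_compose_filterlim[OF eventually_nhds_in_open[OF M.open_R_domain h(2)] isCont_filterlim_nhds[OF this]]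
  have "\<forall>\<^sub>F k in nhds h. - N.G k \<in> R_domain \<mu>" .
  moreover have "\<forall>\<^sub>F k in nhds h. k \<in> {..<N.a}" using h by (intro eventually_nhds_in_open) auto
  ultimately show ?thesis by eventually_elim (simp add: F_domain_iff)
qed

text \<open>The default value is the supremum of an open set bounded above, hence not a member of
  it. Membership in the domain therefore certifies a genuine second solution, whatever z is.\<close>

lemma h_second_solution:
  assumes "h_second \<mu> \<nu> z \<in> F_dom"
  shows "F_second_solution \<mu> \<nu> z (h_second \<mu> \<nu> z)"
proof (cases "\<exists>h. F_second_solution \<mu> \<nu> z h")
  case True
  then obtain h where h: "F_second_solution \<mu> \<nu> z h" ..
  thus ?thesis using h_second_eq[OF h] by simp
next
  case False
  define s where "s = h_second \<mu> \<nu> z"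
  have s: "s = Sup (F_dom)" "s \<in> F_dom" using False assms by (auto simp: h_second_def s_def)
  obtain d where d: "d > 0" "\<And>k. dist k s < d \<Longrightarrow> k \<in> F_dom"
    using F_domain_eventually[OF s(2)] unfolding eventually_nhds_metric by blast
  have "s + d / 2 \<le> s" unfolding s(1)
  proof (rule cSup_upper)
    show "Sup F_dom + d / 2 \<in> F_dom"
      using d(2)[of "s + d / 2"] d(1) s(1) by (simp add: dist_real_def)
    show "bdd_above (F_dom)" by (rule bdd_aboveI[of _ N.a]) (auto simp: F_domain_iff)
  qed
  thus ?thesis using d(1) by simp
qed

section \<open>Behaviour of E at the second solution\<close>

text \<open>Only the left side of g is controlled: between the two solutions F exceeds z, so E
  increases towards g and g is no local minimum. The sign of R' is not assumed beyond g, which is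
  why an inflection point remains possible.\<close>

lemma E_fun_at_second_solution:
  assumes z: "z < R.a" and h: "h_second \<mu> \<nu> z \<in> F_dom"
    and g: "g = N.G (h_second \<mu> \<nu> z)" and pos: "{0<..<g} \<subseteq> uminus ` R_domain_plus \<mu>"
  shows "E_max z g \<or> inflection_point_on (E_dom z) (E z) g"
proof -
  define h2 where "h2 = h_second \<mu> \<nu> z"
  have sec: "F_second_solution \<mu> \<nu> z h2" using h_second_solution[OF h] by (simp add: h2_def)
  let ?S = "{h' \<in> F_dom. h' < h2 \<and> F h' = z}"
  have h2: "h2 \<in> F_dom" "F h2 = z" "card ?S = 1" using sec by (auto simp: F_second_solution_def)
  have g2: "g = N.G h2" using g by (simp add: h2_def)
  obtain k where k: "?S = {k}" using h2(3) by (rule card_1_singletonE)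
  have "k \<in> ?S" unfolding k by simp
  hence k': "k \<in> F_dom" "k < h2" "F k = z" by auto
  obtain h1 where h1: "h1 \<in> F_dom" "F h1 = z" "N.G h1 = R.G z" using F_solution[OF z] .
  \<comment> \<open>Below the edge value there is only one solution, so two distinct ones force the
    second to lie past it. Then \<open>h1\<close> is left of \<open>h2\<close> and must be the one
    counted.\<close>
  have edge: "R.edge \<le> ereal (N.G h2)"
  proof (rule ccontr)
    assume "\<not> R.edge \<le> ereal (N.G h2)"
    hence e2: "ereal (N.G h2) < R.edge" by simp
    have "N.G k < N.G h2" using k' h2 by (simp add: N.stieltjes_less F_domain_iff)
    hence "ereal (N.G k) < R.edge" using e2 by (metis less_ereal.simps(1) order.strict_trans)
    from solution_below_edge_unique[OF z k'(1,3) this] solution_below_edge_unique[OF z h2(1,2) e2]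
    show False using \<open>N.G k < N.G h2\<close> by simp
  qed
  have "ereal (N.G h1) < ereal (N.G h2)"
    using R.stieltjes_less_lower_edge[OF z] edge h1(3) by (metis less_le_trans)
  hence "h1 < h2" using N.stieltjes_less_iff[of h1 h2] h1 h2 by (simp add: F_domain_iff)
  hence "h1 \<in> ?S" using h1 by simp
  hence kh1: "k = h1" unfolding k by simp
  have above: "z < F x" if x: "h1 < x" "x < h2" for x
  proof (rule F_greater_above[OF z])
    show xd: "x \<in> F_dom" using F_domain_downward[OF h2(1)] x by simp
    have "N.G h1 < N.G x" using x(1) xd by (intro N.stieltjes_less) (auto simp: F_domain_iff)
    thus "R.G z < N.G x" using h1(3) by simp
    fix y assume "y \<in> F_dom" "y \<le> x" "F y = z"
    hence "y \<in> ?S" using x by auto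
    hence "y = h1" unfolding k kh1 by simp
    thus "N.G y \<le> R.G z" using h1(3) by simp
  qed
  have dom: "g \<in> E_dom z" unfolding g2 using h2 by (intro solution_in_E_domain) auto
  have "\<forall>\<^sub>F k in at_left h2. z < F k"
    using eventually_at_left_real[OF \<open>h1 < h2\<close>] by eventually_elim (auto intro: above)
  moreover have "\<forall>\<^sub>F g in at_left (N.G h2). R' (- g) > 0"
  proof -
    have "0 < N.G h2" using h2(1) by (intro N.stieltjes_pos) (simp add: F_domain_iff)
    from eventually_at_left_real[OF this] show ?thesis
    proof eventually_elim
      case (elim x)
      hence "x \<in> uminus ` R_domain_plus \<mu>" using pos g2 by auto
      thus ?case unfolding mem_uminus_R_domain_plus by simp
    qed
  qed
  ultimately have left: "\<forall>\<^sub>F x in at_left g. E z x < E z g"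
    unfolding g2 using E_fun_near_solution(1)[OF h2(1,2)] by blast
  have "\<not> E_min z g"
    by (rule not_local_min_onI[OF open_E_domain _ _ left]) (auto intro: at_le)
  moreover have "E_critical z g"
    unfolding g2 by (rule critical_point_at_solution[OF h2(1,2)])
  ultimately show ?thesis by (auto simp: inflection_point_on_def)
qed

section \<open>The variational formula for the logarithmic potential\<close>

text \<open>The infimum is attained at g1 = G_\<rho>(z): E decreases before it and increases after
  it. Since \<open>E_dom z\<close> need not be an interval, each comparison with g1 also shows that
  the whole segment between g and g1 lies in the domain.\<close>

lemma E_fun_infimum:
  fixes u :: ereal and v :: real
  assumes z: "z < R.a" and u: "u < 0" and v: "R.edge < ereal v"
      "ereal v < stieltjes_left \<nu> (h_second \<mu> \<nu> z)"
    and sub: "{g. u < ereal g \<and> g < v} \<subseteq> uminus ` R_domain_plus \<mu>"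
  shows "ereal (log_potential \<rho> z) = (INF g \<in> E_dom z \<inter> {g. u < ereal g \<and> g < v}. ereal (E z g))"
proof -
  define g1 where "g1 = R.G z"
  obtain h1 where h1: "h1 \<in> F_dom" "F h1 = z" "N.G h1 = g1" using F_solution[OF z] by (auto simp: g1_def)
  have g1pos: "g1 > 0" using R.stieltjes_pos[OF z] by (simp add: g1_def)
  have "ereal g1 < ereal v" unfolding g1_def by (rule less_trans[OF R.stieltjes_less_lower_edge[OF z] v(1)])
  hence g1v: "g1 < v" by simp
  have ug1: "u < ereal g1" using u g1pos by (metis ereal_less(2) order.strict_trans)
  have "stieltjes_left \<nu> (h_second \<mu> \<nu> z) \<le> N.edge"
    using h_second_le[of z] N.stieltjes_less_lower_edge[of "h_second \<mu> \<nu> z"] by (auto simp: stieltjes_left_def)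
  hence vnu: "ereal v < N.edge" using v(2) by simp
  have plus: "- x \<in> R_domain \<mu>" "R' (- x) > 0" if "u < ereal x" "x < v" for x
    using sub that mem_uminus_R_domain_plus[of x] by blast+
  \<comment> \<open>Another solution with coordinate below \<open>v\<close> would lie at or to the
    right of the second solution, contradicting that \<open>v\<close> is less than the value at
    \<open>h_second\<close>.\<close>
  have no: "N.G k \<le> g1" if k: "k \<in> F_dom" "N.G k < v" "F k = z" for k
  proof (rule ccontr)
    assume "\<not> N.G k \<le> g1"
    then obtain m where m: "m \<le> k" "F_second_solution \<mu> \<nu> z m"
      using second_solution_if_solution[OF z k(1,3)] by (auto simp: g1_def)
    have ka: "k < N.a" using k(1) by (simp add: F_domain_iff)
    have "stieltjes_left \<nu> (h_second \<mu> \<nu> z) = ereal (N.G m)"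
      using h_second_eq[OF m(2)] m(1) ka by (simp add: stieltjes_left_def)
    also have "N.G m \<le> N.G k" using N.stieltjes_less[of m k] m(1) ka by (cases "m = k") auto
    hence "ereal (N.G m) \<le> ereal (N.G k)" by simp
    also have "\<dots> < ereal v" using k(2) by simp
    finally show False using v(2) by simp
  qed
  have coord: "\<exists>k\<in>F_dom. N.G k = x" if x: "0 < x" "x < v" for x
  proof -
    have "ereal x < N.edge" using x vnu by (metis less_ereal.simps(1) order.strict_trans)
    then obtain k where k: "k < N.a" "N.G k = x" using N.stieltjes_surj_left[OF x(1)] by blast
    have "u < ereal x" using u x(1) by (metis ereal_less(2) order.strict_trans)
    thus ?thesis using k plus(1)[of x] x by (intro bexI[of _ k]) (auto simp: F_domain_iff)
  qed
  have g1E: "g1 \<in> E_dom z"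
    using solution_in_E_domain[of h1 z] h1 by auto
  have min: "E z g1 \<le> E z g" if g: "g \<in> E_dom z" "u < ereal g" "g < v" for g
  proof (cases g g1 rule: linorder_cases)
    case greater
    have in_dom: "x \<in> E_dom z \<and> (g1 < x \<longrightarrow> E_deriv z x > 0)" if x: "g1 \<le> x" "x \<le> g" for x
    proof (cases "x = g1")
      case False
      hence x1: "g1 < x" "x < v" using x g(3) by auto
      then obtain k where k: "k \<in> F_dom" "N.G k = x" using coord[of x] g1pos by auto
      have Fk: "z < F k"
      proof (rule F_greater_above[OF z k(1)])
        show "R.G z < N.G k" using x1 k by (simp add: g1_def)
        fix y assume y: "y \<in> F_dom" "y \<le> k" "F y = z"
        have "N.G y \<le> N.G k" using N.stieltjes_less[of y k] y(2) k(1) by (cases "y = k") (auto simp: F_domain_iff)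
        thus "N.G y \<le> R.G z" using no[OF y(1) _ y(3)] x1 k by (simp add: g1_def)
      qed
      have xE: "x \<in> E_dom z" using solution_in_E_domain[OF k(1), of z] Fk k(2) by simp
      have "u < ereal x" using ug1 x1(1) by (metis less_ereal.simps(1) order.strict_trans)
      hence "R' (- x) > 0" using plus x1 by blast
      thus ?thesis using E_deriv_pos[of k z] k Fk xE by (simp add: F_domain_iff)
    qed (use g1E in auto)
    have "E z g1 < E z g"
      by (rule deriv_pos_imp_less[of g1 g _ "E_deriv z", OF greater]) (use in_dom E_fun_has_derivative in auto)
    thus ?thesis by simp
  next
    case less
    have in_dom: "x \<in> E_dom z \<and> (x < g1 \<longrightarrow> E_deriv z x < 0)" if x: "g \<le> x" "x \<le> g1" for x
    proof -
      have pl: "- y \<in> R_domain \<mu>" "R' (- y) > 0" if y: "g \<le> y" "y \<le> g1" for y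
      proof -
        have "u < ereal y" using less_le_trans[OF g(2), of "ereal y"] y by simp
        thus "- y \<in> R_domain \<mu>" "R' (- y) > 0" using plus[of y] y g1v by auto
      qed
      \<comment> \<open>With R' positive on the segment, z - R_\<mu>(-x) is at most its value at g1,
        so domain membership passes from g1 to x.\<close>
      have "R_transform \<mu> (- g1) \<le> R_transform \<mu> (- x)"
      proof (rule DERIV_nonneg_imp_nondecreasing[where f = "R_transform \<mu>" and a = "- g1" and b = "- x"])
        show "- g1 \<le> - x" using x by simp
        fix y assume "- g1 \<le> y" "y \<le> - x"
        hence "- (- y) \<in> R_domain \<mu>" "R' (- (- y)) > 0" using pl[of "- y"] x by auto
        hence "y \<in> R_domain \<mu>" "R' y > 0" by auto
        thus "\<exists>d. (R_transform \<mu> has_real_derivative d) (at y) \<and> 0 \<le> d"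
          using real_analytic_at_has_derivative[OF M.real_analytic_at_R_transform] by force
      qed
      hence xE: "x \<in> E_dom z" using g1E pl(1)[OF x] by (auto simp: E_domain_iff)
      moreover have "E_deriv z x < 0" if lt: "x < g1"
      proof (cases "0 < x")
        case True
        then obtain k where k: "k \<in> F_dom" "N.G k = x" using coord[of x] lt g1v by auto
        hence ka: "k < N.a" by (simp add: F_domain_iff)
        have "F k < z" using F_less_below[OF z ka] k lt by (simp add: g1_def)
        thus ?thesis using E_deriv_neg[OF ka, of z] k xE pl(2)[OF x] by simp
      next
        \<comment> \<open>A nonpositive x is no value of G_\<nu> left of its support and has no
          coordinate h, but then x - G_\<nu>(...) is negative outright.\<close>
        case False
        have "N.G (z - R_transform \<mu> (- x)) > 0" using xE by (intro N.stieltjes_pos) (simp add: E_domain_iff)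
        thus ?thesis using False pl(2)[OF x] by (intro mult_pos_neg) auto
      qed
      ultimately show ?thesis by blast
    qed
    have "- E z g < - E z g1"
      by (rule deriv_pos_imp_less[of g g1 _ "\<lambda>x. - E_deriv z x", OF less])
        (use in_dom E_fun_has_derivative in \<open>auto intro!: DERIV_minus\<close>)
    thus ?thesis by simp
  qed simp
  have "ereal (E z g1) = (INF g \<in> E_dom z \<inter> {g. u < ereal g \<and> g < v}. ereal (E z g))"
  proof (rule antisym)
    show "ereal (E z g1) \<le> (INF g \<in> E_dom z \<inter> {g. u < ereal g \<and> g < v}. ereal (E z g))"
      by (rule INF_greatest) (use min in auto)
    show "(INF g \<in> E_dom z \<inter> {g. u < ereal g \<and> g < v}. ereal (E z g)) \<le> ereal (E z g1)"
      by (rule INF_lower) (use g1E ug1 g1v in auto)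
  qed
  thus ?thesis using log_potential_eq_E_fun[OF z] by (simp add: g1_def)
qed

text \<open>The stationary point of \<open>F_edge_point\<close> is the unique maximum of a strictly concave \<open>F\<close>.\<close>

lemma F_less_edge:
  assumes conc: "strictly_concave_on F_dom F" and h: "h \<in> F_dom"
    and ne: "ereal (N.G h) \<noteq> R.edge"
  shows "F h < R.a"
proof (cases "ereal (N.G h) < R.edge")
  case True
  thus ?thesis using F_below_edge[of h] h by (simp add: F_domain_iff)
next
  case False
  hence "R.edge \<le> ereal (N.G h)" by simp
  then obtain k where k: "k \<in> F_dom" "ereal (N.G k) = R.edge" "F k = R.a"
      "(F has_real_derivative 0) (at k)"
    using F_edge_point[OF h] by metis
  have "h \<noteq> k" using ne k(2) by auto
  from strictly_concave_on_less_max[OF conc k(1,4) h this] show ?thesis using k(3) by simp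
qed

lemma F_eq_edge:
  assumes h: "h \<in> F_dom" and e: "ereal (N.G h) = R.edge"
  shows "F h = R.a"
proof -
  obtain k where k: "k \<in> F_dom" "ereal (N.G k) = R.edge" "F k = R.a"
    using F_edge_point[OF h] e by (metis order_refl)
  have "N.G k = N.G h" using k(2) e by (metis ereal.inject)
  hence "k = h" using inj_onD[OF N.stieltjes_inj, of k h] k(1) h by (auto simp: F_domain_iff)
  thus ?thesis using k(3) by simp
qed

text \<open>The only obstacle is g being the edge value of \<nu>, attained by no h. In that case h
  \<le> R.a - R_\<mu>(-G_\<nu>(h)) for all h below the edge of \<nu>, and the limit contradicts the
  strict inequality in \<open>E_domain\<close>.\<close>

lemma edge_in_E_domain:
  assumes g: "g \<in> E_dom R.a" and e: "ereal g = R.edge"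
  obtains h where "h \<in> F_dom" "N.G h = g"
proof -
  have gd: "- g \<in> R_domain \<mu>" "R.a - R_transform \<mu> (- g) < N.a" using g by (auto simp: E_domain_iff)
  have gpos: "g > 0" using R.lower_edge_pos by (simp flip: e)
  have "ereal g \<noteq> N.edge"
  proof
    assume eq: "ereal g = N.edge"
    have "((\<lambda>h. ereal (N.G h)) \<longlongrightarrow> ereal g) (at_left N.a)"
      using N.stieltjes_tendsto_lower_edge unfolding eq N.lower_edge_eq .
    hence lim: "(N.G \<longlongrightarrow> g) (at_left N.a)" by simp
    have "isCont (R_transform \<mu>) (- g)"
      using gd(1) by (intro real_analytic_at_isCont M.real_analytic_at_R_transform)
    from isCont_tendsto_compose[OF this tendsto_minus[OF lim]]
    have limR: "((\<lambda>h. R.a - R_transform \<mu> (- N.G h)) \<longlongrightarrow> R.a - R_transform \<mu> (- g)) (at_left N.a)"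
      by (intro tendsto_diff tendsto_const)
    have "\<forall>\<^sub>F h in at_left N.a. h \<le> R.a - R_transform \<mu> (- N.G h)"
    proof -
      have "\<forall>\<^sub>F h in at_left N.a. h < N.a" by (auto simp: eventually_at_filter)
      thus ?thesis
      proof eventually_elim
        case (elim h)
        have "ereal (N.G h) < R.edge"
          using N.stieltjes_less_lower_edge[OF elim] eq e by simp
        from F_below_edge(2)[OF elim this] show ?case by (simp add: F_fun_def)
      qed
    qed
    from tendsto_le[OF _ limR tendsto_ident_at this] have "N.a \<le> R.a - R_transform \<mu> (- g)" by simp
    thus False using gd(2) by simp
  qed
  hence "ereal g < N.edge" using lower_edge_le(2) e by simp
  then obtain h where "h < N.a" "N.G h = g" using N.stieltjes_surj_left[OF gpos] by blast
  thus ?thesis using gd(1) by (intro that[of h]) (auto simp: F_domain_iff)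
qed

section \<open>Critical points of E for strictly concave F\<close>

context
  fixes z :: real
  assumes conc: "strictly_concave_on F_dom F"
    and plus: "E_dom z \<subseteq> uminus ` R_domain_plus \<mu>"
begin

lemma R'_pos: "g \<in> E_dom z \<Longrightarrow> R' (- g) > 0"
  using plus mem_uminus_R_domain_plus by blast

lemma critical_iff:
  "E_critical z g \<longleftrightarrow> (\<exists>h\<in>F_dom. F h = z \<and> g = N.G h)"
proof
  assume c: "E_critical z g"
  hence "g \<in> E_dom z" by (simp add: critical_point_on_def)
  thus "\<exists>h\<in>F_dom. F h = z \<and> g = N.G h" using c critical_point_E_iff R'_pos by blast
qed (auto intro: critical_point_at_solution)

lemma eventually_R'_pos:
  assumes "g \<in> E_dom z"
  shows "\<forall>\<^sub>F x in at_left g. R' (- x) > 0" "\<forall>\<^sub>F x in at_right g. R' (- x) > 0"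
proof -
  have "\<forall>\<^sub>F x in at g. R' (- x) > 0"
    using eventually_nhds_imp_at[OF E_domain_eventually[OF assms]] by eventually_elim (rule R'_pos)
  thus "\<forall>\<^sub>F x in at_left g. R' (- x) > 0" "\<forall>\<^sub>F x in at_right g. R' (- x) > 0"
    by (simp_all add: eventually_at_split)
qed

lemma no_critical_above_edge: "R.a < z \<Longrightarrow> \<not> E_critical z g"
  unfolding critical_iff using F_less_edge[OF conc] F_eq_edge by (metis less_irrefl less_trans)

lemma critical_at_edge:
  assumes z: "z = R.a"
  shows "E_critical z g \<longleftrightarrow>
      g \<in> E_dom z \<and> ereal g = R.edge"
proof
  assume c: "E_critical z g"
  then obtain h where h: "h \<in> F_dom" "F h = z" "g = N.G h" unfolding critical_iff by blast
  have "ereal (N.G h) = R.edge" using F_less_edge[OF conc h(1)] h(2) z by auto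
  thus "g \<in> E_dom z \<and> ereal g = R.edge"
    using c h(3) by (simp add: critical_point_on_def)
next
  assume g: "g \<in> E_dom z \<and> ereal g = R.edge"
  then obtain h where h: "h \<in> F_dom" "N.G h = g" using edge_in_E_domain z by blast
  have "F h = z" using F_eq_edge[OF h(1)] h(2) g z by simp
  thus "E_critical z g"
    unfolding critical_iff using h by blast
qed

text \<open>F has its strict maximum z at the solution, so F - z is negative on both sides and E
  decreases strictly through the point.\<close>

lemma inflection_at_edge:
  assumes z: "z = R.a" and c: "E_critical z g"
  shows "inflection_point_on (E_dom z) (E z) g"
proof -
  obtain h where h: "h \<in> F_dom" "F h = z" "g = N.G h" using c unfolding critical_iff by blast
  have dom: "g \<in> E_dom z" using c by (simp add: critical_point_on_def)
  have e: "ereal (N.G h) = R.edge" using critical_at_edge[OF z] c h(3) by simp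
  have "\<forall>\<^sub>F k in at h. F k < z"
    using eventually_nhds_imp_at[OF F_domain_eventually[OF h(1)]] eventually_neq_at_within[of h h UNIV]
  proof eventually_elim
    case (elim k)
    have "N.G k \<noteq> N.G h" using inj_onD[OF N.stieltjes_inj, of k h] elim h(1) by (auto simp: F_domain_iff)
    hence "ereal (N.G k) \<noteq> R.edge" using e by (metis ereal.inject)
    thus ?case using F_less_edge[OF conc elim(1)] z by simp
  qed
  hence lr: "\<forall>\<^sub>F k in at_left h. F k < z" "\<forall>\<^sub>F k in at_right h. F k < z"
    by (simp_all add: eventually_at_split)
  have left: "\<forall>\<^sub>F x in at_left g. E z g < E z x"
    using E_fun_near_solution(2)[OF h(1,2)] eventually_R'_pos(1)[OF dom] lr(1) h(3) by blast
  have right: "\<forall>\<^sub>F x in at_right g. E z x < E z g"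
    using E_fun_near_solution(4)[OF h(1,2)] eventually_R'_pos(2)[OF dom] lr(2) h(3) by blast
  have "\<not> E_max z g"
    by (rule not_local_max_onI[OF open_E_domain _ _ left]) (auto intro: at_le)
  moreover have "\<not> E_min z g"
    by (rule not_local_min_onI[OF open_E_domain _ _ right]) (auto intro: at_le)
  ultimately show ?thesis using c by (simp add: inflection_point_on_def)
qed

lemma solution_right_of_stieltjes:
  assumes z: "z < R.a" and h: "h \<in> F_dom" "F h = z" and ne: "N.G h \<noteq> R.G z"
  shows "R.G z < N.G h"
proof (rule ccontr)
  assume "\<not> R.G z < N.G h"
  hence "N.G h < R.G z" using ne by simp
  thus False using F_less_below[OF z, of h] h by (simp add: F_domain_iff)
qed

text \<open>Both further solutions lie right of \<open>h1\<close>; three points on one level would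
  contradict strict concavity at the middle one.\<close>

lemma critical_below_edge_unique:
  assumes z: "z < R.a"
    and "E_critical z g" "E_critical z g'"
    and "g \<noteq> R.G z" "g' \<noteq> R.G z"
  shows "g = g'"
proof -
  obtain h1 where h1: "h1 \<in> F_dom" "F h1 = z" "N.G h1 = R.G z" using F_solution[OF z] .
  obtain h where h: "h \<in> F_dom" "F h = z" "g = N.G h" using assms(2) unfolding critical_iff by blast
  obtain h' where h': "h' \<in> F_dom" "F h' = z" "g' = N.G h'" using assms(3) unfolding critical_iff by blast
  have less: "h1 < k" if "k \<in> F_dom" "F k = z" "N.G k \<noteq> R.G z" for k
    using solution_right_of_stieltjes[OF z that] h1 N.stieltjes_less_iff[of h1 k] that(1) by (simp add: F_domain_iff)
  have no: False if "k \<in> F_dom" "F k = z" "N.G k \<noteq> R.G z" "k' \<in> F_dom" "F k' = z" "k < k'" for k k'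
    using strictly_concave_on_between[OF conc h1(1) that(4) less[OF that(1-3)] that(6), of z] h1(2) that by simp
  have "h = h'"
    using no[of h h'] no[of h' h] h h' assms(4,5) by (cases h h' rule: linorder_cases) auto
  thus ?thesis using h h' by simp
qed

text \<open>Strict concavity puts F above z between the two solutions and below z right of the
  second, so E rises and then falls. The last conclusion serves to single out the local
  minimum.\<close>

lemma local_max_second_critical:
  assumes z: "z < R.a" and c: "E_critical z g" and ne: "g \<noteq> R.G z"
  shows "E_max z g" "R.G z < g"
    "\<not> E_min z g"
proof -
  obtain h1 where h1: "h1 \<in> F_dom" "F h1 = z" "N.G h1 = R.G z" using F_solution[OF z] .
  obtain h where h: "h \<in> F_dom" "F h = z" "g = N.G h" using c unfolding critical_iff by blast
  have dom: "g \<in> E_dom z" using c by (simp add: critical_point_on_def)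
  show gt: "R.G z < g" using solution_right_of_stieltjes[OF z h(1,2)] h(3) ne by simp
  have lt: "h1 < h" using gt h1 h N.stieltjes_less_iff[of h1 h] by (simp add: F_domain_iff)
  have "\<forall>\<^sub>F k in at_left h. z < F k"
    using eventually_at_left_real[OF lt]
  proof eventually_elim
    case (elim k)
    thus ?case using strictly_concave_on_between[OF conc h1(1) h(1), of k z] h1(2) h(2) by auto
  qed
  hence left: "\<forall>\<^sub>F x in at_left g. E z x < E z g"
    using E_fun_near_solution(1)[OF h(1,2)] eventually_R'_pos(1)[OF dom] h(3) by blast
  have "\<forall>\<^sub>F k in at_right h. k \<in> F_dom"
    using F_domain_eventually[OF h(1)] by (rule filter_leD[rotated]) (simp add: at_within_def)
  moreover have "\<forall>\<^sub>F k in at_right h. h < k" by (auto simp: eventually_at_filter)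
  ultimately have "\<forall>\<^sub>F k in at_right h. F k < z"
  proof eventually_elim
    case (elim k)
    show ?case
    proof (rule ccontr)
      assume "\<not> F k < z"
      hence "z < F h" using h1(2) by (intro strictly_concave_on_between[OF conc h1(1) elim(1) lt elim(2)]) auto
      thus False using h(2) by simp
    qed
  qed
  hence right: "\<forall>\<^sub>F x in at_right g. E z x < E z g"
    using E_fun_near_solution(4)[OF h(1,2)] eventually_R'_pos(2)[OF dom] h(3) by blast
  have "\<forall>\<^sub>F x in at g. E z x \<le> E z g"
    using left right by (auto simp: eventually_at_split elim!: eventually_mono)
  thus "E_max z g"
    unfolding local_max_on_def at_within_E_domain[OF dom] using dom by blast
  show "\<not> E_min z g"
    by (rule not_local_min_onI[OF open_E_domain _ _ left]) (auto intro: at_le)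
qed

lemma local_min_at_stieltjes:
  assumes z: "z < R.a"
  shows "E_min z (R.G z)"
proof -
  obtain h where h: "h \<in> F_dom" "F h = z" "N.G h = R.G z" using F_solution[OF z] .
  have ha: "h < N.a" using h(1) by (simp add: F_domain_iff)
  have dom: "N.G h \<in> E_dom z" using h by (intro solution_in_E_domain) auto
  have "\<forall>\<^sub>F k in at_left h. k < h" by (auto simp: eventually_at_filter)
  hence "\<forall>\<^sub>F k in at_left h. F k < z"
  proof eventually_elim
    case (elim k)
    show ?case using N.stieltjes_less[OF elim] elim ha h(3) by (intro F_less_below[OF z]) auto
  qed
  hence left: "\<forall>\<^sub>F x in at_left (N.G h). E z (N.G h) < E z x"
    using E_fun_near_solution(2)[OF h(1,2)] eventually_R'_pos(1)[OF dom] by blast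
  have "\<forall>\<^sub>F k in at_right h. z < F k"
  proof -
    have "\<forall>\<^sub>F y in nhds (N.G h). y \<in> ereal -` {..<R.edge}"
      using R.stieltjes_less_lower_edge[OF z] h(3) by (intro eventually_nhds_in_open open_ereal_vimage) auto
    from eventually_compose_filterlim[OF this isCont_filterlim_nhds[OF N.stieltjes_isCont]]
    have "\<forall>\<^sub>F k in nhds h. ereal (N.G k) < R.edge" using ha by simp
    moreover have "\<forall>\<^sub>F k in nhds h. k \<in> {..<N.a}" using ha by (intro eventually_nhds_in_open) auto
    ultimately have "\<forall>\<^sub>F k in nhds h. ereal (N.G k) < R.edge \<and> k < N.a"
      by eventually_elim simp
    hence "\<forall>\<^sub>F k in at_right h. ereal (N.G k) < R.edge \<and> k < N.a"
      by (rule filter_leD[rotated]) (simp add: at_within_def)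
    moreover have "\<forall>\<^sub>F k in at_right h. h < k" by (auto simp: eventually_at_filter)
    ultimately show ?thesis
    proof eventually_elim
      case (elim k)
      have "ereal (N.G h) < R.edge" using R.stieltjes_less_lower_edge[OF z] h(3) by simp
      thus ?case using F_less_iff[of h k] elim ha h(2) by simp
    qed
  qed
  hence right: "\<forall>\<^sub>F x in at_right (N.G h). E z (N.G h) < E z x"
    using E_fun_near_solution(3)[OF h(1,2)] eventually_R'_pos(2)[OF dom] by blast
  have "\<forall>\<^sub>F x in at (N.G h). E z (N.G h) \<le> E z x"
    using left right by (auto simp: eventually_at_split elim!: eventually_mono)
  hence "E_min z (N.G h)"
    unfolding local_min_on_def at_within_E_domain[OF dom] using dom by blast
  thus ?thesis using h(3) by simp
qed

text \<open>The domain of E is open, so a local minimum is critical by Fermat's theorem; any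
  critical point other than G_\<rho>(z) has smaller values of E immediately beside it.\<close>

lemma local_min_iff:
  assumes z: "z < R.a"
  shows "E_min z g \<longleftrightarrow> g = R.G z"
proof
  assume m: "E_min z g"
  hence dom: "g \<in> E_dom z" by (simp add: local_min_on_def)
  have "\<forall>\<^sub>F x in at g. E z g \<le> E z x"
    using m unfolding local_min_on_def at_within_E_domain[OF dom] by blast
  then obtain d where d: "d > 0" "\<And>x. x \<noteq> g \<Longrightarrow> dist x g < d \<Longrightarrow> E z g \<le> E z x"
    unfolding eventually_at by blast
  have deriv_0: "E_deriv z g = 0"
  proof (rule DERIV_local_min[OF E_fun_has_derivative[OF dom] d(1)], intro allI impI)
    fix y assume "\<bar>g - y\<bar> < d"
    thus "E z g \<le> E z y"
      using d(2)[of y] by (cases "y = g") (auto simp: dist_real_def abs_minus_commute)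
  qed
  have "E_critical z g"
    using E_fun_has_derivative[OF dom] dom unfolding critical_point_on_def deriv_0 by blast
  thus "g = R.G z" using local_max_second_critical(3)[OF z] m by blast
qed (simp add: local_min_at_stieltjes[OF z])

end

end

theorem proposition1p8:
  fixes \<mu> \<nu> \<rho> :: "real measure"
  assumes "compactly_supported \<mu>"
    and "compactly_supported \<nu>"
    and "non_degenerate \<mu>"
    and "is_free_convolution \<mu> \<nu> \<rho>"
  shows
    "(\<forall>z g. z < supp_lower \<rho>
        \<and> h_second \<mu> \<nu> z \<in> F_domain \<mu> \<nu> \<and> F_fun \<mu> \<nu> (h_second \<mu> \<nu> z) = z
        \<and> g = stieltjes \<nu> (h_second \<mu> \<nu> z)
        \<and> {0<..<g} \<subseteq> uminus ` R_domain_plus \<mu>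
        \<longrightarrow> local_max_on (E_domain \<mu> \<nu> z) (E_fun \<mu> \<nu> z) g
            \<or> inflection_point_on (E_domain \<mu> \<nu> z) (E_fun \<mu> \<nu> z) g)
     \<and>
     (\<forall>(z::real) (u::ereal) (v::real). z < supp_lower \<rho> \<and> u < 0
        \<and> stieltjes_lower_edge \<rho> < ereal v \<and> ereal v < stieltjes_left \<nu> (h_second \<mu> \<nu> z)
        \<and> {g. u < ereal g \<and> g < v} \<subseteq> uminus ` R_domain_plus \<mu>
        \<longrightarrow> ereal (log_potential \<rho> z)
            = (INF g \<in> E_domain \<mu> \<nu> z \<inter> {g. u < ereal g \<and> g < v}. ereal (E_fun \<mu> \<nu> z g)))
     \<and>
     (\<forall>z. strictly_concave_on (F_domain \<mu> \<nu>) (F_fun \<mu> \<nu>)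
        \<and> E_domain \<mu> \<nu> z \<subseteq> uminus ` R_domain_plus \<mu>
        \<longrightarrow>
          (supp_lower \<rho> < z \<longrightarrow>
             (\<forall>g. \<not> critical_point_on (E_domain \<mu> \<nu> z) (E_fun \<mu> \<nu> z) g))
        \<and> (z = supp_lower \<rho> \<longrightarrow>
             (\<forall>g. critical_point_on (E_domain \<mu> \<nu> z) (E_fun \<mu> \<nu> z) g
                  \<longleftrightarrow> g \<in> E_domain \<mu> \<nu> z \<and> ereal g = stieltjes_lower_edge \<rho>)
             \<and> (\<forall>g. critical_point_on (E_domain \<mu> \<nu> z) (E_fun \<mu> \<nu> z) g
                  \<longrightarrow> inflection_point_on (E_domain \<mu> \<nu> z) (E_fun \<mu> \<nu> z) g))
        \<and> (z < supp_lower \<rho> \<longrightarrow>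
             (\<forall>g. local_min_on (E_domain \<mu> \<nu> z) (E_fun \<mu> \<nu> z) g \<longleftrightarrow> g = stieltjes \<rho> z)
             \<and> (\<forall>g g'. critical_point_on (E_domain \<mu> \<nu> z) (E_fun \<mu> \<nu> z) g
                     \<and> critical_point_on (E_domain \<mu> \<nu> z) (E_fun \<mu> \<nu> z) g'
                     \<and> g \<noteq> stieltjes \<rho> z \<and> g' \<noteq> stieltjes \<rho> z \<longrightarrow> g = g')
             \<and> (\<forall>g. critical_point_on (E_domain \<mu> \<nu> z) (E_fun \<mu> \<nu> z) g \<and> g \<noteq> stieltjes \<rho> z
                  \<longrightarrow> local_max_on (E_domain \<mu> \<nu> z) (E_fun \<mu> \<nu> z) g \<and> stieltjes \<rho> z < g)))"
proof -
  have "compactly_supported \<rho>" using assms(4) by (simp add: is_free_convolution_def)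
  then interpret free_convolution \<mu> \<nu> \<rho>
    using assms by unfold_locales
  show ?thesis
  proof (intro conjI allI impI, goal_cases)
    case (1 z g)
    thus ?case using E_fun_at_second_solution[of z g] by blast
  next
    case (2 z u v)
    thus ?case using E_fun_infimum[of z u v] by blast
  next
    case (3 z g)
    thus ?case using no_critical_above_edge[of z g] by blast
  next
    case (4 z g)
    thus ?case using critical_at_edge[of z g] by blast
  next
    case (5 z g)
    thus ?case using inflection_at_edge[of z g] by blast
  next
    case (6 z g)
    thus ?case using local_min_iff[of z g] by blast
  next
    case (7 z g g')
    thus ?case using critical_below_edge_unique[of z g g'] by blast
  next
    case (8 z g)
    thus ?case using local_max_second_critical(1)[of z g] by blast
  next
    case (9 z g)
    thus ?case using local_max_second_critical(2)[of z g] by blast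
  qed
qed

end
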